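(* Let $\mu$ be a dominant weight. The polynomial representation $\widetilde{\mathcal P}$ of the oKLRW category $\mathcal O_\mu$ is faithful; that is, for any two objects $X,Y$ of $\mathcal O_\mu$ the map $\operatorname{Hom}_{\mathcal O_\mu}(X,Y)\to\operatorname{Hom}_k(\widetilde{\mathcal P}(X),\widetilde{\mathcal P}(Y))$ is injective.
   Context: $k$ is an algebraically closed field. $Q=(Q_0,Q_1,s,t)$ is a loop-free quiver with at most one arrow (both directions counted) between two distinct vertices; $\tau$ is an involution of $Q_0$ and $Q_1$ with $s(\tau h)=\tau(t(h))$, $t(\tau h)=\tau(s(h))$, with $\tau(s(h))=t(h)$ iff $\tau(h)=h$, and without fixed vertices. $i\to j$ means there is an arrow from $i$ to $j$. A dominant weight is $\theta=\sum_i\theta_i\varpi_i$ with $\theta_i\in\mathbb N$ ($\varpi_i$ fundamental weights). $X_{ij}(u,v)=u-v$ if $j\to i$, and $1$ otherwise; $f_{ij}(u,v)=X_{ij}(u,v)X_{ji}(v,u)$. **KLRW category $\mathcal K$:** the strict $k$-linear monoidal category with generating objects $i\in Q_0$ (black strands) and dominant weights $\theta$ (red strands), generating morphisms $x_i:i\to i$ (dot), $\sigma_{ij}:i\otimes j\to j\otimes i$, $\sigma_{i\theta}:i\otimes\theta\to\theta\otimes i$, $\sigma_{\theta i}:\theta\otimes i\to i\otimes\theta$, and relations ($y_r$ = dot on the $r$-th black strand): $(x_j\otimes1)\sigma_{ij}=\sigma_{ij}(1\otimes x_j)+\delta_{ij}$, $\sigma_{ij}(x_i\otimes1)=(1\otimes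 x_i)\sigma_{ij}+\delta_{ij}$; $\sigma_{ii}^2=0$, $\sigma_{ji}\sigma_{ij}=f_{ij}(y_1,y_2)$ for $i\ne j$; $(\sigma_{jk}\otimes1)(1\otimes\sigma_{ik})(\sigma_{ij}\otimes1)-(1\otimes\sigma_{ij})(\sigma_{ik}\otimes1)(1\otimes\sigma_{jk})=\delta_{i=k\neq j}\frac{f_{ij}(y_3,y_2)-f_{ij}(y_1,y_2)}{y_3-y_1}$; $(\sigma_{\theta j}\otimes1)(1\otimes\sigma_{ij})(\sigma_{i\theta}\otimes1)-(1\otimes\sigma_{i\theta})(\sigma_{ij}\otimes1)(1\otimes\sigma_{\theta j})=\delta_{ij}\sum_{a+b+1=\theta_i}x_i^a\otimes1\otimes x_j^b$; $(\sigma_{j\theta}\otimes1)(1\otimes\sigma_{i\theta})(\sigma_{ij}\otimes1)=(1\otimes\sigma_{ij})(\sigma_{i\theta}\otimes1)(1\otimes\sigma_{j\theta})$, $(\sigma_{ji}\otimes1)(1\otimes\sigma_{\theta i})(\sigma_{\theta j}\otimes1)=(1\otimes\sigma_{\theta j})(\sigma_{\theta i}\otimes1)(1\otimes\sigma_{ji})$; $(x_i\otimes1)\sigma_{\theta i}=\sigma_{\theta i}(1\otimes x_i)$, $\sigma_{i\theta}(x_i\otimes1)=(1\otimes x_i)\sigma_{i\theta}$; $\sigma_{i\theta}\sigma_{\theta i}=1\otimes x_i^{\theta_i}$, $\sigma_{\theta i}\sigma_{i\theta}=x_i^{\theta_i}\otimes1$. **oKLRW category $\mathcal O_\mu$:**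 same objects as $\mathcal K$ (words); morphisms are linear combinations of composites of morphisms of $\mathcal K$ and morphisms $\rho_i\otimes\mathrm{id}_Z$ where $\rho_i:i\to\tau i$, $i\in Q_0$, modulo the consequences (closed under composition and $-\otimes\mathrm{id}_Z$) of the relations of $\mathcal K$ and, with $f^\mu_i(u)=(-u)^{\mu_i}u^{\mu_{\tau i}}$, $\rho_{\tau i}\rho_i=f^\mu_i(-x_i)$, $\rho_ix_i=-x_{\tau i}\rho_i$, and $\sigma_{\tau j,\tau i}(\rho_j\otimes1)\sigma_{\tau i,j}(\rho_i\otimes1)-(\rho_i\otimes1)\sigma_{\tau j,i}(\rho_j\otimes1)\sigma_{ij}=\delta_{\tau i,j}\frac{f^\mu_i(y_1)-f^\mu_j(y_2)}{y_1+y_2}\sigma_{ij}$. **Polynomial representation $\widetilde{\mathcal P}:\mathcal O_\mu\to\mathrm{Vect}_k$:** a word with $n$ black letters goes to $k[Y_1,\dots,Y_n]$. If a generator acts on strands whose first black strand is the $r$-th black strand of the word, then: $x_i$ acts by multiplication by $Y_r$; $\sigma_{\theta i}$ by multiplication by $Y_r^{\theta_i}$; $\sigma_{i\theta}$ by the identity; $\sigma_{ij}$, $i\ne j$, by $f\mapsto X_{ij}(Y_{r+1},Y_r)f^{s_r}$; $\sigma_{ii}$ by $f\mapsto\frac{f^{s_r}-f}{Y_{r+1}-Y_r}$, where $f^{s_r}$ is $f$ with $Y_r,Y_{r+1}$ exchanged; and $\rho_i$ (on the first strand) by $f\mapsto(-Y_1)^{\mu_i}f(-Y_1,Y_2,\dots,Y_n)$.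 *)

theory Defs
  imports
    "Graph_Theory.Digraph"
    "HOL-Library.Poly_Mapping"
    "HOL-Library.FuncSet"
    "HOL-Combinatorics.Transposition"
    "HOL-Computational_Algebra.Polynomial"
begin

locale involutive_quiver = loopfree_digraph Q
  for Q :: "('i, 'a) pre_digraph" +
  fixes \<tau> :: "'i \<Rightarrow> 'i" and \<tau>\<^sub>1 :: "'a \<Rightarrow> 'a"
  assumes at_most_one_arrow:
      "\<lbrakk>h \<in> arcs Q; h' \<in> arcs Q; {tail Q h, head Q h} = {tail Q h', head Q h'}\<rbrakk> \<Longrightarrow> h = h'"
    and tau_verts: "i \<in> verts Q \<Longrightarrow> \<tau> i \<in> verts Q"
    and tau_invol: "i \<in> verts Q \<Longrightarrow> \<tau> (\<tau> i) = i"
    and tau_no_fix: "i \<in> verts Q \<Longrightarrow> \<tau> i \<noteq> i"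
    and tau_arcs: "h \<in> arcs Q \<Longrightarrow> \<tau>\<^sub>1 h \<in> arcs Q"
    and tau_arcs_invol: "h \<in> arcs Q \<Longrightarrow> \<tau>\<^sub>1 (\<tau>\<^sub>1 h) = h"
    and tail_tau: "h \<in> arcs Q \<Longrightarrow> tail Q (\<tau>\<^sub>1 h) = \<tau> (head Q h)"
    and head_tau: "h \<in> arcs Q \<Longrightarrow> head Q (\<tau>\<^sub>1 h) = \<tau> (tail Q h)"
    and tau_fixed_arc: "h \<in> arcs Q \<Longrightarrow> \<tau> (tail Q h) = head Q h \<longleftrightarrow> \<tau>\<^sub>1 h = h"

text \<open>A weight \<open>\<Sum>\<^sub>i \<theta>\<^sub>i \<varpi>\<^sub>i\<close> is its finitely supported family of coefficients \<open>\<theta>\<^sub>i\<close>.\<close>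

type_synonym 'i weight = "'i \<Rightarrow>\<^sub>0 nat"

definition dominant_weights :: "('i, 'a) pre_digraph \<Rightarrow> 'i weight set" where
  "dominant_weights Q = {\<theta>. Poly_Mapping.keys \<theta> \<subseteq> verts Q}"

datatype 'i letter = is_black: Black 'i | Red "'i weight"

type_synonym 'i word = "'i letter list"

definition words :: "('i, 'a) pre_digraph \<Rightarrow> 'i word set" where
  "words Q = lists (Black ` verts Q \<union> Red ` dominant_weights Q)"

definition nblack :: "'i word \<Rightarrow> nat" where
  "nblack w = length (filter is_black w)"

text \<open>One ring with variables \<open>Y\<^sub>r\<close> (\<open>r\<close> a natural number) contains all the \<open>k[Y\<^sub>1, \<dots>, Y\<^sub>n]\<close>, as the
  subrings \<open>polys n\<close>.\<close>

type_synonym 'k mpoly = "(nat \<Rightarrow>\<^sub>0 nat) \<Rightarrow>\<^sub>0 'k"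

definition Var :: "nat \<Rightarrow> 'k::field mpoly" where
  "Var r = Poly_Mapping.single (Poly_Mapping.single r 1) 1"

definition const :: "'k \<Rightarrow> 'k::field mpoly" where
  "const c = Poly_Mapping.single 0 c"

definition polys :: "nat \<Rightarrow> 'k::field mpoly set" where
  "polys n = {p. \<forall>m \<in> Poly_Mapping.keys p. Poly_Mapping.keys m \<subseteq> {1..n}}"

definition subst :: "(nat \<Rightarrow> 'k mpoly) \<Rightarrow> 'k mpoly \<Rightarrow> 'k::field mpoly" where
  "subst s p = (\<Sum>m \<in> Poly_Mapping.keys p. const (Poly_Mapping.lookup p m) *
      (\<Prod>r \<in> Poly_Mapping.keys m. s r ^ Poly_Mapping.lookup m r))"

definition swap :: "nat \<Rightarrow> 'k mpoly \<Rightarrow> 'k::field mpoly" where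
  "swap r = subst (\<lambda>n. Var (transpose r (Suc r) n))"

definition neg1 :: "'k mpoly \<Rightarrow> 'k::field mpoly" where
  "neg1 = subst (Var(1 := - Var 1))"

text \<open>Exact quotient \<open>p / q\<close>; the polynomial ring is a domain, so it is unique for \<open>q \<noteq> 0\<close>. It is
  used only where \<open>q\<close> divides \<open>p\<close>.\<close>

definition quot :: "'k mpoly \<Rightarrow> 'k mpoly \<Rightarrow> 'k::field mpoly" where
  "quot p q = (THE g. q * g = p)"

definition Xfac :: "('i, 'a) pre_digraph \<Rightarrow> 'i \<Rightarrow> 'i \<Rightarrow> 'k mpoly \<Rightarrow> 'k mpoly \<Rightarrow> 'k::field mpoly" where
  "Xfac Q i j u v = (if j \<rightarrow>\<^bsub>Q\<^esub> i then u - v else 1)"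

definition ffac :: "('i, 'a) pre_digraph \<Rightarrow> 'i \<Rightarrow> 'i \<Rightarrow> 'k mpoly \<Rightarrow> 'k mpoly \<Rightarrow> 'k::field mpoly" where
  "ffac Q i j u v = Xfac Q i j u v * Xfac Q j i v u"

definition fmu :: "('i \<Rightarrow> 'i) \<Rightarrow> 'i weight \<Rightarrow> 'i \<Rightarrow> 'k mpoly \<Rightarrow> 'k::field mpoly" where
  "fmu \<tau> \<mu> i u = (- u) ^ Poly_Mapping.lookup \<mu> i * u ^ Poly_Mapping.lookup \<mu> (\<tau> i)"

text \<open>
  The strict monoidal category \<open>\<K>\<close> acts on \<open>\<O>\<^sub>\<mu>\<close> from the right: a morphism of \<open>\<O>\<^sub>\<mu>\<close> may be
  tensored on its right with a morphism of \<open>\<K>\<close>, bifunctorially, while nothing may be placed to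
  the left of a \<open>\<rho>\<^sub>i\<close>. Both categories are given by generators and relations, so a morphism is a
  class of formal expressions, and one type of expressions serves for both.
\<close>

datatype ('i, 'k) mor =
    Ident "'i word"
  | Dot 'i
  | CrossBB 'i 'i
  | CrossBR 'i "'i weight"
  | CrossRB "'i weight" 'i
  | Rho 'i
  | Comp "('i, 'k) mor" "('i, 'k) mor"  (infixr \<open>\<cdot>\<close> 70)
  | Tens "('i, 'k) mor" "('i, 'k) mor"  (infixr \<open>\<otimes>\<close> 75)
  | Zero "'i word" "'i word"
  | Add "('i, 'k) mor" "('i, 'k) mor"  (infixl \<open>\<oplus>\<close> 65)
  | Scale 'k "('i, 'k) mor"  (infixr \<open>\<odot>\<close> 68)

text \<open>Composition is written as for functions: \<open>g \<cdot> f\<close> is \<open>f\<close> followed by \<open>g\<close>.\<close>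

primrec src :: "('i, 'k) mor \<Rightarrow> 'i word" where
  "src (Ident w) = w"
| "src (Dot i) = [Black i]"
| "src (CrossBB i j) = [Black i, Black j]"
| "src (CrossBR i \<theta>) = [Black i, Red \<theta>]"
| "src (CrossRB \<theta> i) = [Red \<theta>, Black i]"
| "src (Rho i) = [Black i]"
| "src (g \<cdot> f) = src f"
| "src (f \<otimes> g) = src f @ src g"
| "src (Zero v w) = v"
| "src (f \<oplus> g) = src f"
| "src (c \<odot> f) = src f"

primrec tgt :: "('i \<Rightarrow> 'i) \<Rightarrow> ('i, 'k) mor \<Rightarrow> 'i word" where
  "tgt \<tau> (Ident w) = w"
| "tgt \<tau> (Dot i) = [Black i]"
| "tgt \<tau> (CrossBB i j) = [Black j, Black i]"
| "tgt \<tau> (CrossBR i \<theta>) = [Red \<theta>, Black i]"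
| "tgt \<tau> (CrossRB \<theta> i) = [Black i, Red \<theta>]"
| "tgt \<tau> (Rho i) = [Black (\<tau> i)]"
| "tgt \<tau> (g \<cdot> f) = tgt \<tau> g"
| "tgt \<tau> (f \<otimes> g) = tgt \<tau> f @ tgt \<tau> g"
| "tgt \<tau> (Zero v w) = w"
| "tgt \<tau> (f \<oplus> g) = tgt \<tau> f"
| "tgt \<tau> (c \<odot> f) = tgt \<tau> f"

datatype cat = KLRW | oKLRW

primrec mor_in :: "('i, 'a) pre_digraph \<Rightarrow> ('i \<Rightarrow> 'i) \<Rightarrow> cat \<Rightarrow> ('i, 'k) mor \<Rightarrow> bool" where
  "mor_in Q \<tau> C (Ident w) \<longleftrightarrow> w \<in> words Q"
| "mor_in Q \<tau> C (Dot i) \<longleftrightarrow> i \<in> verts Q"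
| "mor_in Q \<tau> C (CrossBB i j) \<longleftrightarrow> i \<in> verts Q \<and> j \<in> verts Q"
| "mor_in Q \<tau> C (CrossBR i \<theta>) \<longleftrightarrow> i \<in> verts Q \<and> \<theta> \<in> dominant_weights Q"
| "mor_in Q \<tau> C (CrossRB \<theta> i) \<longleftrightarrow> i \<in> verts Q \<and> \<theta> \<in> dominant_weights Q"
| "mor_in Q \<tau> C (Rho i) \<longleftrightarrow> C = oKLRW \<and> i \<in> verts Q"
| "mor_in Q \<tau> C (g \<cdot> f) \<longleftrightarrow> mor_in Q \<tau> C g \<and> mor_in Q \<tau> C f \<and> src g = tgt \<tau> f"
| "mor_in Q \<tau> C (f \<otimes> g) \<longleftrightarrow> mor_in Q \<tau> C f \<and> mor_in Q \<tau> KLRW g"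
| "mor_in Q \<tau> C (Zero v w) \<longleftrightarrow> v \<in> words Q \<and> w \<in> words Q"
| "mor_in Q \<tau> C (f \<oplus> g) \<longleftrightarrow>
     mor_in Q \<tau> C f \<and> mor_in Q \<tau> C g \<and> src f = src g \<and> tgt \<tau> f = tgt \<tau> g"
| "mor_in Q \<tau> C (c \<odot> f) \<longleftrightarrow> mor_in Q \<tau> C f"

abbreviation Diff :: "('i, 'k::field) mor \<Rightarrow> ('i, 'k) mor \<Rightarrow> ('i, 'k) mor" (infixl \<open>\<ominus>\<close> 65) where
  "f \<ominus> g \<equiv> f \<oplus> (- 1) \<odot> g"

text \<open>\<open>dots w p\<close> is the endomorphism of \<open>w\<close> obtained from \<open>p\<close> by putting the dot \<open>y\<^sub>r\<close> on the
  \<open>r\<close>-th black strand for \<open>Y\<^sub>r\<close>; meant for \<open>p \<in> polys (nblack w)\<close>.\<close>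

primrec dotpow :: "'i \<Rightarrow> nat \<Rightarrow> ('i, 'k) mor" where
  "dotpow i 0 = Ident [Black i]"
| "dotpow i (Suc a) = Dot i \<cdot> dotpow i a"

primrec dotmonom :: "nat \<Rightarrow> 'i word \<Rightarrow> (nat \<Rightarrow>\<^sub>0 nat) \<Rightarrow> ('i, 'k) mor" where
  "dotmonom r [] m = Ident []"
| "dotmonom r (l # w) m =
    (case l of
      Black i \<Rightarrow> dotpow i (Poly_Mapping.lookup m r) \<otimes> dotmonom (Suc r) w m
    | Red \<theta> \<Rightarrow> Ident [Red \<theta>] \<otimes> dotmonom r w m)"

definition dots :: "'i word \<Rightarrow> 'k mpoly \<Rightarrow> ('i, 'k::field) mor" where
  "dots w p = foldr (\<lambda>m f. Poly_Mapping.lookup p m \<odot> dotmonom 1 w m \<oplus> f)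
      (sorted_list_of_set (Poly_Mapping.keys p)) (Zero w w)"

inductive klrw_rel :: "('i, 'a) pre_digraph \<Rightarrow> ('i, 'k::field) mor \<Rightarrow> ('i, 'k) mor \<Rightarrow> bool"
  for Q :: "('i, 'a) pre_digraph" where
  klrw_dot_cross:
    "\<lbrakk>i \<in> verts Q; j \<in> verts Q\<rbrakk> \<Longrightarrow> klrw_rel Q
      ((Dot j \<otimes> Ident [Black i]) \<cdot> CrossBB i j)
      (CrossBB i j \<cdot> (Ident [Black i] \<otimes> Dot j) \<oplus>
        (if i = j then Ident [Black i, Black j] else Zero [Black i, Black j] [Black j, Black i]))"
| klrw_cross_dot:
    "\<lbrakk>i \<in> verts Q; j \<in> verts Q\<rbrakk> \<Longrightarrow> klrw_rel Q
      (CrossBB i j \<cdot> (Dot i \<otimes> Ident [Black j]))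
      ((Ident [Black j] \<otimes> Dot i) \<cdot> CrossBB i j \<oplus>
        (if i = j then Ident [Black i, Black j] else Zero [Black i, Black j] [Black j, Black i]))"
| klrw_cross_cross_same:
    "i \<in> verts Q \<Longrightarrow> klrw_rel Q
      (CrossBB i i \<cdot> CrossBB i i) (Zero [Black i, Black i] [Black i, Black i])"
| klrw_cross_cross:
    "\<lbrakk>i \<in> verts Q; j \<in> verts Q; i \<noteq> j\<rbrakk> \<Longrightarrow> klrw_rel Q
      (CrossBB j i \<cdot> CrossBB i j) (dots [Black i, Black j] (ffac Q i j (Var 1) (Var 2)))"
| klrw_braid:
    "\<lbrakk>i \<in> verts Q; j \<in> verts Q; k \<in> verts Q\<rbrakk> \<Longrightarrow> klrw_rel Q
      ((CrossBB j k \<otimes> Ident [Black i]) \<cdot> (Ident [Black j] \<otimes> CrossBB i k) \<cdot>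
          (CrossBB i j \<otimes> Ident [Black k])
        \<ominus> (Ident [Black k] \<otimes> CrossBB i j) \<cdot> (CrossBB i k \<otimes> Ident [Black j]) \<cdot>
          (Ident [Black i] \<otimes> CrossBB j k))
      (if i = k \<and> k \<noteq> j
       then dots [Black i, Black j, Black k]
         (quot (ffac Q i j (Var 3) (Var 2) - ffac Q i j (Var 1) (Var 2)) (Var 3 - Var 1))
       else Zero [Black i, Black j, Black k] [Black k, Black j, Black i])"
| klrw_red_middle:
    "\<lbrakk>i \<in> verts Q; j \<in> verts Q; \<theta> \<in> dominant_weights Q\<rbrakk> \<Longrightarrow> klrw_rel Q
      ((CrossRB \<theta> j \<otimes> Ident [Black i]) \<cdot> (Ident [Red \<theta>] \<otimes> CrossBB i j) \<cdot>
          (CrossBR i \<theta> \<otimes> Ident [Black j])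
        \<ominus> (Ident [Black j] \<otimes> CrossBR i \<theta>) \<cdot> (CrossBB i j \<otimes> Ident [Red \<theta>]) \<cdot>
          (Ident [Black i] \<otimes> CrossRB \<theta> j))
      (if i = j
       then dots [Black i, Red \<theta>, Black j]
         (\<Sum>(a, b) \<in> {(a, b). a + b + 1 = Poly_Mapping.lookup \<theta> i}. Var 1 ^ a * Var 2 ^ b)
       else Zero [Black i, Red \<theta>, Black j] [Black j, Red \<theta>, Black i])"
| klrw_red_right:
    "\<lbrakk>i \<in> verts Q; j \<in> verts Q; \<theta> \<in> dominant_weights Q\<rbrakk> \<Longrightarrow> klrw_rel Q
      ((CrossBR j \<theta> \<otimes> Ident [Black i]) \<cdot> (Ident [Black j] \<otimes> CrossBR i \<theta>) \<cdot>
        (CrossBB i j \<otimes> Ident [Red \<theta>]))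
      ((Ident [Red \<theta>] \<otimes> CrossBB i j) \<cdot> (CrossBR i \<theta> \<otimes> Ident [Black j]) \<cdot>
        (Ident [Black i] \<otimes> CrossBR j \<theta>))"
| klrw_red_left:
    "\<lbrakk>i \<in> verts Q; j \<in> verts Q; \<theta> \<in> dominant_weights Q\<rbrakk> \<Longrightarrow> klrw_rel Q
      ((CrossBB j i \<otimes> Ident [Red \<theta>]) \<cdot> (Ident [Black j] \<otimes> CrossRB \<theta> i) \<cdot>
        (CrossRB \<theta> j \<otimes> Ident [Black i]))
      ((Ident [Black i] \<otimes> CrossRB \<theta> j) \<cdot> (CrossRB \<theta> i \<otimes> Ident [Black j]) \<cdot>
        (Ident [Red \<theta>] \<otimes> CrossBB j i))"
| klrw_dot_red_left:
    "\<lbrakk>i \<in> verts Q; \<theta> \<in> dominant_weights Q\<rbrakk> \<Longrightarrow> klrw_rel Q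
      ((Dot i \<otimes> Ident [Red \<theta>]) \<cdot> CrossRB \<theta> i) (CrossRB \<theta> i \<cdot> (Ident [Red \<theta>] \<otimes> Dot i))"
| klrw_dot_red_right:
    "\<lbrakk>i \<in> verts Q; \<theta> \<in> dominant_weights Q\<rbrakk> \<Longrightarrow> klrw_rel Q
      (CrossBR i \<theta> \<cdot> (Dot i \<otimes> Ident [Red \<theta>])) ((Ident [Red \<theta>] \<otimes> Dot i) \<cdot> CrossBR i \<theta>)"
| klrw_red_red_left:
    "\<lbrakk>i \<in> verts Q; \<theta> \<in> dominant_weights Q\<rbrakk> \<Longrightarrow> klrw_rel Q
      (CrossBR i \<theta> \<cdot> CrossRB \<theta> i) (Ident [Red \<theta>] \<otimes> dotpow i (Poly_Mapping.lookup \<theta> i))"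
| klrw_red_red_right:
    "\<lbrakk>i \<in> verts Q; \<theta> \<in> dominant_weights Q\<rbrakk> \<Longrightarrow> klrw_rel Q
      (CrossRB \<theta> i \<cdot> CrossBR i \<theta>) (dotpow i (Poly_Mapping.lookup \<theta> i) \<otimes> Ident [Red \<theta>])"

inductive oklrw_rel ::
    "('i, 'a) pre_digraph \<Rightarrow> ('i \<Rightarrow> 'i) \<Rightarrow> 'i weight \<Rightarrow> ('i, 'k::field) mor \<Rightarrow> ('i, 'k) mor \<Rightarrow> bool"
  for Q :: "('i, 'a) pre_digraph" and \<tau> :: "'i \<Rightarrow> 'i" and \<mu> :: "'i weight" where
  oklrw_rho_rho:
    "i \<in> verts Q \<Longrightarrow> oklrw_rel Q \<tau> \<mu>
      (Rho (\<tau> i) \<cdot> Rho i) (dots [Black i] (fmu \<tau> \<mu> i (- Var 1)))"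
| oklrw_rho_dot:
    "i \<in> verts Q \<Longrightarrow> oklrw_rel Q \<tau> \<mu>
      (Rho i \<cdot> Dot i) ((- 1) \<odot> (Dot (\<tau> i) \<cdot> Rho i))"
| oklrw_rho_cross:
    "\<lbrakk>i \<in> verts Q; j \<in> verts Q\<rbrakk> \<Longrightarrow> oklrw_rel Q \<tau> \<mu>
      (CrossBB (\<tau> j) (\<tau> i) \<cdot> (Rho j \<otimes> Ident [Black (\<tau> i)]) \<cdot>
          CrossBB (\<tau> i) j \<cdot> (Rho i \<otimes> Ident [Black j])
        \<ominus> (Rho i \<otimes> Ident [Black (\<tau> j)]) \<cdot> CrossBB (\<tau> j) i \<cdot>
          (Rho j \<otimes> Ident [Black i]) \<cdot> CrossBB i j)
      (if \<tau> i = j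
       then dots [Black j, Black i] (quot (fmu \<tau> \<mu> i (Var 1) - fmu \<tau> \<mu> j (Var 2)) (Var 1 + Var 2)) \<cdot>
         CrossBB i j
       else Zero [Black i, Black j] [Black (\<tau> i), Black (\<tau> j)])"

text \<open>Equality of morphisms: the smallest congruence that satisfies the axioms of a \<open>k\<close>-linear
  strict monoidal category (for \<open>\<O>\<^sub>\<mu>\<close>: of a \<open>k\<close>-linear strict right module category over \<open>\<K>\<close>)
  and the relations above.\<close>

inductive mor_eq ::
    "('i, 'a) pre_digraph \<Rightarrow> ('i \<Rightarrow> 'i) \<Rightarrow> 'i weight \<Rightarrow> cat \<Rightarrow>
      ('i, 'k::field) mor \<Rightarrow> ('i, 'k) mor \<Rightarrow> bool"
  for Q :: "('i, 'a) pre_digraph" and \<tau> :: "'i \<Rightarrow> 'i" and \<mu> :: "'i weight" where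
  meq_klrw_rel: "klrw_rel Q f g \<Longrightarrow> mor_eq Q \<tau> \<mu> C f g"
| meq_oklrw_rel: "oklrw_rel Q \<tau> \<mu> f g \<Longrightarrow> mor_eq Q \<tau> \<mu> oKLRW f g"
| meq_refl: "mor_in Q \<tau> C f \<Longrightarrow> mor_eq Q \<tau> \<mu> C f f"
| meq_sym: "mor_eq Q \<tau> \<mu> C f g \<Longrightarrow> mor_eq Q \<tau> \<mu> C g f"
| meq_trans: "mor_eq Q \<tau> \<mu> C f g \<Longrightarrow> mor_eq Q \<tau> \<mu> C g h \<Longrightarrow> mor_eq Q \<tau> \<mu> C f h"
| meq_comp_cong: "\<lbrakk>mor_eq Q \<tau> \<mu> C g g'; mor_eq Q \<tau> \<mu> C f f'; src g = tgt \<tau> f\<rbrakk> \<Longrightarrow>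
    mor_eq Q \<tau> \<mu> C (g \<cdot> f) (g' \<cdot> f')"
| meq_tens_cong: "\<lbrakk>mor_eq Q \<tau> \<mu> C f f'; mor_eq Q \<tau> \<mu> KLRW g g'\<rbrakk> \<Longrightarrow>
    mor_eq Q \<tau> \<mu> C (f \<otimes> g) (f' \<otimes> g')"
| meq_add_cong: "\<lbrakk>mor_eq Q \<tau> \<mu> C f f'; mor_eq Q \<tau> \<mu> C g g'; src f = src g; tgt \<tau> f = tgt \<tau> g\<rbrakk> \<Longrightarrow>
    mor_eq Q \<tau> \<mu> C (f \<oplus> g) (f' \<oplus> g')"
| meq_scale_cong: "mor_eq Q \<tau> \<mu> C f f' \<Longrightarrow> mor_eq Q \<tau> \<mu> C (c \<odot> f) (c \<odot> f')"
| meq_comp_assoc: "mor_in Q \<tau> C ((h \<cdot> g) \<cdot> f) \<Longrightarrow> mor_eq Q \<tau> \<mu> C ((h \<cdot> g) \<cdot> f) (h \<cdot> g \<cdot> f)"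
| meq_comp_id_left: "mor_in Q \<tau> C f \<Longrightarrow> mor_eq Q \<tau> \<mu> C (Ident (tgt \<tau> f) \<cdot> f) f"
| meq_comp_id_right: "mor_in Q \<tau> C f \<Longrightarrow> mor_eq Q \<tau> \<mu> C (f \<cdot> Ident (src f)) f"
| meq_add_assoc: "mor_in Q \<tau> C (f \<oplus> g \<oplus> h) \<Longrightarrow> mor_eq Q \<tau> \<mu> C (f \<oplus> g \<oplus> h) (f \<oplus> (g \<oplus> h))"
| meq_add_commute: "mor_in Q \<tau> C (f \<oplus> g) \<Longrightarrow> mor_eq Q \<tau> \<mu> C (f \<oplus> g) (g \<oplus> f)"
| meq_add_zero: "mor_in Q \<tau> C f \<Longrightarrow> mor_eq Q \<tau> \<mu> C (f \<oplus> Zero (src f) (tgt \<tau> f)) f"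
| meq_add_minus: "mor_in Q \<tau> C f \<Longrightarrow> mor_eq Q \<tau> \<mu> C (f \<ominus> f) (Zero (src f) (tgt \<tau> f))"
| meq_scale_add_right: "mor_in Q \<tau> C (f \<oplus> g) \<Longrightarrow>
    mor_eq Q \<tau> \<mu> C (c \<odot> (f \<oplus> g)) (c \<odot> f \<oplus> c \<odot> g)"
| meq_scale_add_left: "mor_in Q \<tau> C f \<Longrightarrow> mor_eq Q \<tau> \<mu> C ((c + d) \<odot> f) (c \<odot> f \<oplus> d \<odot> f)"
| meq_scale_scale: "mor_in Q \<tau> C f \<Longrightarrow> mor_eq Q \<tau> \<mu> C (c \<odot> d \<odot> f) ((c * d) \<odot> f)"
| meq_scale_one: "mor_in Q \<tau> C f \<Longrightarrow> mor_eq Q \<tau> \<mu> C (1 \<odot> f) f"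
| meq_comp_add_left: "mor_in Q \<tau> C ((g \<oplus> g') \<cdot> f) \<Longrightarrow>
    mor_eq Q \<tau> \<mu> C ((g \<oplus> g') \<cdot> f) (g \<cdot> f \<oplus> g' \<cdot> f)"
| meq_comp_add_right: "mor_in Q \<tau> C (g \<cdot> (f \<oplus> f')) \<Longrightarrow>
    mor_eq Q \<tau> \<mu> C (g \<cdot> (f \<oplus> f')) (g \<cdot> f \<oplus> g \<cdot> f')"
| meq_comp_scale_left: "mor_in Q \<tau> C (g \<cdot> f) \<Longrightarrow> mor_eq Q \<tau> \<mu> C ((c \<odot> g) \<cdot> f) (c \<odot> (g \<cdot> f))"
| meq_comp_scale_right: "mor_in Q \<tau> C (g \<cdot> f) \<Longrightarrow> mor_eq Q \<tau> \<mu> C (g \<cdot> (c \<odot> f)) (c \<odot> (g \<cdot> f))"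
| meq_tens_add_left: "mor_in Q \<tau> C ((f \<oplus> f') \<otimes> g) \<Longrightarrow>
    mor_eq Q \<tau> \<mu> C ((f \<oplus> f') \<otimes> g) (f \<otimes> g \<oplus> f' \<otimes> g)"
| meq_tens_add_right: "mor_in Q \<tau> C (f \<otimes> (g \<oplus> g')) \<Longrightarrow>
    mor_eq Q \<tau> \<mu> C (f \<otimes> (g \<oplus> g')) (f \<otimes> g \<oplus> f \<otimes> g')"
| meq_tens_scale_left: "mor_in Q \<tau> C (f \<otimes> g) \<Longrightarrow> mor_eq Q \<tau> \<mu> C ((c \<odot> f) \<otimes> g) (c \<odot> (f \<otimes> g))"
| meq_tens_scale_right: "mor_in Q \<tau> C (f \<otimes> g) \<Longrightarrow> mor_eq Q \<tau> \<mu> C (f \<otimes> (c \<odot> g)) (c \<odot> (f \<otimes> g))"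
| meq_tens_ident: "\<lbrakk>v \<in> words Q; w \<in> words Q\<rbrakk> \<Longrightarrow>
    mor_eq Q \<tau> \<mu> C (Ident v \<otimes> Ident w) (Ident (v @ w))"
| meq_interchange: "mor_in Q \<tau> C ((g \<cdot> f) \<otimes> (g' \<cdot> f')) \<Longrightarrow>
    mor_eq Q \<tau> \<mu> C ((g \<cdot> f) \<otimes> (g' \<cdot> f')) ((g \<otimes> g') \<cdot> (f \<otimes> f'))"
| meq_tens_assoc: "mor_in Q \<tau> C ((f \<otimes> g) \<otimes> h) \<Longrightarrow>
    mor_eq Q \<tau> \<mu> C ((f \<otimes> g) \<otimes> h) (f \<otimes> g \<otimes> h)"
| meq_tens_unit_left: "mor_in Q \<tau> C (Ident [] \<otimes> f) \<Longrightarrow> mor_eq Q \<tau> \<mu> C (Ident [] \<otimes> f) f"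
| meq_tens_unit_right: "mor_in Q \<tau> C f \<Longrightarrow> mor_eq Q \<tau> \<mu> C (f \<otimes> Ident []) f"

definition oKLRW_exprs ::
    "('i, 'a) pre_digraph \<Rightarrow> ('i \<Rightarrow> 'i) \<Rightarrow> 'i word \<Rightarrow> 'i word \<Rightarrow> ('i, 'k::field) mor set" where
  "oKLRW_exprs Q \<tau> v w = {f. mor_in Q \<tau> oKLRW f \<and> src f = v \<and> tgt \<tau> f = w}"

definition oKLRW_eq ::
    "('i, 'a) pre_digraph \<Rightarrow> ('i \<Rightarrow> 'i) \<Rightarrow> 'i weight \<Rightarrow> 'i word \<Rightarrow> 'i word \<Rightarrow>
      (('i, 'k::field) mor \<times> ('i, 'k) mor) set" where
  "oKLRW_eq Q \<tau> \<mu> v w = {(f, g) \<in> oKLRW_exprs Q \<tau> v w \<times> oKLRW_exprs Q \<tau> v w.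
      mor_eq Q \<tau> \<mu> oKLRW f g}"

definition oKLRW_Hom ::
    "('i, 'a) pre_digraph \<Rightarrow> ('i \<Rightarrow> 'i) \<Rightarrow> 'i weight \<Rightarrow> 'i word \<Rightarrow> 'i word \<Rightarrow>
      ('i, 'k::field) mor set set" where
  "oKLRW_Hom Q \<tau> \<mu> v w = oKLRW_exprs Q \<tau> v w // oKLRW_eq Q \<tau> \<mu> v w"

text \<open>\<open>act Q \<mu> r f\<close> is the operator of \<open>f\<close> when the first black strand of \<open>f\<close> is the \<open>r\<close>-th black
  strand of the ambient word.\<close>

primrec act :: "('i, 'a) pre_digraph \<Rightarrow> 'i weight \<Rightarrow> nat \<Rightarrow> ('i, 'k::field) mor \<Rightarrow>
    'k mpoly \<Rightarrow> 'k mpoly" where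
  "act Q \<mu> r (Ident w) p = p"
| "act Q \<mu> r (Dot i) p = Var r * p"
| "act Q \<mu> r (CrossBB i j) p =
    (if i = j then quot (swap r p - p) (Var (Suc r) - Var r)
     else Xfac Q i j (Var (Suc r)) (Var r) * swap r p)"
| "act Q \<mu> r (CrossBR i \<theta>) p = p"
| "act Q \<mu> r (CrossRB \<theta> i) p = Var r ^ Poly_Mapping.lookup \<theta> i * p"
| "act Q \<mu> r (Rho i) p = (- Var 1) ^ Poly_Mapping.lookup \<mu> i * neg1 p"
| "act Q \<mu> r (g \<cdot> f) p = act Q \<mu> r g (act Q \<mu> r f p)"
| "act Q \<mu> r (f \<otimes> g) p = act Q \<mu> r f (act Q \<mu> (r + nblack (src f)) g p)"
| "act Q \<mu> r (Zero v w) p = 0"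
| "act Q \<mu> r (f \<oplus> g) p = act Q \<mu> r f p + act Q \<mu> r g p"
| "act Q \<mu> r (c \<odot> f) p = const c * act Q \<mu> r f p"

definition poly_op :: "('i, 'a) pre_digraph \<Rightarrow> 'i weight \<Rightarrow> ('i, 'k::field) mor \<Rightarrow>
    'k mpoly \<Rightarrow> 'k mpoly" where
  "poly_op Q \<mu> f = restrict (act Q \<mu> 1 f) (polys (nblack (src f)))"

text \<open>\<open>poly_op\<close> is constant on the classes of expressions, see \<open>poly_rep_class\<close> below.\<close>

definition poly_rep :: "('i, 'a) pre_digraph \<Rightarrow> 'i weight \<Rightarrow> ('i, 'k::field) mor set \<Rightarrow>
    'k mpoly \<Rightarrow> 'k mpoly" where
  "poly_rep Q \<mu> F = the_elem (poly_op Q \<mu> ` F)"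

lemma const_add: "const (a + b) = const a + const b"
  by (simp add: const_def single_add)
lemma const_mult: "const (a * b) = const a * const b"
  by (simp add: const_def mult_single)
lemma const_0 [simp]: "const 0 = 0"
  by (simp add: const_def)
lemma const_1 [simp]: "const 1 = 1"
  by (simp add: const_def)
lemma const_uminus: "const (- a) = - const a"
  by (simp add: const_def single_uminus)

lemma Var_power: "Var r ^ a = Poly_Mapping.single (Poly_Mapping.single r a) (1::'k::field)"
proof (induction a)
  case 0 then show ?case by simp
next
  case (Suc a)
  then show ?case
    by (simp add: Var_def mult_single single_add[symmetric])
qed

lemma monom_expand:
  "Poly_Mapping.single m (c::'k::field) =
     const c * (\<Prod>r \<in> Poly_Mapping.keys m. Var r ^ Poly_Mapping.lookup m r)"
proof -
  have *: "(\<Prod>r \<in> A. Poly_Mapping.single (Poly_Mapping.single r (Poly_Mapping.lookup m r)) (1::'k)) =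
      Poly_Mapping.single (\<Sum>r\<in>A. Poly_Mapping.single r (Poly_Mapping.lookup m r)) 1" if "finite A" for A
    using that by induction (simp_all add: mult_single)
  have "(\<Sum>r\<in>Poly_Mapping.keys m. Poly_Mapping.single r (Poly_Mapping.lookup m r)) = m"
    by (rule poly_mapping_eqI)
      (simp add: lookup_sum lookup_single when_def in_keys_iff)
  then show ?thesis
    by (simp add: Var_power * const_def mult_single)
qed

lemma mpoly_sum: "p = (\<Sum>m \<in> Poly_Mapping.keys p. Poly_Mapping.single m (Poly_Mapping.lookup p m))"
  by (rule poly_mapping_eqI) (simp add: lookup_sum lookup_single when_def in_keys_iff)

lemma mpoly_induct [case_names const var add mult]:
  assumes "\<And>c. P (const c)" "\<And>r. P (Var r)" "\<And>p q. P p \<Longrightarrow> P q \<Longrightarrow> P (p + q)"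
    "\<And>p q. P p \<Longrightarrow> P q \<Longrightarrow> P (p * q)"
  shows "P (p :: 'k::field mpoly)"
proof -
  have pow: "P (Var r ^ a)" for r a
    by (induction a) (use assms(1)[of 1] assms(2,4) in auto)
  have prod: "P (\<Prod>r \<in> A. Var r ^ f r)" if "finite A" for A and f :: "nat \<Rightarrow> nat"
    using that by induction (use assms(1)[of 1] assms(4) pow in auto)
  have sm: "P (\<Sum>m \<in> A. f m)" if "finite A" "\<And>m. P (f m)" for A and f :: "_ \<Rightarrow> 'k mpoly"
    using that by (induction A rule: finite_induct) (use assms(1)[of 0] assms(3) in auto)
  have "P (\<Sum>m \<in> Poly_Mapping.keys p. Poly_Mapping.single m (Poly_Mapping.lookup p m))"
    by (rule sm) (simp_all add: monom_expand assms prod)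
  then show ?thesis by (simp flip: mpoly_sum)
qed

lemma subst_superset:
  assumes "finite A" "Poly_Mapping.keys p \<subseteq> A"
  shows "subst s p = (\<Sum>m \<in> A. const (Poly_Mapping.lookup p m) *
      (\<Prod>r \<in> Poly_Mapping.keys m. s r ^ Poly_Mapping.lookup m r))"
  unfolding subst_def
  by (rule sum.mono_neutral_left) (use assms in \<open>auto simp: in_keys_iff\<close>)

lemma subst_add: "subst s (p + q) = subst s p + subst s q"
proof -
  let ?A = "Poly_Mapping.keys p \<union> Poly_Mapping.keys q"
  have "Poly_Mapping.keys (p + q) \<subseteq> ?A" by (rule keys_add)
  then show ?thesis
    by (subst (1 2 3) subst_superset[of ?A])
      (auto simp: lookup_add const_add distrib_right sum.distrib)
qed

lemma subst_single: "subst s (Poly_Mapping.single m c) =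
   const c * (\<Prod>r \<in> Poly_Mapping.keys m. s r ^ Poly_Mapping.lookup m r)"
  by (simp add: subst_def)

lemma subst_const [simp]: "subst s (const c) = const c"
  by (simp add: const_def subst_single)
lemma subst_Var [simp]: "subst s (Var r) = s r"
  by (simp add: Var_def subst_single)
lemma subst_0 [simp]: "subst s 0 = 0"
  using subst_const[of s 0] by simp
lemma subst_1 [simp]: "subst s 1 = 1"
  using subst_const[of s 1] by simp

lemma subst_sum: "subst s (sum f A) = (\<Sum>x\<in>A. subst s (f x))"
  by (induction A rule: infinite_finite_induct) (simp_all add: subst_add)

lemma mono_prod_superset:
  fixes s :: "nat \<Rightarrow> 'k::field mpoly"
  assumes "finite A" "Poly_Mapping.keys m \<subseteq> A"
  shows "(\<Prod>r \<in> Poly_Mapping.keys m. s r ^ Poly_Mapping.lookup m r) =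
    (\<Prod>r \<in> A. s r ^ Poly_Mapping.lookup m r)"
  by (rule prod.mono_neutral_left) (use assms in \<open>auto simp: in_keys_iff\<close>)

lemma subst_single_mult:
  "subst s (Poly_Mapping.single m c * Poly_Mapping.single n d) =
   subst s (Poly_Mapping.single m c) * subst s (Poly_Mapping.single n d)"
proof -
  let ?A = "Poly_Mapping.keys m \<union> Poly_Mapping.keys n"
  have k: "Poly_Mapping.keys (m + n) \<subseteq> ?A" by (rule keys_add)
  have "(\<Prod>r \<in> Poly_Mapping.keys (m + n). s r ^ Poly_Mapping.lookup (m + n) r) =
    (\<Prod>r \<in> Poly_Mapping.keys m. s r ^ Poly_Mapping.lookup m r) *
    (\<Prod>r \<in> Poly_Mapping.keys n. s r ^ Poly_Mapping.lookup n r)"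
    by (subst (1 2 3) mono_prod_superset[of ?A])
      (use k in \<open>auto simp: lookup_add power_add prod.distrib\<close>)
  then show ?thesis
    by (simp add: mult_single subst_single const_mult)
qed

lemma subst_mult: "subst s (p * q) = subst s p * subst s q"
proof -
  let ?s = "\<lambda>p m. Poly_Mapping.single m (Poly_Mapping.lookup p m)"
  have "subst s (p * q) = subst s ((\<Sum>m \<in> Poly_Mapping.keys p. ?s p m) * (\<Sum>n \<in> Poly_Mapping.keys q. ?s q n))"
    by (simp flip: mpoly_sum)
  also have "\<dots> = (\<Sum>m \<in> Poly_Mapping.keys p. \<Sum>n \<in> Poly_Mapping.keys q. subst s (?s p m) * subst s (?s q n))"
    by (simp add: sum_product subst_sum subst_single_mult)
  also have "\<dots> = subst s (\<Sum>m \<in> Poly_Mapping.keys p. ?s p m) * subst s (\<Sum>n \<in> Poly_Mapping.keys q. ?s q n)"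
    by (simp add: sum_product subst_sum)
  finally show ?thesis by (simp flip: mpoly_sum)
qed

lemma subst_uminus: "subst s (- p) = - subst s p"
  using subst_add[of s p "- p"] by (simp add: eq_neg_iff_add_eq_0 add.commute)
lemma subst_diff: "subst s (p - q) = subst s p - subst s q"
  using subst_add[of s p "- q"] by (simp add: subst_uminus)
lemma subst_power: "subst s (p ^ a) = subst s p ^ a"
  by (induction a) (simp_all add: subst_mult)

lemmas subst_simps = subst_add subst_mult subst_uminus subst_diff subst_power

lemma subst_subst: "subst s (subst t p) = subst (\<lambda>r. subst s (t r)) p"
  by (induction p rule: mpoly_induct) (simp_all add: subst_simps)

lemma subst_id: "subst Var p = p"
  by (induction p rule: mpoly_induct) (simp_all add: subst_simps)

lemma mult_left_cancel_mpoly: "(q :: 'k::field mpoly) \<noteq> 0 \<Longrightarrow> q * a = q * b \<longleftrightarrow> a = b"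
  by simp

lemma quotI: "(q :: 'k::field mpoly) * g = p \<Longrightarrow> q \<noteq> 0 \<Longrightarrow> quot p q = g"
  unfolding quot_def by (rule the_equality) (auto simp: mult_left_cancel_mpoly)

lemma quot_dvd: "(q :: 'k::field mpoly) dvd p \<Longrightarrow> q \<noteq> 0 \<Longrightarrow> q * quot p q = p"
  by (metis dvd_def quotI)

lemma Var_eq_iff [simp]: "(Var a :: 'k::field mpoly) = Var b \<longleftrightarrow> a = b"
  by (metis (no_types) Var_def lookup_single_eq lookup_single_not_eq one_neq_zero)

lemma Var_add_ne_0: "a \<noteq> b \<Longrightarrow> (Var a :: 'k::field mpoly) + Var b \<noteq> 0"
proof
  assume ab: "a \<noteq> b" and 0: "(Var a :: 'k mpoly) + Var b = 0"
  have "Poly_Mapping.single a (1::nat) \<noteq> Poly_Mapping.single b 1"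
    using ab by (metis lookup_single_eq lookup_single_not_eq one_neq_zero)
  then have "Poly_Mapping.lookup ((Var a :: 'k mpoly) + Var b) (Poly_Mapping.single a 1) = 1"
    by (simp add: Var_def lookup_add lookup_single_not_eq)
  then show False using 0 by simp
qed

lemma Var_dvd_transpose:
  "(Var b - Var a :: 'k::field mpoly) dvd subst (\<lambda>n. Var (transpose a b n)) p - p"
proof (induction p rule: mpoly_induct)
  case (var r)
  have "(Var b - Var a :: 'k mpoly) dvd Var a - Var b"
    by (metis dvd_refl dvd_minus_iff minus_diff_eq)
  then show ?case by (auto simp: transpose_def)
next
  case (add p q)
  then have "(Var b - Var a :: 'k mpoly) dvd (subst (\<lambda>n. Var (transpose a b n)) p - p) +
      (subst (\<lambda>n. Var (transpose a b n)) q - q)" by (rule dvd_add)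
  then show ?case by (simp add: subst_simps algebra_simps)
next
  case (mult p q)
  then have "(Var b - Var a :: 'k mpoly) dvd (subst (\<lambda>n. Var (transpose a b n)) p - p) * subst (\<lambda>n. Var (transpose a b n)) q +
      p * (subst (\<lambda>n. Var (transpose a b n)) q - q)" by (intro dvd_add dvd_mult2 dvd_mult)
  then show ?case by (simp add: subst_simps algebra_simps)
qed simp

abbreviation demazure :: "nat \<Rightarrow> 'k::field mpoly \<Rightarrow> 'k mpoly" where
  "demazure r p \<equiv> quot (swap r p - p) (Var (Suc r) - Var r)"

lemma demazure: "(Var (Suc r) - Var r) * demazure r p = swap r p - p"
  unfolding swap_def by (rule quot_dvd) (auto intro: Var_dvd_transpose)

lemma demazureI: "(Var (Suc r) - Var r) * g = swap r p - p \<Longrightarrow> demazure r p = g"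
  by (rule quotI) auto

lemma swap_simps [simp]:
  "swap r (p + q) = swap r p + swap r q" "swap r (p * q) = swap r p * swap r q"
  "swap r (- p) = - swap r p" "swap r (p - q) = swap r p - swap r q"
  "swap r (p ^ a) = swap r p ^ a" "swap r (const c) = const c" "swap r 0 = 0" "swap r 1 = 1"
  "swap r (Var n) = Var (transpose r (Suc r) n)"
  by (simp_all add: swap_def subst_simps)

lemma swap_swap [simp]: "swap r (swap r p) = p"
  by (simp add: swap_def subst_subst subst_id)

lemma neg1_simps [simp]:
  "neg1 (p + q) = neg1 p + neg1 q" "neg1 (p * q) = neg1 p * neg1 q"
  "neg1 (- p) = - neg1 p" "neg1 (p - q) = neg1 p - neg1 q"
  "neg1 (p ^ a) = neg1 p ^ a" "neg1 (const c) = const c" "neg1 0 = 0" "neg1 1 = 1"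
  "neg1 (Var n) = (if n = 1 then - Var 1 else Var n)"
  by (simp_all add: neg1_def subst_simps)

lemma neg1_neg1 [simp]: "neg1 (neg1 p) = p"
  by (induction p rule: mpoly_induct) simp_all

lemma swap_swap_commute: "Suc r < s \<Longrightarrow> swap r (swap s p) = swap s (swap r p)"
  by (induction p rule: mpoly_induct) (auto simp: transpose_def)

lemma swap_neg1_commute: "1 < r \<Longrightarrow> swap r (neg1 p) = neg1 (swap r p)"
  by (induction p rule: mpoly_induct) (auto simp: transpose_def)

lemma swap_braid: "swap r (swap (Suc r) (swap r p)) = swap (Suc r) (swap r (swap (Suc r) p))"
  by (induction p rule: mpoly_induct) (auto simp: transpose_def)

lemma swap_neg1_braid:
  "swap 1 (neg1 (swap 1 (neg1 p))) = neg1 (swap 1 (neg1 (swap 1 p)))"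
  by (induction p rule: mpoly_induct) (auto simp: transpose_def)

lemma polys_iff: "p \<in> polys n \<longleftrightarrow> subst (\<lambda>r. if r \<in> {1..n} then Var r else 0) p = p" (is "_ \<longleftrightarrow> subst ?s p = p")
proof
  assume p: "p \<in> polys n"
  have "subst ?s p = subst Var p"
    unfolding subst_def
  proof (intro sum.cong refl arg_cong2[where f = "(*)"] prod.cong)
    fix m r assume "m \<in> Poly_Mapping.keys p" "r \<in> Poly_Mapping.keys m"
    then have "r \<in> {1..n}" using p unfolding polys_def by blast
    then show "?s r ^ Poly_Mapping.lookup m r = Var r ^ Poly_Mapping.lookup m r" by simp
  qed
  then show "subst ?s p = p" by (simp add: subst_id)
next
  assume eq: "subst ?s p = p"
  have closed0: "(0 :: 'a mpoly) \<in> polys n" by (simp add: polys_def)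
  have closed_add: "q + q' \<in> polys n" if "q \<in> polys n" "q' \<in> polys n" for q q' :: "'a mpoly"
    using that keys_add[of q q'] unfolding polys_def by blast
  have closed_mult: "q * q' \<in> polys n" if qq: "q \<in> polys n" "q' \<in> polys n" for q q' :: "'a mpoly"
    unfolding polys_def
  proof clarify
    fix m r assume m: "m \<in> Poly_Mapping.keys (q * q')" and r: "r \<in> Poly_Mapping.keys m"
    then obtain a b where ab: "m = a + b" "a \<in> Poly_Mapping.keys q" "b \<in> Poly_Mapping.keys q'"
      using keys_mult[of q q'] by blast
    then have "r \<in> Poly_Mapping.keys a \<union> Poly_Mapping.keys b" using r keys_add[of a b] by blast
    then show "r \<in> {1..n}" using ab qq unfolding polys_def by blast
  qed
  have "subst ?s q \<in> polys n" for q
  proof (induction q rule: mpoly_induct)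
    case (const c)
    show ?case unfolding subst_const by (simp add: polys_def const_def)
  next
    case (var r)
    show ?case unfolding subst_Var using closed0 by (simp add: polys_def Var_def)
  qed (simp_all add: subst_simps closed0 closed_add closed_mult)
  then show "p \<in> polys n" using eq by metis
qed

lemma polys_intros [intro, simp]:
  "const c \<in> polys n" "0 \<in> polys n" "1 \<in> polys n"
  "p \<in> polys n \<Longrightarrow> q \<in> polys n \<Longrightarrow> p + q \<in> polys n"
  "p \<in> polys n \<Longrightarrow> q \<in> polys n \<Longrightarrow> p * q \<in> polys n"
  "p \<in> polys n \<Longrightarrow> q \<in> polys n \<Longrightarrow> p - q \<in> polys n"
  "p \<in> polys n \<Longrightarrow> - p \<in> polys n"
  "p \<in> polys n \<Longrightarrow> p ^ a \<in> polys n"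
  "1 \<le> r \<Longrightarrow> r \<le> n \<Longrightarrow> Var r \<in> polys n"
  by (simp_all add: polys_iff subst_simps)

lemma subst_in_polys:
  assumes "\<And>r. 1 \<le> r \<Longrightarrow> r \<le> n \<Longrightarrow> s r \<in> polys m" "p \<in> polys n"
  shows "subst s p \<in> polys m"
proof -
  let ?k = "\<lambda>r. if r \<in> {1..n} then Var r else 0"
  have "subst s (subst ?k q) \<in> polys m" for q
  proof (induction q rule: mpoly_induct)
    case (var r)
    then show ?case using assms(1)[of r] by simp
  qed (simp_all add: subst_simps)
  from this[of p] show ?thesis using assms(2) by (simp add: polys_iff[of p])
qed

lemma subst_cong_polys:
  assumes "\<And>r. 1 \<le> r \<Longrightarrow> r \<le> n \<Longrightarrow> s r = t r" "p \<in> polys n"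
  shows "subst s p = subst t p"
proof -
  let ?k = "\<lambda>r. if r \<in> {1..n} then Var r else 0"
  have "subst s (subst ?k q) = subst t (subst ?k q)" for q
  proof (induction q rule: mpoly_induct)
    case (var r)
    then show ?case using assms(1)[of r] by simp
  qed (simp_all add: subst_simps)
  from this[of p] show ?thesis using assms(2) by (simp add: polys_iff[of p])
qed

lemma quot_in_polys:
  assumes "q dvd p" "q \<noteq> 0" "p \<in> polys n" "q \<in> polys n"
  shows "quot p q \<in> polys n"
proof -
  let ?k = "subst (\<lambda>r. if r \<in> {1..n} then Var r else 0)"
  have q: "q * quot p q = p" by (rule quot_dvd[OF assms(1,2)])
  have k: "?k p = p" "?k q = q" using assms(3,4) polys_iff by blast+
  have "?k (q * quot p q) = ?k p" by (simp only: q)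
  then have "q * ?k (quot p q) = p" by (simp only: subst_mult k)
  then have "quot p q = ?k (quot p q)" using assms(2) by (rule quotI)
  then show ?thesis unfolding polys_iff by simp
qed

lemma swap_in_polys: "1 \<le> r \<Longrightarrow> Suc r \<le> n \<Longrightarrow> p \<in> polys n \<Longrightarrow> swap r p \<in> polys n"
  unfolding swap_def by (rule subst_in_polys[of n]) (auto simp: transpose_def)

lemma demazure_in_polys:
  assumes "1 \<le> r" "Suc r \<le> n" "p \<in> polys n"
  shows "demazure r p \<in> polys n"
proof (rule quot_in_polys)
  show "Var (Suc r) - Var r dvd swap r p - p" by (metis demazure dvd_triv_left)
qed (use assms in \<open>simp_all add: swap_in_polys\<close>)

lemma neg1_in_polys: "1 \<le> n \<Longrightarrow> p \<in> polys n \<Longrightarrow> neg1 p \<in> polys n"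
  unfolding neg1_def by (rule subst_in_polys[of n]) auto

lemma nblack_simps [simp]:
  "nblack [] = 0" "nblack (Black i # w) = Suc (nblack w)" "nblack (Red \<theta> # w) = nblack w"
  "nblack (v @ w) = nblack v + nblack w"
  by (simp_all add: nblack_def)

lemma words_simps [simp]:
  "[] \<in> words Q" "Black i # w \<in> words Q \<longleftrightarrow> i \<in> verts Q \<and> w \<in> words Q"
  "Red \<theta> # w \<in> words Q \<longleftrightarrow> \<theta> \<in> dominant_weights Q \<and> w \<in> words Q"
  "v @ w \<in> words Q \<longleftrightarrow> v \<in> words Q \<and> w \<in> words Q"
  by (auto simp: words_def)

lemma src_dotpow [simp]: "src (dotpow i a) = [Black i]"
  by (induction a) auto
lemma tgt_dotpow [simp]: "tgt \<tau> (dotpow i a) = [Black i]"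
  by (cases a) auto
lemma mor_in_dotpow [simp]: "mor_in Q \<tau> C (dotpow i a) \<longleftrightarrow> i \<in> verts Q"
  by (induction a) auto

lemma src_dotmonom [simp]: "src (dotmonom r w m) = w"
  by (induction w arbitrary: r) (auto split: letter.split)
lemma tgt_dotmonom [simp]: "tgt \<tau> (dotmonom r w m) = w"
  by (induction w arbitrary: r) (auto split: letter.split)
lemma mor_in_dotmonom [simp]: "w \<in> words Q \<Longrightarrow> mor_in Q \<tau> C (dotmonom r w m)"
  by (induction w arbitrary: r C) (auto split: letter.split)

lemma dots_typing [simp]:
  fixes p :: "'k::field mpoly"
  shows "src (dots w p :: ('i, 'k) mor) = w" "tgt \<tau> (dots w p :: ('i, 'k) mor) = w"
    "w \<in> words Q \<Longrightarrow> mor_in Q \<tau> C (dots w p :: ('i, 'k) mor)"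
proof -
  define F :: "(nat \<Rightarrow>\<^sub>0 nat) list \<Rightarrow> ('i, 'k) mor" where
    "F ms = foldr (\<lambda>m f. Poly_Mapping.lookup p m \<odot> dotmonom 1 w m \<oplus> f) ms (Zero w w)" for ms
  have *: "src (F ms) = w \<and> tgt \<tau> (F ms) = w \<and> (w \<in> words Q \<longrightarrow> mor_in Q \<tau> C (F ms))" for ms
    by (induction ms) (auto simp: F_def)
  have **: "dots w p = F (sorted_list_of_set (Poly_Mapping.keys p))" by (simp add: dots_def F_def)
  show "src (dots w p :: ('i, 'k) mor) = w" "tgt \<tau> (dots w p :: ('i, 'k) mor) = w"
    "w \<in> words Q \<Longrightarrow> mor_in Q \<tau> C (dots w p :: ('i, 'k) mor)"
    using * unfolding ** by blast+
qed

lemma act_dotpow [simp]: "act Q \<mu> r (dotpow i a) p = Var r ^ a * p"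
  by (induction a) (simp_all add: mult.assoc)

lemma act_dotmonom:
  "act Q \<mu> r (dotmonom j w m) p =
     (\<Prod>t<nblack w. Var (r + t) ^ Poly_Mapping.lookup m (j + t)) * p"
proof (induction w arbitrary: r j)
  case Nil
  then show ?case by simp
next
  case (Cons l w)
  then show ?case
    by (cases l) (simp_all add: prod.lessThan_Suc_shift mult.assoc del: prod.lessThan_Suc)
qed

lemma act_dots:
  fixes p :: "'k::field mpoly"
  assumes "p \<in> polys (nblack w)" "1 \<le> r"
  shows "act Q \<mu> r (dots w p) q = subst (\<lambda>j. Var (j + r - 1)) p * q"
proof -
  let ?g = "\<lambda>m. const (Poly_Mapping.lookup p m) *
    (\<Prod>t<nblack w. Var (r + t) ^ Poly_Mapping.lookup m (Suc t))"
  have f: "act Q \<mu> r (foldr (\<lambda>m f. Poly_Mapping.lookup p m \<odot> dotmonom 1 w m \<oplus> f) ms (Zero w w)) q =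
     sum_list (map ?g ms) * q" for ms
    by (induction ms) (simp_all add: act_dotmonom distrib_right mult.assoc)
  have "act Q \<mu> r (dots w p) q = (\<Sum>m \<in> Poly_Mapping.keys p. ?g m) * q"
    unfolding dots_def f by (simp add: sum_list_distinct_conv_sum_set)
  also have "(\<Sum>m \<in> Poly_Mapping.keys p. ?g m) = subst (\<lambda>j. Var (j + r - 1)) p"
    unfolding subst_def
  proof (rule sum.cong[OF HOL.refl])
    fix m assume "m \<in> Poly_Mapping.keys p"
    then have k: "Poly_Mapping.keys m \<subseteq> {1..nblack w}" using assms unfolding polys_def by blast
    have "(\<Prod>j\<in>Poly_Mapping.keys m. (Var (j + r - 1) :: 'k mpoly) ^ Poly_Mapping.lookup m j) =
      (\<Prod>j\<in>{1..nblack w}. Var (j + r - 1) ^ Poly_Mapping.lookup m j)"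
      by (rule mono_prod_superset) (use k in auto)
    also have "\<dots> = (\<Prod>t<nblack w. Var (r + t) ^ Poly_Mapping.lookup m (Suc t))"
      by (simp add: prod.atLeast1_atMost_eq add.commute)
    finally show "?g m = const (Poly_Mapping.lookup p m) *
      (\<Prod>j\<in>Poly_Mapping.keys m. Var (j + r - 1) ^ Poly_Mapping.lookup m j)" by simp
  qed
  finally show ?thesis .
qed

lemma quot_0 [simp]: "quot 0 (Var (Suc r) - Var r) = 0"
  by (rule quotI) auto

lemma act_0 [simp]: "act Q \<mu> r f 0 = 0"
  by (induction f arbitrary: r) simp_all

lemma act_nblack:
  "\<lbrakk>mor_in Q \<tau> C f; nblack (tgt \<tau> f) \<noteq> nblack (src f)\<rbrakk> \<Longrightarrow> act Q \<mu> r f p = 0"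
proof (induction f arbitrary: C r p)
  case (Comp g f)
  then show ?case
    by (cases "nblack (tgt \<tau> f) = nblack (src f)") auto
next
  case (Tens f g)
  then show ?case
    by (cases "nblack (tgt \<tau> f) = nblack (src f)") auto
next
  case (Add f g)
  have "act Q \<mu> r f p = 0" using Add.prems by (intro Add.IH(1)) auto
  moreover have "act Q \<mu> r g p = 0" using Add.prems by (intro Add.IH(2)) auto
  ultimately show ?case by simp
qed auto

definition locop :: "nat \<Rightarrow> ('k::field mpoly \<Rightarrow> 'k mpoly) \<Rightarrow> bool" where
  "locop s T \<longleftrightarrow> (\<forall>p q. T (p + q) = T p + T q) \<and> (\<forall>c p. T (const c * p) = const c * T p) \<and>
     (\<forall>j\<ge>s. \<forall>p. T (Var j * p) = Var j * T p) \<and> (\<forall>j\<ge>s. \<forall>p. T (swap j p) = swap j (T p))"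

lemma locopD:
  assumes "locop s T"
  shows "T (p + q) = T p + T q" "T (const c * p) = const c * T p" "T 0 = 0" "T (- p) = - T p"
    "T (p - q) = T p - T q"
    "s \<le> j \<Longrightarrow> T (Var j * p) = Var j * T p" "s \<le> j \<Longrightarrow> T (swap j p) = swap j (T p)"
    "s \<le> j \<Longrightarrow> T (Var j ^ a * p) = Var j ^ a * T p"
proof -
  show *: "T (p + q) = T p + T q" "T (const c * p) = const c * T p" for p q c
    using assms by (auto simp: locop_def)
  show **: "s \<le> j \<Longrightarrow> T (Var j * p) = Var j * T p" "s \<le> j \<Longrightarrow> T (swap j p) = swap j (T p)" for p
    using assms by (auto simp: locop_def)
  show "T 0 = 0" using *(2)[of 0 0] by simp
  show m: "T (- p) = - T p" for p using *(2)[of "- 1" p] by (simp add: const_uminus)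
  show "T (p - q) = T p - T q" using *(1)[of p "- q"] m by simp
  show "s \<le> j \<Longrightarrow> T (Var j ^ a * p) = Var j ^ a * T p"
    by (induction a) (simp_all add: ** mult.assoc)
qed

lemma locop_demazure: "Suc (Suc r) \<le> s \<Longrightarrow> locop s (demazure r)"
  unfolding locop_def
proof (intro conjI allI impI)
  fix p q :: "'a mpoly" and c
  show "demazure r (p + q) = demazure r p + demazure r q"
    by (rule demazureI) (simp add: distrib_left demazure)
  show "demazure r (const c * p) = const c * demazure r p"
    by (rule demazureI) (simp add: mult.left_commute[of _ "const c"] demazure right_diff_distrib)
next
  fix j and p :: "'a mpoly" assume "Suc (Suc r) \<le> s" "s \<le> j"
  then have t: "transpose r (Suc r) j = j" by (simp add: transpose_def)
  show "demazure r (Var j * p) = Var j * demazure r p"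
    by (rule demazureI)
      (simp add: mult.left_commute[of _ "Var j"] demazure right_diff_distrib t)
next
  fix j and p :: "'a mpoly" assume j: "Suc (Suc r) \<le> s" "s \<le> j"
  have "swap j ((Var (Suc r) - Var r) * demazure r p) = swap j (swap r p - p)"
    by (simp only: demazure)
  then have "(Var (Suc r) - Var r) * swap j (demazure r p) = swap j (swap r p) - swap j p"
    using j by (simp add: transpose_def)
  then show "demazure r (swap j p) = swap j (demazure r p)"
    using j by (intro demazureI) (simp add: swap_swap_commute)
qed

lemma locop_comp: "locop s T \<Longrightarrow> locop s U \<Longrightarrow> locop s (\<lambda>p. T (U p))"
  by (simp add: locop_def)
lemma locop_add: "locop s T \<Longrightarrow> locop s U \<Longrightarrow> locop s (\<lambda>p. T p + U p)"
  by (simp add: locop_def algebra_simps)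
lemma locop_id: "locop s (\<lambda>p. p)"
  by (simp add: locop_def)
lemma locop_zero: "locop s (\<lambda>p. 0)"
  by (simp add: locop_def)
lemma locop_mult:
  assumes "\<And>j. s \<le> j \<Longrightarrow> swap j g = g"
  shows "locop s ((*) g)"
  using assms by (simp add: locop_def algebra_simps)
lemma locop_swap: "Suc (Suc r) \<le> s \<Longrightarrow> locop s (swap r)"
  by (auto simp: locop_def swap_swap_commute transpose_def)
lemma locop_neg1: "2 \<le> s \<Longrightarrow> locop s neg1"
  by (auto simp: locop_def swap_neg1_commute)

lemma swap_Xfac [simp]: "swap r (Xfac Q i j u v) = Xfac Q i j (swap r u) (swap r v)"
  by (simp add: Xfac_def)
lemma neg1_Xfac [simp]: "neg1 (Xfac Q i j u v) = Xfac Q i j (neg1 u) (neg1 v)"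
  by (simp add: Xfac_def)
lemma subst_Xfac [simp]: "subst s (Xfac Q i j u v) = Xfac Q i j (subst s u) (subst s v)"
  by (simp add: Xfac_def subst_simps)

lemma locop_act:
  fixes f :: "('i, 'k::field) mor"
  shows "\<lbrakk>mor_in Q \<tau> C f; C = oKLRW \<Longrightarrow> r = 1; r + nblack (src f) \<le> s\<rbrakk> \<Longrightarrow> locop s (act Q \<mu> r f)"
proof (induction f arbitrary: C r)
  case (Dot i)
  then have "locop s ((*) (Var r))" by (intro locop_mult) (simp add: transpose_def)
  moreover have "act Q \<mu> r (Dot i) = (*) (Var r)" by (rule ext) simp
  ultimately show ?case by simp
next
  case (CrossBB i j)
  then have r: "Suc (Suc r) \<le> s" by simp
  show ?case
  proof (cases "i = j")
    case True
    then have "act Q \<mu> r (CrossBB i j) = (demazure r :: 'k mpoly \<Rightarrow> _)" by (intro ext) simp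
    then show ?thesis using locop_demazure[OF r] by (simp only:)
  next
    case False
    then have act: "act Q \<mu> r (CrossBB i j) = (\<lambda>p :: 'k mpoly. Xfac Q i j (Var (Suc r)) (Var r) * swap r p)"
      by (intro ext) simp
    have "locop s ((*) (Xfac Q i j (Var (Suc r)) (Var r :: 'k mpoly)))"
      using r by (intro locop_mult) (simp add: transpose_def)
    then show ?thesis unfolding act using locop_swap[OF r] by (rule locop_comp)
  qed
next
  case (CrossRB \<theta> i)
  then have "locop s ((*) (Var r ^ Poly_Mapping.lookup \<theta> i))" by (intro locop_mult) (simp add: transpose_def)
  moreover have "act Q \<mu> r (CrossRB \<theta> i) = (*) (Var r ^ Poly_Mapping.lookup \<theta> i)" by (rule ext) simp
  ultimately show ?case by simp
next
  case (Rho i)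
  then have s: "2 \<le> s" by simp
  have act: "act Q \<mu> r (Rho i) = (\<lambda>p :: 'k mpoly. (- Var 1) ^ Poly_Mapping.lookup \<mu> i * neg1 p)"
    by (rule ext) simp
  have "locop s ((*) ((- Var 1 :: 'k mpoly) ^ Poly_Mapping.lookup \<mu> i))" using s
    by (intro locop_mult) (simp add: transpose_def)
  then show ?case unfolding act using locop_neg1[OF s] by (rule locop_comp)
next
  case (Comp g f)
  have gf: "act Q \<mu> r (g \<cdot> f) = (\<lambda>p. act Q \<mu> r g (act Q \<mu> r f p))" by (rule ext) simp
  show ?case
  proof (cases "nblack (tgt \<tau> f) = nblack (src f)")
    case True
    have "locop s (act Q \<mu> r g)" using Comp.prems True by (intro Comp.IH(1)) auto
    moreover have "locop s (act Q \<mu> r f)" using Comp.prems by (intro Comp.IH(2)) auto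
    ultimately show ?thesis unfolding gf by (rule locop_comp)
  next
    case False
    then have "act Q \<mu> r (g \<cdot> f) = (\<lambda>p. 0)"
      using Comp.prems act_nblack[of Q \<tau> C f] by (intro ext) simp
    then show ?thesis by (simp add: locop_zero)
  qed
next
  case (Tens f g)
  have "locop s (act Q \<mu> r f)" using Tens.prems by (intro Tens.IH(1)) auto
  moreover have "locop s (act Q \<mu> (r + nblack (src f)) g)"
    using Tens.prems by (intro Tens.IH(2)[of KLRW]) auto
  ultimately have "locop s (\<lambda>p. act Q \<mu> r f (act Q \<mu> (r + nblack (src f)) g p))" by (rule locop_comp)
  moreover have "act Q \<mu> r (f \<otimes> g) = (\<lambda>p. act Q \<mu> r f (act Q \<mu> (r + nblack (src f)) g p))"
    by (rule ext) simp
  ultimately show ?case by (simp only:)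
next
  case (Add f g)
  have "locop s (act Q \<mu> r f)" using Add.prems by (intro Add.IH(1)) auto
  moreover have "locop s (act Q \<mu> r g)" using Add.prems by (intro Add.IH(2)) auto
  ultimately have "locop s (\<lambda>p. act Q \<mu> r f p + act Q \<mu> r g p)" by (rule locop_add)
  moreover have "act Q \<mu> r (f \<oplus> g) = (\<lambda>p. act Q \<mu> r f p + act Q \<mu> r g p)" by (rule ext) simp
  ultimately show ?case by (simp only:)
next
  case (Scale c f)
  have "locop s (act Q \<mu> r f)" using Scale.prems by (intro Scale.IH) auto
  have c: "locop s ((*) (const c))" by (rule locop_mult) simp
  have "locop s (\<lambda>p. const c * act Q \<mu> r f p)" by (rule locop_comp[OF c]) fact
  moreover have "act Q \<mu> r (c \<odot> f) = (\<lambda>p. const c * act Q \<mu> r f p)" by (rule ext) simp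
  ultimately show ?case by (simp only:)
next
  case (Ident w)
  have "act Q \<mu> r (Ident w) = (\<lambda>p. p)" by (rule ext) simp
  then show ?case by (simp add: locop_id)
next
  case (CrossBR i \<theta>)
  have "act Q \<mu> r (CrossBR i \<theta>) = (\<lambda>p. p)" by (rule ext) simp
  then show ?case by (simp add: locop_id)
next
  case (Zero v w)
  have "act Q \<mu> r (Zero v w) = (\<lambda>p. 0)" by (rule ext) simp
  then show ?case by (simp add: locop_zero)
qed

lemma act_commute:
  assumes T: "locop s T"
  shows "\<lbrakk>mor_in Q \<tau> KLRW g; s \<le> t\<rbrakk> \<Longrightarrow> act Q \<mu> t g (T p) = T (act Q \<mu> t g p)"
proof (induction g arbitrary: t p)
  case (CrossBB i j)
  then have t: "s \<le> t" by simp
  have c: "demazure t (T p) = T (demazure t p)"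
  proof (rule demazureI)
    have "T ((Var (Suc t) - Var t) * demazure t p) = T (swap t p - p)" by (simp only: demazure)
    then show "(Var (Suc t) - Var t) * T (demazure t p) = swap t (T p) - T p"
      using t by (simp add: left_diff_distrib locopD[OF T])
  qed
  show ?case using t c by (auto simp: Xfac_def left_diff_distrib locopD[OF T])
qed (simp_all add: locopD[OF T])

lemma act_linear:
  assumes "mor_in Q \<tau> C f" "C = oKLRW \<Longrightarrow> r = 1"
  shows "act Q \<mu> r f (p + q) = act Q \<mu> r f p + act Q \<mu> r f q"
    "act Q \<mu> r f (const c * p) = const c * act Q \<mu> r f p"
  using locopD(1,2)[OF locop_act[OF assms order.refl]] by auto

lemma act_in_polys:
  "\<lbrakk>mor_in Q \<tau> C f; C = oKLRW \<Longrightarrow> r = 1; 1 \<le> r; r + nblack (src f) \<le> Suc n; p \<in> polys n\<rbrakk> \<Longrightarrow>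
     act Q \<mu> r f p \<in> polys n"
proof (induction f arbitrary: C r p)
  case (CrossBB i j)
  then show ?case by (auto simp: Xfac_def intro!: demazure_in_polys swap_in_polys)
next
  case (Rho i)
  then show ?case by (auto intro!: neg1_in_polys)
next
  case (Comp g f)
  have f: "act Q \<mu> r f p \<in> polys n" using Comp.prems by (intro Comp.IH(2)) auto
  show ?case
  proof (cases "nblack (tgt \<tau> f) = nblack (src f)")
    case True
    then show ?thesis unfolding act.simps using Comp.prems f by (intro Comp.IH(1)) auto
  next
    case False
    then show ?thesis using Comp.prems act_nblack[of Q \<tau> C f] by simp
  qed
next
  case (Tens f g)
  have "act Q \<mu> (r + nblack (src f)) g p \<in> polys n"
    using Tens.prems by (intro Tens.IH(2)[of KLRW]) auto
  then show ?case unfolding act.simps using Tens.prems by (intro Tens.IH(1)) auto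
next
  case (Add f g)
  have "act Q \<mu> r f p \<in> polys n" using Add.prems by (intro Add.IH(1)) auto
  moreover have "act Q \<mu> r g p \<in> polys n" using Add.prems by (intro Add.IH(2)) auto
  ultimately show ?case by simp
next
  case (Scale c f)
  have "act Q \<mu> r f p \<in> polys n" using Scale.prems by (intro Scale.IH) auto
  then show ?case by simp
qed auto

lemma swap_demazure: "swap r (demazure r p) = demazure r p"
proof -
  have 1: "(Var r - Var (Suc r)) * swap r (demazure r p) = p - swap r p"
    using arg_cong[OF demazure[of r p], of "swap r"] by (simp add: transpose_def)
  have "(Var (Suc r) - Var r) * swap r (demazure r p) = - ((Var r - Var (Suc r)) * swap r (demazure r p))"
    by (metis minus_diff_eq minus_mult_left)
  also have "\<dots> = (Var (Suc r) - Var r) * demazure r p"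
    unfolding 1 demazure by simp
  finally show ?thesis by simp
qed

lemma braid_calc:
  fixes u v w :: "'r::comm_ring_1"
  assumes "u * X = A - B" "v * A = P - d" "w * B = T - d" "w * P = \<alpha>" "v * T = \<beta>" "u * d = \<gamma>"
    and v: "v = u + w"
  shows "u * v * w * X = \<alpha> - \<beta> + \<gamma>"
proof -
  have "u * v * w * X = v * w * (u * X)" by (simp add: mult_ac)
  also have "\<dots> = w * (v * A) - v * (w * B)" by (simp only: assms(1)) (simp add: algebra_simps)
  also have "\<dots> = w * P - v * T + (v - w) * d" by (simp only: assms(2,3)) (simp add: algebra_simps)
  also have "v - w = u" using v by simp
  finally show ?thesis by (simp add: assms(4-6))
qed

lemma demazure_braid:
  fixes p :: "'k::field mpoly"
  shows "demazure r (demazure (Suc r) (demazure r p)) =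
    demazure (Suc r) (demazure r (demazure (Suc r) p))"
proof -
  let ?a = "Var r :: 'k mpoly" and ?b = "Var (Suc r) :: 'k mpoly" and ?c = "Var (Suc (Suc r)) :: 'k mpoly"
  let ?s = "swap r" and ?t = "swap (Suc r)"
  let ?V = "(?b - ?a) * (?c - ?a) * (?c - ?b)"
  have V0: "?V \<noteq> 0" by simp
  have tr: "transpose r (Suc r) r = Suc r" "transpose r (Suc r) (Suc r) = r"
    "transpose r (Suc r) (Suc (Suc r)) = Suc (Suc r)"
    "transpose (Suc r) (Suc (Suc r)) r = r" "transpose (Suc r) (Suc (Suc r)) (Suc r) = Suc (Suc r)"
    "transpose (Suc r) (Suc (Suc r)) (Suc (Suc r)) = Suc r"
    by (simp_all add: transpose_def)
  have D: "(?b - ?a) * demazure r q = ?s q - q" for q by (rule demazure)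
  have E: "(?c - ?b) * demazure (Suc r) q = ?t q - q" for q by (rule demazure)
  have sD: "?s (demazure r q) = demazure r q" for q by (rule swap_demazure)
  have tD: "(?c - ?a) * ?t (demazure r q) = ?t (?s q) - ?t q" for q
    using arg_cong[OF D[of q], of ?t] by (simp add: tr)
  have stD: "(?c - ?b) * ?s (?t (demazure r q)) = ?s (?t (?s q)) - ?s (?t q)" for q
    using arg_cong[OF tD[of q], of ?s] by (simp add: tr)
  have sE: "(?c - ?a) * ?s (demazure (Suc r) q) = ?s (?t q) - ?s q" for q
    using arg_cong[OF E[of q], of ?s] by (simp add: tr)
  have tE: "?t (demazure (Suc r) q) = demazure (Suc r) q" for q by (rule swap_demazure)
  have tsE: "(?b - ?a) * ?t (?s (demazure (Suc r) q)) = ?t (?s (?t q)) - ?t (?s q)" for q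
    using arg_cong[OF sE[of q], of ?t] by (simp add: tr)
  have 1: "?V * demazure r (demazure (Suc r) (demazure r p)) =
      (?s (?t (?s p)) - ?s (?t p)) - (?t (?s p) - ?t p) + (?s p - p)"
    by (rule braid_calc[OF D[of "demazure (Suc r) (demazure r p)"] sE[of "demazure r p", unfolded sD]
        E[of "demazure r p"] stD[of p] tD[of p] D[of p]]) simp
  have 2: "(?c - ?b) * (?c - ?a) * (?b - ?a) * demazure (Suc r) (demazure r (demazure (Suc r) p)) =
      (?t (?s (?t p)) - ?t (?s p)) - (?s (?t p) - ?s p) + (?t p - p)"
    by (rule braid_calc[OF E[of "demazure r (demazure (Suc r) p)"] tD[of "demazure (Suc r) p", unfolded tE]
        D[of "demazure (Suc r) p"] tsE[of p] sE[of p] E[of p]]) simp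
  have "?V * demazure (Suc r) (demazure r (demazure (Suc r) p)) =
      (?c - ?b) * (?c - ?a) * (?b - ?a) * demazure (Suc r) (demazure r (demazure (Suc r) p))"
    by (simp only: mult_ac)
  then have "?V * demazure r (demazure (Suc r) (demazure r p)) =
      ?V * demazure (Suc r) (demazure r (demazure (Suc r) p))"
    by (simp only: 1 2 swap_braid) (simp add: algebra_simps)
  then show ?thesis by (rule mult_left_cancel_mpoly[THEN iffD1, OF V0])
qed

lemma demazure_symmetric:
  assumes "swap r g = g"
  shows "demazure r (g * p) = g * demazure r p"
proof (rule demazureI)
  have "(Var (Suc r) - Var r) * (g * demazure r p) = g * ((Var (Suc r) - Var r) * demazure r p)"
    by (simp add: mult.left_commute)
  then show "(Var (Suc r) - Var r) * (g * demazure r p) = swap r (g * p) - g * p"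
    by (simp add: demazure assms right_diff_distrib)
qed

lemma demazure_demazure: "demazure r (demazure r p) = 0"
  by (rule demazureI) (simp add: swap_demazure)

lemma transpose_adjacent:
  "transpose r (Suc r) r = Suc r" "transpose r (Suc r) (Suc r) = r"
  "transpose r (Suc r) (Suc (Suc r)) = Suc (Suc r)"
  "transpose (Suc r) (Suc (Suc r)) r = r" "transpose (Suc r) (Suc (Suc r)) (Suc r) = Suc (Suc r)"
  "transpose (Suc r) (Suc (Suc r)) (Suc (Suc r)) = Suc r"
  by (simp_all add: transpose_def)

lemma demazure_swap_swap: "demazure (Suc r) (swap r (swap (Suc r) p)) = swap r (swap (Suc r) (demazure r p))"
proof (rule demazureI)
  have "swap r (swap (Suc r) ((Var (Suc r) - Var r) * demazure r p)) = swap r (swap (Suc r) (swap r p - p))"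
    by (simp only: demazure)
  then show "(Var (Suc (Suc r)) - Var (Suc r)) * swap r (swap (Suc r) (demazure r p)) =
      swap (Suc r) (swap r (swap (Suc r) p)) - swap r (swap (Suc r) p)"
    by (simp only: swap_simps transpose_adjacent swap_braid)
qed

lemma demazure_swap_swap': "demazure r (swap (Suc r) (swap r p)) = swap (Suc r) (swap r (demazure (Suc r) p))"
proof (rule demazureI)
  have "swap (Suc r) (swap r ((Var (Suc (Suc r)) - Var (Suc r)) * demazure (Suc r) p)) =
      swap (Suc r) (swap r (swap (Suc r) p - p))"
    by (simp only: demazure)
  then show "(Var (Suc r) - Var r) * swap (Suc r) (swap r (demazure (Suc r) p)) =
      swap r (swap (Suc r) (swap r p)) - swap (Suc r) (swap r p)"
    by (simp only: swap_simps transpose_adjacent swap_braid)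
qed

lemma dvd_ffac: "(u - w) dvd (ffac Q i j u v - ffac Q i j w v :: 'k::field mpoly)"
proof -
  have "ffac Q i j u v - ffac Q i j w v = (u - w) *
      (if j \<rightarrow>\<^bsub>Q\<^esub> i then (if i \<rightarrow>\<^bsub>Q\<^esub> j then v + v - u - w else 1) else (if i \<rightarrow>\<^bsub>Q\<^esub> j then - 1 else 0))"
    by (simp add: ffac_def Xfac_def algebra_simps)
  then show ?thesis by (rule dvdI)
qed

lemma subst_ffac [simp]: "subst s (ffac Q i j u v) = ffac Q i j (subst s u) (subst s v)"
  by (simp add: ffac_def subst_simps)

lemma ffac_in_polys: "u \<in> polys n \<Longrightarrow> v \<in> polys n \<Longrightarrow> ffac Q i j u v \<in> polys n"
  by (simp add: ffac_def Xfac_def)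

lemma act_diff: "act Q \<mu> r (f \<ominus> g) p = act Q \<mu> r f p - act Q \<mu> r g p"
  by (simp add: const_uminus)

lemma braid_correction:
  fixes Q :: "('i, 'a) pre_digraph" and p :: "'k::field mpoly"
  assumes "1 \<le> r"
  shows "(Var (Suc (Suc r)) - Var r) *
      act Q \<mu> r (dots [Black i, Black j, Black k] (quot (ffac Q i j (Var 3) (Var 2) - ffac Q i j (Var 1) (Var 2)) (Var 3 - Var 1))) p =
    (ffac Q i j (Var (Suc (Suc r))) (Var (Suc r)) - ffac Q i j (Var r) (Var (Suc r))) * p"
proof -
  define q :: "'k mpoly" where "q = quot (ffac Q i j (Var 3) (Var 2) - ffac Q i j (Var 1) (Var 2)) (Var 3 - Var 1)"
  let ?s = "subst (\<lambda>j. Var (j + r - 1) :: 'k mpoly)"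
  have q: "(Var 3 - Var 1) * q = ffac Q i j (Var 3) (Var 2) - ffac Q i j (Var 1) (Var 2)"
    unfolding q_def by (rule quot_dvd) (auto intro: dvd_ffac)
  have "q \<in> polys 3"
    unfolding q_def
    by (rule quot_in_polys[OF dvd_ffac]; (intro polys_intros ffac_in_polys)?; simp)
  then have "q \<in> polys (nblack [Black i, Black j, Black k])" by (simp add: numeral_3_eq_3)
  then have A: "act Q \<mu> r (dots [Black i, Black j, Black k] q) p = ?s q * p"
    using assms by (rule act_dots)
  have B: "(Var (Suc (Suc r)) - Var r) * ?s q =
      ffac Q i j (Var (Suc (Suc r))) (Var (Suc r)) - ffac Q i j (Var r) (Var (Suc r))"
    using arg_cong[OF q, of ?s] by (simp add: subst_simps)
  show ?thesis unfolding q_def[symmetric] A mult.assoc[symmetric] B ..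
qed

lemma iji_calc:
  fixes v :: "'r::comm_ring_1"
  assumes "v * U = x * P - y * p" "v * V = z * P - w * p"
  shows "v * (z * U - x * V) = (x * w - y * z) * p"
proof -
  have "v * (z * U - x * V) = z * (v * U) - x * (v * V)" by (simp add: algebra_simps)
  then show ?thesis unfolding assms by (simp add: algebra_simps)
qed

lemma act_braid_iji:
  fixes Q :: "('i, 'a) pre_digraph" and p :: "'k::field mpoly"
  assumes "1 \<le> r" "i \<noteq> j"
  shows "act Q \<mu> r
     ((CrossBB j i \<otimes> Ident [Black i]) \<cdot> (Ident [Black j] \<otimes> CrossBB i i) \<cdot>
          (CrossBB i j \<otimes> Ident [Black i])
        \<ominus> (Ident [Black i] \<otimes> CrossBB i j) \<cdot> (CrossBB i i \<otimes> Ident [Black j]) \<cdot>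
          (Ident [Black i] \<otimes> CrossBB j i)) p =
    act Q \<mu> r (dots [Black i, Black j, Black i] (quot (ffac Q i j (Var 3) (Var 2) - ffac Q i j (Var 1) (Var 2)) (Var 3 - Var 1))) p"
    (is "?L = ?R")
proof -
  let ?a = "Var r :: 'k mpoly" and ?b = "Var (Suc r) :: 'k mpoly" and ?c = "Var (Suc (Suc r)) :: 'k mpoly"
  let ?s = "swap r" and ?t = "swap (Suc r)"
  have tr: "transpose r (Suc r) r = Suc r" "transpose r (Suc r) (Suc r) = r"
    "transpose r (Suc r) (Suc (Suc r)) = Suc (Suc r)"
    "transpose (Suc r) (Suc (Suc r)) r = r" "transpose (Suc r) (Suc (Suc r)) (Suc r) = Suc (Suc r)"
    "transpose (Suc r) (Suc (Suc r)) (Suc (Suc r)) = Suc r"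
    by (simp_all add: transpose_def)
  define u where "u = ?s (demazure (Suc r) (Xfac Q i j ?b ?a * ?s p))"
  define v where "v = ?t (demazure r (Xfac Q j i ?c ?b * ?t p))"
  have u: "(?c - ?a) * u = Xfac Q i j ?c ?b * ?s (?t (?s p)) - Xfac Q i j ?a ?b * p"
    using arg_cong[OF demazure[of "Suc r" "Xfac Q i j ?b ?a * ?s p"], of ?s]
    by (simp add: tr u_def)
  have v: "(?c - ?a) * v = Xfac Q j i ?b ?a * ?s (?t (?s p)) - Xfac Q j i ?b ?c * p"
    using arg_cong[OF demazure[of r "Xfac Q j i ?c ?b * ?t p"], of ?t]
    by (simp add: tr v_def swap_braid)
  have L: "?L = Xfac Q j i ?b ?a * u - Xfac Q i j ?c ?b * v"
    unfolding act_diff using assms(2) by (simp add: u_def v_def)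
  have "(?c - ?a) * ?L = (ffac Q i j ?c ?b - ffac Q i j ?a ?b) * p"
    unfolding L ffac_def by (rule iji_calc[OF u v])
  also have "\<dots> = (?c - ?a) * ?R"
    by (rule braid_correction[OF assms(1), symmetric])
  finally show ?thesis by (rule mult_left_cancel_mpoly[THEN iffD1, rotated]) simp
qed

lemma act_braid_other:
  assumes "\<not> (i = k \<and> k \<noteq> j)"
  shows "act Q \<mu> r
      ((CrossBB j k \<otimes> Ident [Black i]) \<cdot> (Ident [Black j] \<otimes> CrossBB i k) \<cdot>
          (CrossBB i j \<otimes> Ident [Black k])
        \<ominus> (Ident [Black k] \<otimes> CrossBB i j) \<cdot> (CrossBB i k \<otimes> Ident [Black j]) \<cdot>
          (Ident [Black i] \<otimes> CrossBB j k)) p = 0"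
proof -
  have tr: "transpose r (Suc r) r = Suc r" "transpose r (Suc r) (Suc r) = r"
    "transpose r (Suc r) (Suc (Suc r)) = Suc (Suc r)"
    "transpose (Suc r) (Suc (Suc r)) r = r" "transpose (Suc r) (Suc (Suc r)) (Suc r) = Suc (Suc r)"
    "transpose (Suc r) (Suc (Suc r)) (Suc (Suc r)) = Suc r"
    by (simp_all add: transpose_def)
  consider "i = j" "j = k" | "i = j" "j \<noteq> k" | "i \<noteq> j" "j = k" | "i \<noteq> j" "j \<noteq> k" "i \<noteq> k"
    using assms by blast
  then show ?thesis
  proof cases
    case 1
    then show ?thesis unfolding act_diff by (simp add: demazure_braid)
  next
    case 2
    let ?g = "Xfac Q j k (Var (Suc (Suc r))) (Var r) * Xfac Q j k (Var (Suc (Suc r))) (Var (Suc r))"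
    have "demazure (Suc r) (Xfac Q j k (Var (Suc r)) (Var r) * (Xfac Q j k (Var (Suc (Suc r))) (Var r) * swap r (swap (Suc r) p)))
      = Xfac Q j k (Var (Suc r)) (Var r) * (Xfac Q j k (Var (Suc (Suc r))) (Var r) * swap r (swap (Suc r) (demazure r p)))"
      using demazure_symmetric[of "Suc r" "Xfac Q j k (Var (Suc r)) (Var r) * Xfac Q j k (Var (Suc (Suc r))) (Var r)"
         "swap r (swap (Suc r) p)"]
      by (simp add: tr mult_ac demazure_swap_swap)
    then show ?thesis using 2 unfolding act_diff by (simp add: tr)
  next
    case 3
    have "demazure r (Xfac Q i k (Var (Suc (Suc r))) (Var (Suc r)) * (Xfac Q i k (Var (Suc (Suc r))) (Var r) * swap (Suc r) (swap r p)))
      = Xfac Q i k (Var (Suc (Suc r))) (Var (Suc r)) * (Xfac Q i k (Var (Suc (Suc r))) (Var r) * swap (Suc r) (swap r (demazure (Suc r) p)))"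
      using demazure_symmetric[of r "Xfac Q i k (Var (Suc (Suc r))) (Var (Suc r)) * Xfac Q i k (Var (Suc (Suc r))) (Var r)"
         "swap (Suc r) (swap r p)"]
      by (simp add: tr mult_ac demazure_swap_swap')
    then show ?thesis using 3 unfolding act_diff by (simp add: tr)
  next
    case 4
    then show ?thesis unfolding act_diff by (simp add: tr swap_braid mult_ac)
  qed
qed

lemma sum_pairs: "(\<Sum>(a, b) \<in> {(a, b). a + b + 1 = m}. f a b) = (\<Sum>a<m. f a (m - Suc a))"
  for f :: "nat \<Rightarrow> nat \<Rightarrow> 'b::comm_monoid_add"
  by (rule sum.reindex_bij_witness[of _ "\<lambda>a. (a, m - Suc a)" fst]) auto

lemma red_correction:
  fixes p :: "'k::field mpoly"
  assumes "1 \<le> r"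
  shows "(Var (Suc r) - Var r) *
      act Q \<mu> r (dots [Black i, Red \<theta>, Black i] (\<Sum>(a, b) \<in> {(a, b). a + b + 1 = m}. Var 1 ^ a * Var 2 ^ b)) p =
    (Var (Suc r) ^ m - Var r ^ m) * p"
proof -
  let ?s = "subst (\<lambda>j. Var (j + r - 1) :: 'k mpoly)"
  have sum_in: "(\<Sum>a\<in>A. f a) \<in> polys n" if "\<And>a. f a \<in> polys n" for A n and f :: "nat \<Rightarrow> 'k mpoly"
    by (induction A rule: infinite_finite_induct) (simp_all add: that)
  have "(\<Sum>a<m. Var 1 ^ a * Var 2 ^ (m - Suc a) :: 'k mpoly) \<in> polys (nblack [Black i, Red \<theta>, Black i])"
    by (rule sum_in) simp
  then have "act Q \<mu> r (dots [Black i, Red \<theta>, Black i] (\<Sum>a<m. Var 1 ^ a * Var 2 ^ (m - Suc a) :: 'k mpoly)) p =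
      ?s (\<Sum>a<m. Var 1 ^ a * Var 2 ^ (m - Suc a)) * p"
    using assms by (rule act_dots)
  also have "?s (\<Sum>a<m. Var 1 ^ a * Var 2 ^ (m - Suc a)) = (\<Sum>a<m. Var r ^ a * Var (Suc r) ^ (m - Suc a))"
    by (simp add: subst_sum subst_simps)
  finally have A: "act Q \<mu> r (dots [Black i, Red \<theta>, Black i] (\<Sum>a<m. Var 1 ^ a * Var 2 ^ (m - Suc a) :: 'k mpoly)) p =
      (\<Sum>a<m. Var r ^ a * Var (Suc r) ^ (m - Suc a)) * p" .
  have B: "Var (Suc r) ^ m - Var r ^ m = (Var (Suc r) - Var r :: 'k mpoly) * (\<Sum>a<m. Var r ^ a * Var (Suc r) ^ (m - Suc a))"
    using power_diff_sumr2[of "Var r :: 'k mpoly" m "Var (Suc r)"]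
    by (simp add: mult.commute algebra_simps)
  show ?thesis unfolding sum_pairs A B by (simp add: mult.assoc)
qed

lemma demazure_Var_Suc: "demazure r (Var (Suc r) * p) = Var r * demazure r p - p"
proof (rule demazureI)
  have "(Var (Suc r) - Var r) * (Var r * demazure r p - p) =
      Var r * ((Var (Suc r) - Var r) * demazure r p) - (Var (Suc r) - Var r) * p"
    by (simp add: right_diff_distrib mult_ac)
  then show "(Var (Suc r) - Var r) * (Var r * demazure r p - p) =
      swap r (Var (Suc r) * p) - Var (Suc r) * p"
    unfolding demazure by (simp add: transpose_adjacent algebra_simps)
qed

lemma demazure_Var: "demazure r (Var r * p) = Var (Suc r) * demazure r p + p"
proof (rule demazureI)
  have "(Var (Suc r) - Var r) * (Var (Suc r) * demazure r p + p) =
      Var (Suc r) * ((Var (Suc r) - Var r) * demazure r p) + (Var (Suc r) - Var r) * p"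
    by (simp add: distrib_left mult_ac)
  then show "(Var (Suc r) - Var r) * (Var (Suc r) * demazure r p + p) =
      swap r (Var r * p) - Var r * p"
    unfolding demazure by (simp add: transpose_adjacent algebra_simps)
qed

lemma act_klrw_rel:
  fixes f :: "('i, 'k::field) mor"
  assumes "klrw_rel Q f g" "1 \<le> r"
  shows "act Q \<mu> r f p = act Q \<mu> r g p"
  using assms(1)
proof cases
  case (klrw_dot_cross i j)
  then show ?thesis
    using demazure_Var_Suc[of r p] by (auto simp: transpose_adjacent mult_ac)
next
  case (klrw_cross_dot i j)
  then show ?thesis
    using demazure_Var[of r p] by (auto simp: transpose_adjacent mult_ac)
next
  case (klrw_cross_cross_same i)
  then show ?thesis by (simp add: demazure_demazure)
next
  case (klrw_cross_cross i j)
  have "ffac Q i j (Var 1) (Var 2) \<in> polys (nblack [Black i, Black j])"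
    by (rule ffac_in_polys) simp_all
  then have "act Q \<mu> r (dots [Black i, Black j] (ffac Q i j (Var 1) (Var 2)) :: ('i, 'k) mor) p =
      subst (\<lambda>j. Var (j + r - 1)) (ffac Q i j (Var 1) (Var 2)) * p"
    using assms(2) by (rule act_dots)
  also have "\<dots> = ffac Q i j (Var r) (Var (Suc r)) * p" by simp
  finally show ?thesis using klrw_cross_cross by (simp add: ffac_def transpose_adjacent mult_ac)
next
  case (klrw_braid i j k)
  show ?thesis
  proof (cases "i = k \<and> k \<noteq> j")
    case True
    then have k: "k = i" "i \<noteq> j" by auto
    show ?thesis unfolding klrw_braid(1,2) if_P[OF True]
      unfolding k(1) by (rule act_braid_iji[OF assms(2) k(2)])
  next
    case False
    show ?thesis unfolding klrw_braid(1,2) if_not_P[OF False] act.simps(9)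
      by (rule act_braid_other[OF False])
  qed
next
  case (klrw_red_middle i j \<theta>)
  show ?thesis
  proof (cases "i = j")
    case True
    let ?m = "Poly_Mapping.lookup \<theta> j"
    have D: "(Var (Suc r) - Var r) * (Var r ^ ?m * demazure r p - demazure r (Var (Suc r) ^ ?m * p)) =
        (Var (Suc r) ^ ?m - Var r ^ ?m) * p"
    proof -
      have "(Var (Suc r) - Var r) * (Var r ^ ?m * demazure r p - demazure r (Var (Suc r) ^ ?m * p)) =
          Var r ^ ?m * ((Var (Suc r) - Var r) * demazure r p) -
          (Var (Suc r) - Var r) * demazure r (Var (Suc r) ^ ?m * p)"
        by (simp only: right_diff_distrib mult.left_commute)
      then show ?thesis unfolding demazure by (simp add: transpose_adjacent algebra_simps)
    qed
    have "(Var (Suc r) - Var r) * act Q \<mu> r f p = (Var (Suc r) - Var r) * act Q \<mu> r g p"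
      unfolding klrw_red_middle(1,2) if_P[OF True] act_diff
      unfolding True red_correction[OF assms(2)]
      using D by simp
    then show ?thesis by (rule mult_left_cancel_mpoly[THEN iffD1, rotated]) simp
  next
    case False
    show ?thesis unfolding klrw_red_middle(1,2) if_not_P[OF False] act_diff
      using False by (simp add: transpose_adjacent mult_ac)
  qed
next
  case (klrw_red_right i j \<theta>)
  then show ?thesis by simp
next
  case (klrw_red_left i j \<theta>)
  show ?thesis
  proof (cases "i = j")
    case True
    let ?m = "Poly_Mapping.lookup \<theta> j"
    have "demazure r ((Var r * Var (Suc r)) ^ ?m * p) = (Var r * Var (Suc r)) ^ ?m * demazure r p"
      by (rule demazure_symmetric) (simp add: transpose_adjacent mult_ac)
    then show ?thesis unfolding klrw_red_left(1,2) using True by (simp add: power_mult_distrib mult_ac)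
  next
    case False
    then show ?thesis unfolding klrw_red_left(1,2) by (auto simp: transpose_adjacent mult_ac)
  qed
qed (simp_all add: mult_ac)

lemma klrw_rel_typing:
  "klrw_rel Q f g \<Longrightarrow> mor_in Q \<tau> C f \<and> mor_in Q \<tau> C g \<and> src f = src g \<and> tgt \<tau> f = tgt \<tau> g"
  by (induction rule: klrw_rel.induct) simp_all

context involutive_quiver
begin

lemma oklrw_rel_typing:
  "oklrw_rel Q \<tau> \<mu> f g \<Longrightarrow>
     mor_in Q \<tau> oKLRW f \<and> mor_in Q \<tau> oKLRW g \<and> src f = src g \<and> tgt \<tau> f = tgt \<tau> g"
  by (induction rule: oklrw_rel.induct) (auto simp: tau_verts tau_invol)

lemma mor_in_words: "mor_in Q \<tau> C f \<Longrightarrow> src f \<in> words Q \<and> tgt \<tau> f \<in> words Q"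
  by (induction f arbitrary: C) (auto simp: tau_verts)

lemma mor_in_KLRW: "mor_in Q \<tau> KLRW f \<Longrightarrow> mor_in Q \<tau> C f"
  by (induction f) auto

lemma mor_eq_typing:
  "mor_eq Q \<tau> \<mu> C f g \<Longrightarrow> mor_in Q \<tau> C f \<and> mor_in Q \<tau> C g \<and> src f = src g \<and> tgt \<tau> f = tgt \<tau> g"
proof (induction rule: mor_eq.induct)
  case (meq_klrw_rel f g C)
  then show ?case by (rule klrw_rel_typing)
next
  case (meq_oklrw_rel f g)
  then show ?case by (rule oklrw_rel_typing)
qed (auto dest: mor_in_words mor_in_KLRW)

lemma tau_dominates:
  assumes "i \<in> verts Q" "j \<in> verts Q"
  shows "\<tau> i \<rightarrow>\<^bsub>Q\<^esub> \<tau> j \<longleftrightarrow> j \<rightarrow>\<^bsub>Q\<^esub> i"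
proof -
  have *: "\<tau> b \<rightarrow>\<^bsub>Q\<^esub> \<tau> a" if "a \<rightarrow>\<^bsub>Q\<^esub> b" for a b
  proof -
    obtain h where h: "h \<in> arcs Q" "tail Q h = a" "head Q h = b"
      using \<open>a \<rightarrow>\<^bsub>Q\<^esub> b\<close> by (auto simp: arcs_ends_conv)
    have "tail Q (\<tau>\<^sub>1 h) = \<tau> b" "head Q (\<tau>\<^sub>1 h) = \<tau> a" "\<tau>\<^sub>1 h \<in> arcs Q"
      using h tail_tau head_tau tau_arcs by auto
    then show ?thesis unfolding arcs_ends_conv by force
  qed
  show ?thesis using *[of j i] *[of "\<tau> i" "\<tau> j"] assms by (auto simp: tau_invol)
qed

lemma Xfac_tau:
  assumes "i \<in> verts Q" "j \<in> verts Q"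
  shows "Xfac Q (\<tau> j) (\<tau> i) u v = Xfac Q i j u v"
    "Xfac Q (\<tau> j) i u v = Xfac Q (\<tau> i) j u v"
  using tau_dominates[of i j] tau_dominates[of "\<tau> i" j] assms
  by (simp_all add: Xfac_def tau_verts tau_invol)

lemma Xfac_neg: "Xfac Q i j (- u) (- v) = Xfac Q i j v u" "Xfac Q i j u (- v) = Xfac Q i j v (- u)"
  by (simp_all add: Xfac_def)

end

lemma dvd_power_diff: "u - w dvd u ^ n - (w ^ n :: 'r::comm_ring_1)"
  by (metis dvd_triv_left power_diff_sumr2)

lemma dvd_fmu:
  assumes "\<tau> (\<tau> i) = i"
  shows "u + v dvd fmu \<tau> \<mu> i u - (fmu \<tau> \<mu> (\<tau> i) v :: 'k::field mpoly)"
proof -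
  let ?a = "Poly_Mapping.lookup \<mu> i" and ?b = "Poly_Mapping.lookup \<mu> (\<tau> i)"
  have 1: "u + v dvd (- u) ^ ?a - v ^ ?a"
    using dvd_power_diff[of "- u" v ?a] by (metis minus_add_distrib minus_dvd_iff diff_minus_eq_add minus_diff_eq add.commute diff_conv_add_uminus)
  have 2: "u + v dvd u ^ ?b - (- v) ^ ?b"
    using dvd_power_diff[of u "- v" ?b] by simp
  have "fmu \<tau> \<mu> i u - fmu \<tau> \<mu> (\<tau> i) v = ((- u) ^ ?a - v ^ ?a) * u ^ ?b + v ^ ?a * (u ^ ?b - (- v) ^ ?b)"
    by (simp add: fmu_def assms algebra_simps)
  then show ?thesis using 1 2 by (simp only: dvd_add dvd_mult dvd_mult2)
qed

lemma rho_calc: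
  fixes y :: "'r::comm_ring_1"
  assumes "y * U = e * P - g * S" "y * V = c * (X * P) - h * (X * S)"
  shows "y * (X * (c * U) - e * V) = (e * h - c * g) * (X * S)"
proof -
  have "y * (X * (c * U) - e * V) = X * c * (y * U) - e * (y * V)" by (simp add: algebra_simps)
  then show ?thesis unfolding assms by (simp add: algebra_simps)
qed

context involutive_quiver
begin

lemma fmu_in_polys: "u \<in> polys n \<Longrightarrow> fmu \<tau> \<mu> i u \<in> polys n"
  by (simp add: fmu_def)

lemma act_rho_cross_tau:
  fixes p :: "'k::field mpoly"
  assumes i: "i \<in> verts Q" and j: "\<tau> i = j"
  shows "act Q \<mu> 1
      (CrossBB (\<tau> j) (\<tau> i) \<cdot> (Rho j \<otimes> Ident [Black (\<tau> i)]) \<cdot>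
          CrossBB (\<tau> i) j \<cdot> (Rho i \<otimes> Ident [Black j])
        \<ominus> (Rho i \<otimes> Ident [Black (\<tau> j)]) \<cdot> CrossBB (\<tau> j) i \<cdot>
          (Rho j \<otimes> Ident [Black i]) \<cdot> CrossBB i j) p =
    act Q \<mu> 1 (dots [Black j, Black i] (quot (fmu \<tau> \<mu> i (Var 1) - fmu \<tau> \<mu> j (Var 2)) (Var 1 + Var 2)) \<cdot>
         CrossBB i j) p" (is "?L = ?R")
proof -
  let ?a = "Poly_Mapping.lookup \<mu> i" and ?b = "Poly_Mapping.lookup \<mu> j"
  let ?s = "swap (Suc 0)" and ?y = "Var 1 + Var 2 :: 'k mpoly"
  let ?X = "Xfac Q i j (Var 2) (Var 1) :: 'k mpoly"
  define q :: "'k mpoly" where "q = quot (fmu \<tau> \<mu> i (Var 1) - fmu \<tau> \<mu> j (Var 2)) ?y"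
  have tj: "\<tau> j = i" and ij: "i \<noteq> j" using i j tau_invol[OF i] tau_no_fix[OF i] by auto
  have tr: "transpose (Suc 0) 2 (Suc 0) = 2" "transpose (Suc 0) 2 2 = Suc 0" "Suc (Suc 0) = 2"
    by (simp_all add: transpose_def)
  have y0: "?y \<noteq> 0" by (rule Var_add_ne_0) simp
  have dvd: "?y dvd fmu \<tau> \<mu> i (Var 1) - fmu \<tau> \<mu> j (Var 2)"
    using dvd_fmu[of \<tau> i] tau_invol[OF i] j by simp
  have q: "?y * q = fmu \<tau> \<mu> i (Var 1) - fmu \<tau> \<mu> j (Var 2)"
    unfolding q_def by (rule quot_dvd[OF dvd y0])
  have "q \<in> polys 2" unfolding q_def
    by (rule quot_in_polys[OF dvd y0]) (intro polys_intros fmu_in_polys; simp)+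
  then have "q \<in> polys (nblack [Black j, Black i])" by (simp add: numeral_2_eq_2)
  then have dots: "act Q \<mu> 1 (dots [Black j, Black i] q) r = q * r" for r
    by (subst act_dots) (simp_all add: subst_id)
  have R: "?R = q * (?X * ?s p)"
    unfolding act.simps(7) q_def[symmetric] dots using ij by (simp add: tr)
  define U where "U = ?s (neg1 (demazure (Suc 0) ((- Var 1) ^ ?a * neg1 p)))"
  define V where "V = neg1 (demazure (Suc 0) ((- Var 1) ^ ?b * neg1 (?X * ?s p)))"
  have L: "?L = ?X * ((- Var 2) ^ ?b * U) - (- Var 1) ^ ?a * V"
    unfolding act_diff using ij by (simp add: U_def V_def j tj tr)
  have U: "?y * U = (- Var 1) ^ ?a * ?s (neg1 (?s (neg1 p))) - Var 2 ^ ?a * ?s p"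
    using arg_cong[OF demazure[of "Suc 0" "(- Var 1) ^ ?a * neg1 p"], of "\<lambda>q. ?s (neg1 q)"]
    by (simp add: tr U_def)
  have V: "?y * V = (- Var 2) ^ ?b * (?X * ?s (neg1 (?s (neg1 p)))) - Var 1 ^ ?b * (?X * ?s p)"
    using arg_cong[OF demazure[of "Suc 0" "(- Var 1) ^ ?b * neg1 (?X * ?s p)"], of neg1]
    by (simp add: tr V_def swap_neg1_braid[unfolded One_nat_def] Xfac_neg mult_ac add.commute)
  have "?y * ?L = ((- Var 1) ^ ?a * Var 1 ^ ?b - (- Var 2) ^ ?b * Var 2 ^ ?a) * (?X * ?s p)"
    unfolding L by (rule rho_calc[OF U V])
  also have "\<dots> = (?y * q) * (?X * ?s p)" unfolding q by (simp add: fmu_def j tj)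
  also have "\<dots> = ?y * ?R" unfolding R by (simp only: mult.assoc)
  finally show ?thesis by (rule mult_left_cancel_mpoly[THEN iffD1, rotated]) (rule y0)
qed

lemma act_rho_cross_other:
  fixes p :: "'k::field mpoly"
  assumes i: "i \<in> verts Q" and j: "j \<in> verts Q" "\<tau> i \<noteq> j"
  shows "act Q \<mu> 1
      (CrossBB (\<tau> j) (\<tau> i) \<cdot> (Rho j \<otimes> Ident [Black (\<tau> i)]) \<cdot>
          CrossBB (\<tau> i) j \<cdot> (Rho i \<otimes> Ident [Black j])
        \<ominus> (Rho i \<otimes> Ident [Black (\<tau> j)]) \<cdot> CrossBB (\<tau> j) i \<cdot>
          (Rho j \<otimes> Ident [Black i]) \<cdot> CrossBB i j) p = 0"
proof -
  let ?s = "swap (Suc 0)" and ?a = "Poly_Mapping.lookup \<mu> i"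
  have tr: "transpose (Suc 0) 2 (Suc 0) = 2" "transpose (Suc 0) 2 2 = Suc 0" "Suc (Suc 0) = 2"
    by (simp_all add: transpose_def)
  have tji: "\<tau> j \<noteq> i" using i j tau_invol by auto
  show ?thesis
  proof (cases "i = j")
    case True
    let ?X = "\<lambda>u v. Xfac Q (\<tau> j) j u v :: 'k mpoly"
    let ?g = "(- Var 1) ^ ?a * (- Var 2) ^ ?a * ?X (Var 2) (- Var 1)"
    have g: "?s ?g = ?g" using Xfac_neg(2)[of "\<tau> j" j "Var 1 :: 'k mpoly" "Var 2"] by (simp add: tr mult_ac)
    have D: "?s (neg1 (?s (neg1 (demazure (Suc 0) p)))) = neg1 (?s (neg1 (demazure (Suc 0) p)))"
      using swap_neg1_braid[unfolded One_nat_def, of "demazure (Suc 0) p"] by (simp add: swap_demazure)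
    have "demazure (Suc 0) (?g * neg1 (?s (neg1 p))) = ?g * demazure (Suc 0) (neg1 (?s (neg1 p)))"
      by (rule demazure_symmetric[OF g])
    also have "demazure (Suc 0) (neg1 (?s (neg1 p))) = neg1 (?s (neg1 (demazure (Suc 0) p)))"
    proof (rule demazureI)
      have "neg1 (?s (neg1 ((Var 2 - Var 1) * demazure (Suc 0) p))) = neg1 (?s (neg1 (?s p - p)))"
        using demazure[of "Suc 0" p] by (simp only: tr One_nat_def)
      then show "(Var (Suc (Suc 0)) - Var (Suc 0)) * neg1 (?s (neg1 (demazure (Suc 0) p))) =
          ?s (neg1 (?s (neg1 p))) - neg1 (?s (neg1 p))"
        by (simp add: tr swap_neg1_braid[unfolded One_nat_def] algebra_simps)
    qed
    finally show ?thesis unfolding act_diff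
      using True tji by (simp add: tr mult_ac)
  next
    case False
    then have tij: "\<tau> j \<noteq> \<tau> i" using i j tau_invol by metis
    have X: "Xfac Q (\<tau> j) (\<tau> i) u v = Xfac Q i j u v" "Xfac Q (\<tau> j) i u v = Xfac Q (\<tau> i) j u v"
      for u v :: "'k mpoly" using Xfac_tau[OF i j(1)] by auto
    show ?thesis unfolding act_diff
      using False tij tji j(2) Xfac_neg(2)[of "\<tau> i" j "Var 1 :: 'k mpoly" "Var 2"]
      by (simp add: tr X Xfac_neg(1) swap_neg1_braid[unfolded One_nat_def] mult_ac)
  qed
qed

lemma act_oklrw_rel:
  fixes f :: "('i, 'k::field) mor"
  assumes "oklrw_rel Q \<tau> \<mu> f g"
  shows "act Q \<mu> 1 f p = act Q \<mu> 1 g p"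
  using assms
proof cases
  case (oklrw_rho_rho i)
  have "fmu \<tau> \<mu> i (- Var 1) \<in> polys (nblack [Black i])"
    by (rule fmu_in_polys) simp
  then have "act Q \<mu> 1 (dots [Black i] (fmu \<tau> \<mu> i (- Var 1)) :: ('i, 'k) mor) p = fmu \<tau> \<mu> i (- Var 1) * p"
    by (subst act_dots) (simp_all add: subst_id)
  then show ?thesis using oklrw_rho_rho by (simp add: fmu_def mult_ac)
next
  case (oklrw_rho_dot i)
  then show ?thesis by (simp add: const_uminus mult_ac)
next
  case (oklrw_rho_cross i j)
  show ?thesis
  proof (cases "\<tau> i = j")
    case True
    show ?thesis unfolding oklrw_rho_cross(1,2) if_P[OF True]
      by (rule act_rho_cross_tau) fact+
  next
    case False
    show ?thesis unfolding oklrw_rho_cross(1,2) if_not_P[OF False] act.simps(9)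
      by (rule act_rho_cross_other) fact+
  qed
qed

theorem act_mor_eq:
  fixes f g :: "('i, 'k::field) mor"
  shows "\<lbrakk>mor_eq Q \<tau> \<mu> C f g; C = oKLRW \<Longrightarrow> r = 1; 1 \<le> r\<rbrakk> \<Longrightarrow> act Q \<mu> r f p = act Q \<mu> r g p"
proof (induction arbitrary: r p rule: mor_eq.induct)
  case (meq_klrw_rel f g C)
  then show ?case by (intro act_klrw_rel)
next
  case (meq_oklrw_rel f g)
  then show ?case by (simp add: act_oklrw_rel[unfolded One_nat_def])
next
  case (meq_tens_cong C f f' g g')
  then show ?case using mor_eq_typing[OF meq_tens_cong.hyps(1)] by simp
next
  case (meq_comp_add_right C g f f')
  then show ?case using act_linear(1)[of Q \<tau> C g r] by simp
next
  case (meq_comp_scale_right C g f c)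
  then show ?case using act_linear(2)[of Q \<tau> C g r] by simp
next
  case (meq_tens_add_right C f g g')
  then show ?case using act_linear(1)[of Q \<tau> C f r] by simp
next
  case (meq_tens_scale_right C f g c)
  then show ?case using act_linear(2)[of Q \<tau> C f r] by simp
next
  case (meq_interchange C g f g' f')
  let ?r = "r + nblack (src f)"
  show ?case
  proof (cases "nblack (tgt \<tau> f) = nblack (src f)")
    case True
    have "locop ?r (act Q \<mu> r f)"
      using meq_interchange by (intro locop_act[of Q \<tau> C]) auto
    then have "act Q \<mu> ?r g' (act Q \<mu> r f q) = act Q \<mu> r f (act Q \<mu> ?r g' q)" for q
      using meq_interchange by (intro act_commute) auto
    then show ?thesis using meq_interchange True by simp
  next
    case False
    then have "act Q \<mu> r f q = 0" for q
      using meq_interchange by (intro act_nblack[of Q \<tau> C]) auto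
    then show ?thesis by simp
  qed
next
  case (meq_tens_assoc C f g h)
  then show ?case by (simp add: add.assoc)
qed (simp_all add: const_add const_mult const_uminus algebra_simps)

lemma equiv_oKLRW_eq: "equiv (oKLRW_exprs Q \<tau> X Y) (oKLRW_eq Q \<tau> \<mu> X Y)"
  unfolding equiv_def refl_on_def sym_def trans_def oKLRW_eq_def oKLRW_exprs_def
  by (auto intro: meq_refl meq_sym meq_trans)

theorem poly_rep_class:
  assumes "f \<in> oKLRW_exprs Q \<tau> X Y"
  shows "poly_rep Q \<mu> (oKLRW_eq Q \<tau> \<mu> X Y `` {f}) = poly_op Q \<mu> f"
proof -
  have "poly_op Q \<mu> g = poly_op Q \<mu> f" if "g \<in> oKLRW_eq Q \<tau> \<mu> X Y `` {f}" for g
  proof -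
    have "mor_eq Q \<tau> \<mu> oKLRW f g" "src f = src g"
      using that by (auto simp: oKLRW_eq_def oKLRW_exprs_def)
    then show ?thesis
      using act_mor_eq[of \<mu> oKLRW f g 1] by (simp add: poly_op_def restrict_def fun_eq_iff)
  qed
  moreover have "f \<in> oKLRW_eq Q \<tau> \<mu> X Y `` {f}"
    using equiv_class_self[OF equiv_oKLRW_eq assms] .
  ultimately have "poly_op Q \<mu> ` (oKLRW_eq Q \<tau> \<mu> X Y `` {f}) = {poly_op Q \<mu> f}" by blast
  then show ?thesis by (simp add: poly_rep_def)
qed

theorem poly_op_linear:
  assumes "f \<in> oKLRW_exprs Q \<tau> X Y"
  shows "poly_op Q \<mu> f \<in> polys (nblack X) \<rightarrow>\<^sub>E polys (nblack Y)"
    and "\<lbrakk>p \<in> polys (nblack X); q \<in> polys (nblack X)\<rbrakk> \<Longrightarrow>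
      poly_op Q \<mu> f (p + q) = poly_op Q \<mu> f p + poly_op Q \<mu> f q"
    and "p \<in> polys (nblack X) \<Longrightarrow> poly_op Q \<mu> f (const c * p) = const c * poly_op Q \<mu> f p"
proof -
  have f: "mor_in Q \<tau> oKLRW f" "src f = X" "tgt \<tau> f = Y" using assms by (auto simp: oKLRW_exprs_def)
  have "act Q \<mu> 1 f p \<in> polys (nblack Y)" if "p \<in> polys (nblack X)" for p
  proof (cases "nblack Y = nblack X")
    case True
    then show ?thesis using act_in_polys[OF f(1), of 1 "nblack X" p] f that by simp
  next
    case False
    then show ?thesis using act_nblack[OF f(1)] f by simp
  qed
  then show "poly_op Q \<mu> f \<in> polys (nblack X) \<rightarrow>\<^sub>E polys (nblack Y)"
    by (simp add: poly_op_def f)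
  show "\<lbrakk>p \<in> polys (nblack X); q \<in> polys (nblack X)\<rbrakk> \<Longrightarrow>
      poly_op Q \<mu> f (p + q) = poly_op Q \<mu> f p + poly_op Q \<mu> f q"
    using act_linear(1)[OF f(1), of 1] by (simp add: poly_op_def f)
  show "p \<in> polys (nblack X) \<Longrightarrow> poly_op Q \<mu> f (const c * p) = const c * poly_op Q \<mu> f p"
    using act_linear(2)[OF f(1), of 1] by (simp add: poly_op_def f)
qed

end

end

theory Submission
  imports Defs
begin

text \<open>
  The positions of the letters of a word, red ones included, are permuted with signs by the Weyl
  group of type \<open>B\<^sub>N\<close>: \<open>s\<^sub>k\<close> with \<open>k \<ge> 1\<close> crosses the \<open>k\<close>-th and the next letter, \<open>s\<^sub>0\<close> is \<open>\<rho>\<close> on the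
  first letter. Modulo diagrams with fewer crossings, the defining relations say that the diagram of
  a word in these generators depends only on its braid class, that it is zero if a square occurs, and
  that dots slide through it. As every word is braid equivalent to a normal form or to a word with a
  square, the diagrams of normal forms, multiplied by monomials in the dots, span the morphisms.
  On polynomials, such a diagram acts by a multiple of the automorphism of its group element plus
  multiples of automorphisms of shorter elements. These automorphisms are pairwise distinct, hence
  independent by Dedekind's lemma, and the spanning set is a basis on which the representation is
  injective.
\<close>

section \<open>Normal forms of words in the generators of type B\<close>

text \<open>The group enters through one multiplication rule: a generator times a normal form is
  braid equivalent to a normal form or to a word with a square. Word length serves as the degree
  throughout. Two obstacles shape the rest. The relations hold only up to terms with fewer
  crossings, so each rewriting step must record the degree of its error, and spanning becomes an
  induction along a filtration. On polynomials, a crossing of equal labels is a divided difference,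
  whose expansion in automorphisms has denominators. Multiplying each operator on the left by a
  nonzero polynomial keeps the expansion inside the polynomial ring, and leading coefficients stay
  nonzero because that ring is a domain. Moreover, polynomials see the black strands only, while
  normal forms permute all letters. The missing information comes from the words: red strands do not
  cross each other unless the diagram is zero by convention, so their order is preserved, and the
  target word shows the places of the two colours.\<close>

inductive braid :: "nat list \<Rightarrow> nat list \<Rightarrow> bool" where
  braid_far: "Suc i < j \<Longrightarrow> braid [i, j] [j, i]"
| braid_three: "1 \<le> i \<Longrightarrow> braid [i, Suc i, i] [Suc i, i, Suc i]"
| braid_four: "braid [0, 1, 0, 1] [1, 0, 1, 0]"
| braid_refl: "braid w w"
| braid_sym: "braid v w \<Longrightarrow> braid w v"
| braid_trans [trans]: "braid u v \<Longrightarrow> braid v w \<Longrightarrow> braid u w"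
| braid_context: "braid v w \<Longrightarrow> braid (a @ v @ b) (a @ w @ b)"

lemma braid_set: "braid v w \<Longrightarrow> set v = set w"
  by (induction rule: braid.induct) auto

lemma braid_length: "braid v w \<Longrightarrow> length v = length w"
  by (induction rule: braid.induct) auto

lemma braid_Cons: "braid v w \<Longrightarrow> braid (m # v) (m # w)"
  using braid_context[of v w "[m]" "[]"] by simp

lemma braid_append_right: "braid v w \<Longrightarrow> braid (v @ b) (w @ b)"
  using braid_context[of v w "[]" b] by simp

lemma braid_append_left: "braid v w \<Longrightarrow> braid (a @ v) (a @ w)"
  using braid_context[of v w a "[]"] by simp

lemma braid_commute:
  "(\<And>x. x \<in> set w \<Longrightarrow> Suc x < m \<or> Suc m < x) \<Longrightarrow> braid (m # w) (w @ [m])"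
proof (induction w)
  case Nil
  then show ?case by (simp add: braid_refl)
next
  case (Cons x w)
  have "braid [m, x] [x, m]" using Cons.prems[of x] by (auto intro: braid.intros)
  then have "braid (m # x # w) (x # m # w)" using braid_append_right[of "[m, x]" "[x, m]" w] by simp
  also have "braid (x # m # w) (x # w @ [m])" using Cons by (intro braid_Cons) auto
  finally show ?case by simp
qed

text \<open>Squares stay outside \<open>braid\<close>: a repeated generator is trivial in the group,
  but in the category it is a morphism with fewer crossings, to which the induction on crossings
  applies.\<close>

definition reducible :: "nat list \<Rightarrow> bool" where
  "reducible w \<longleftrightarrow> (\<exists>a s b. braid w (a @ s # s # b))"

lemma reducible_braid: "braid v w \<Longrightarrow> reducible w \<Longrightarrow> reducible v"
  unfolding reducible_def using braid_trans by blast

lemma reducible_append: "reducible w \<Longrightarrow> reducible (a @ w @ b)"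
proof -
  assume "reducible w"
  then obtain c s d where "braid w (c @ s # s # d)" unfolding reducible_def by blast
  then have "braid (a @ w @ b) (a @ (c @ s # s # d) @ b)" by (rule braid_context)
  then have "braid (a @ w @ b) ((a @ c) @ s # s # (d @ b))" by simp
  then show ?thesis unfolding reducible_def by blast
qed

text \<open>The shortest representatives of the cosets of \<open>B\<^sub>n\<close> in \<open>B\<^sub>n\<^sub>+\<^sub>1\<close>: \<open>coset_rep n e j\<close> moves the last of
  \<open>n + 1\<close> letters to position \<open>j\<close>, with its sign changed unless \<open>e\<close>.\<close>

fun coset_rep :: "nat \<Rightarrow> bool \<Rightarrow> nat \<Rightarrow> nat list" where
  "coset_rep n True j = [Suc j..<Suc n]"
| "coset_rep n False j = rev [1..<Suc j] @ [0..<Suc n]"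

text \<open>Factorisation along the chain of parabolic subgroups: an element of the larger group is
  a coset representative times an element of the smaller one. With 2 (n + 1) choices of
  \<open>(e, j)\<close> in the step from n to n + 1, \<open>nf n\<close> has one word for each of
  the 2^n n! signed permutations.\<close>

primrec nf :: "nat \<Rightarrow> nat list set" where
  "nf 0 = {[]}"
| "nf (Suc n) = {coset_rep n e j @ a | e j a. j \<le> n \<and> a \<in> nf n}"

lemma set_nf: "a \<in> nf n \<Longrightarrow> set a \<subseteq> {..<n}"
proof (induction n arbitrary: a)
  case (Suc n)
  then obtain e j b where *: "a = coset_rep n e j @ b" "j \<le> n" "b \<in> nf n" by auto
  then have "set b \<subseteq> {..<n}" using Suc.IH by blast
  moreover have "set (coset_rep n e j) \<subseteq> {..<Suc n}" using *(2) by (cases e) auto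
  ultimately show ?case using *(1) by auto
qed simp

lemma finite_nf: "finite (nf n)"
proof (induction n)
  case (Suc n)
  have "nf (Suc n) \<subseteq> (\<lambda>(e, j, a). coset_rep n e j @ a) ` (UNIV \<times> {..n} \<times> nf n)" by force
  then show ?case by (rule finite_subset) (simp add: Suc)
qed simp

lemma upt_split: "i \<le> j \<Longrightarrow> j \<le> k \<Longrightarrow> [i..<k] = [i..<j] @ [j..<k]"
  by (metis le_add_diff_inverse upt_add_eq_append)

lemma upt_split2: "i \<le> m \<Longrightarrow> Suc m < k \<Longrightarrow> [i..<k] = [i..<m] @ [m, Suc m] @ [Suc (Suc m)..<k]"
  using upt_split[of i m k] by (simp add: upt_conv_Cons)

text \<open>An ascending run lowers by one a letter that passes it from left to right:
  \<open>Suc m\<close> commutes with the smaller letters of \<open>c\<close>, the braid relation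
  turns \<open>Suc m, m, Suc m\<close> into \<open>m, Suc m, m\<close>, and the last
  \<open>m\<close> commutes with the larger letters of \<open>d\<close>.\<close>

lemma braid_pass:
  assumes "1 \<le> m" "\<And>x. x \<in> set c \<Longrightarrow> x < m" "\<And>x. x \<in> set d \<Longrightarrow> Suc m < x"
  shows "braid (Suc m # c @ [m, Suc m] @ d) (c @ [m, Suc m] @ d @ [m])"
proof -
  have "braid (Suc m # c) (c @ [Suc m])" using assms by (intro braid_commute) auto
  from braid_append_right[OF this]
  have "braid (Suc m # c @ [m, Suc m] @ d) (c @ [Suc m, m, Suc m] @ d)"
    by (metis (no_types, opaque_lifting) append.assoc append_Cons append_Nil)
  also have "braid (c @ [Suc m, m, Suc m] @ d) (c @ [m, Suc m, m] @ d)"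
    using assms(1) by (intro braid_context braid_sym[OF braid_three])
  also have "braid (m # d) (d @ [m])" using assms by (intro braid_commute) auto
  then have "braid (c @ [m, Suc m, m] @ d) (c @ [m, Suc m] @ d @ [m])"
    using braid_append_left[of "m # d" "d @ [m]" "c @ [m, Suc m]"] by simp
  finally show ?thesis .
qed

text \<open>A form of Deodhar's lemma. A representative is the run j+1, ..., n or the word j, ...,
  1, 0, 1, ..., n. A generator put in front extends it, or repeats its first letter, or passes
  through it and comes out as a generator of the smaller group.\<close>

lemma coset_rep_step:
  assumes "j \<le> n" "m \<le> n"
  shows "(\<exists>e' j'. j' \<le> n \<and> m # coset_rep n e j = coset_rep n e' j') \<or>
    (\<exists>m'<n. braid (m # coset_rep n e j) (coset_rep n e j @ [m'])) \<or> reducible (m # coset_rep n e j)"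
proof (cases e)
  case True
  consider "m < j" | "m = j" | "m = Suc j" | k where "m = Suc k" "Suc j \<le> k"
    by (metis Suc_leI le_neq_implies_less not_less_eq_eq not_less less_imp_Suc_add le_add1 add_Suc_right)
  then show ?thesis
  proof cases
    case 1
    then have "braid (m # coset_rep n e j) (coset_rep n e j @ [m])" 
      using True by (intro braid_commute) auto
    then show ?thesis using 1 assms by auto
  next
    case 2
    \<comment> \<open>The run grows to the left; once it contains the generator 0 it is the
      representative with sign change and j = 0.\<close>
    have "m # coset_rep n e j = (if j = 0 then coset_rep n False 0 else coset_rep n True (j - 1))"
      using 2 True assms by (simp add: upt_conv_Cons)
    then show ?thesis using assms by (metis diff_le_self le_trans le0)
  next
    case 3
    then have "m # coset_rep n e j = [] @ m # m # [Suc m..<Suc n]"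
      using True assms by (simp add: upt_conv_Cons)
    then show ?thesis unfolding reducible_def by (metis braid_refl)
  next
    case 4
    have "coset_rep n e j = [Suc j..<k] @ [k, Suc k] @ [Suc (Suc k)..<Suc n]"
      using 4 True assms upt_split2[of "Suc j" k "Suc n"] by (simp del: upt_Suc)
    then have "braid (m # coset_rep n e j) (coset_rep n e j @ [k])"
      using braid_pass[of k "[Suc j..<k]" "[Suc (Suc k)..<Suc n]"] 4 by (simp del: upt_Suc)
    then show ?thesis using 4 assms by auto
  qed
next
  case False
  consider "m = j" | "m = Suc j" | k where "m = Suc k" "Suc j \<le> k" | "1 \<le> m" "m < j" | "m = 0" "1 \<le> j"
    by (metis Suc_leI le_neq_implies_less not_less_eq_eq not_less less_imp_Suc_add le_add1 add_Suc_right One_nat_def neq0_conv)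
  then show ?thesis
  proof cases
    case 1
    have "\<exists>b. coset_rep n e j = m # b"
      using 1 False by (cases j) (simp_all add: upt_conv_Cons del: upt_Suc, simp)
    then show ?thesis unfolding reducible_def by (metis braid_refl append_Nil)
  next
    case 2
    then have "m # coset_rep n e j = coset_rep n False m" using False by simp
    then show ?thesis using assms by blast
  next
    case 3
    have "coset_rep n e j = (rev [1..<Suc j] @ [0..<k]) @ [k, Suc k] @ [Suc (Suc k)..<Suc n]"
      using 3 False assms upt_split2[of 0 k "Suc n"] by (simp del: upt_Suc)
    moreover have "x < k" if "x \<in> set (rev [1..<Suc j] @ [0..<k])" for x
      using that 3 by (auto simp del: upt_Suc)
    then have "braid (Suc k # (rev [1..<Suc j] @ [0..<k]) @ [k, Suc k] @ [Suc (Suc k)..<Suc n])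
        ((rev [1..<Suc j] @ [0..<k]) @ [k, Suc k] @ [Suc (Suc k)..<Suc n] @ [k])"
      using 3 by (intro braid_pass) (auto simp del: upt_Suc)
    ultimately have "braid (m # coset_rep n e j) (coset_rep n e j @ [k])"
      using 3(1) by (simp del: upt_Suc)
    then show ?thesis using 3 assms by auto
  next
    case 4
    \<comment> \<open>The letter m meets m+1, m on the descending arm and becomes m+1; the ascending
      arm then lowers it back to m.\<close>
    let ?A = "rev [Suc (Suc m)..<Suc j]" and ?B = "rev [1..<m]" and ?C = "[0..<m]"
      and ?D = "[Suc (Suc m)..<Suc n]"
    have u: "coset_rep n e j = ?A @ [Suc m, m] @ ?B @ ?C @ [m, Suc m] @ ?D"
      using 4 False assms upt_split2[of 1 m "Suc j"] upt_split2[of 0 m "Suc n"] by (simp del: upt_Suc)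
    have "braid (m # ?A) (?A @ [m])" by (intro braid_commute) auto
    from braid_append_right[OF this]
    have "braid (m # coset_rep n e j) (?A @ [m, Suc m, m] @ ?B @ ?C @ [m, Suc m] @ ?D)"
      unfolding u by (metis (no_types, opaque_lifting) append.assoc append_Cons append_Nil)
    also have "braid (?A @ [m, Suc m, m] @ ?B @ ?C @ [m, Suc m] @ ?D)
        (?A @ [Suc m, m, Suc m] @ ?B @ ?C @ [m, Suc m] @ ?D)"
      using 4 by (intro braid_context braid_three)
    also have "braid (Suc m # (?B @ ?C) @ [m, Suc m] @ ?D) ((?B @ ?C) @ [m, Suc m] @ ?D @ [m])"
      using 4 by (intro braid_pass) auto
    then have "braid (?A @ [Suc m, m, Suc m] @ ?B @ ?C @ [m, Suc m] @ ?D) (coset_rep n e j @ [m])"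
      unfolding u using braid_append_left[of _ _ "?A @ [Suc m, m]"] by fastforce
    finally show ?thesis using 4 assms by (auto intro!: exI[of _ m])
  next
    case 5
    \<comment> \<open>The generator 0 commutes with all letters above 1; at the turning point 1, 0,
      1 the relation of length four carries it to the other side.\<close>
    let ?A = "rev [2..<Suc j]" and ?D = "[2..<Suc n]"
    have u: "coset_rep n e j = ?A @ [1, 0, 1] @ ?D"
      using 5 False assms by (simp add: upt_conv_Cons numeral_2_eq_2 del: upt_Suc)
    have "braid (0 # ?A) (?A @ [0])" by (intro braid_commute) auto
    from braid_append_right[OF this]
    have "braid (m # coset_rep n e j) (?A @ [0, 1, 0, 1] @ ?D)"
      unfolding u 5(1) by (metis (no_types, opaque_lifting) append.assoc append_Cons append_Nil)
    also have "braid \<dots> (?A @ [1, 0, 1, 0] @ ?D)"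
      by (intro braid_context braid_four)
    also have "braid (0 # ?D) (?D @ [0])" by (intro braid_commute) auto
    then have "braid (?A @ [1, 0, 1, 0] @ ?D) (coset_rep n e j @ [0])"
      unfolding u using braid_append_left[of _ _ "?A @ [1, 0, 1]"] by fastforce
    finally show ?thesis using 5 assms by (auto intro!: exI[of _ 0])
  qed
qed

text \<open>The generator is pushed through the factors of the normal form, from the largest group
  downwards: a factor absorbs it, or hands it on as a generator of the next smaller group, or a
  square appears.\<close>

lemma nf_step:
  "a \<in> nf n \<Longrightarrow> m < n \<Longrightarrow> (\<exists>b \<in> nf n. braid (m # a) b) \<or> reducible (m # a)"
proof (induction n arbitrary: a m)
  case (Suc n)
  then obtain e j b where a: "a = coset_rep n e j @ b" "j \<le> n" "b \<in> nf n" by auto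
  from coset_rep_step[OF a(2), of m e] Suc.prems(2)
  consider e' j' where "j' \<le> n" "m # coset_rep n e j = coset_rep n e' j'"
    | m' where "m' < n" "braid (m # coset_rep n e j) (coset_rep n e j @ [m'])"
    | "reducible (m # coset_rep n e j)" by auto
  then show ?case
  proof cases
    case 1
    then have "m # a = coset_rep n e' j' @ b" using a(1) by simp
    then have "m # a \<in> nf (Suc n)" using 1 a(3) by auto
    then show ?thesis by (metis braid_refl)
  next
    case 2
    have br: "braid (m # a) (coset_rep n e j @ m' # b)"
      using braid_append_right[OF 2(2), of b] a(1) by simp
    from Suc.IH[OF a(3) 2(1)] show ?thesis
    proof
      assume "\<exists>c\<in>nf n. braid (m' # b) c"
      then obtain c where c: "c \<in> nf n" "braid (m' # b) c" by blast
      have "braid (m # a) (coset_rep n e j @ c)"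
        using br braid_append_left[OF c(2)] by (rule braid_trans)
      moreover have "coset_rep n e j @ c \<in> nf (Suc n)" using a(2) c(1) by auto
      ultimately show ?thesis by blast
    next
      assume "reducible (m' # b)"
      then have "reducible (coset_rep n e j @ m' # b)"
        using reducible_append[of "m' # b" "coset_rep n e j" "[]"] by simp
      then show ?thesis using br reducible_braid by blast
    qed
  next
    case 3
    then have "reducible (m # a)" using reducible_append[of _ "[]" b] a(1) by fastforce
    then show ?thesis by blast
  qed
qed simp

lemma Nil_in_nf: "[] \<in> nf n"
proof (induction n)
  case (Suc n)
  then show ?case by (auto intro!: exI[of _ True] exI[of _ n])
qed simp

lemma nf_or_reducible: "set w \<subseteq> {..<n} \<Longrightarrow> (\<exists>a \<in> nf n. braid w a) \<or> reducible w"
proof (induction w)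
  case Nil
  then show ?case using Nil_in_nf braid_refl by blast
next
  case (Cons m w)
  then consider a where "a \<in> nf n" "braid w a" | "reducible w" by auto
  then show ?case
  proof cases
    case 1
    then have "braid (m # w) (m # a)" by (simp add: braid_Cons)
    then show ?thesis using nf_step[OF 1(1), of m] Cons.prems braid_trans reducible_braid by fastforce
  next
    case 2
    then show ?thesis using reducible_append[of w "[m]" "[]"] by simp
  qed
qed

section \<open>Calculus of whiskered morphisms\<close>

locale oklrw = involutive_quiver Q \<tau> \<tau>\<^sub>1
  for Q :: "('i, 'a) pre_digraph" and \<tau> :: "'i \<Rightarrow> 'i" and \<tau>\<^sub>1 :: "'a \<Rightarrow> 'a" +
  fixes \<mu> :: "'i weight"
begin

abbreviation eqv :: "('i, 'k::field) mor \<Rightarrow> cat \<Rightarrow> ('i, 'k) mor \<Rightarrow> bool" ("_ \<approx>\<^bsub>_\<^esub> _" [51, 0, 51] 50) where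
  "f \<approx>\<^bsub>C\<^esub> g \<equiv> mor_eq Q \<tau> \<mu> C f g"

abbreviation eqo :: "('i, 'k::field) mor \<Rightarrow> ('i, 'k) mor \<Rightarrow> bool" (infix "\<approx>" 50) where
  "f \<approx> g \<equiv> mor_eq Q \<tau> \<mu> oKLRW f g"

declare meq_trans [trans]

section \<open>Consequences of the interchange law\<close>

lemma eqv_comp: "g \<approx>\<^bsub>C\<^esub> g' \<Longrightarrow> f \<approx>\<^bsub>C\<^esub> f' \<Longrightarrow> src g = tgt \<tau> f \<Longrightarrow> g \<cdot> f \<approx>\<^bsub>C\<^esub> g' \<cdot> f'"
  by (rule meq_comp_cong)

lemma eqv_comp_left: "g \<approx>\<^bsub>C\<^esub> g' \<Longrightarrow> mor_in Q \<tau> C f \<Longrightarrow> src g = tgt \<tau> f \<Longrightarrow> g \<cdot> f \<approx>\<^bsub>C\<^esub> g' \<cdot> f"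
  by (intro meq_comp_cong meq_refl)

lemma eqv_comp_right: "f \<approx>\<^bsub>C\<^esub> f' \<Longrightarrow> mor_in Q \<tau> C g \<Longrightarrow> src g = tgt \<tau> f \<Longrightarrow> g \<cdot> f \<approx>\<^bsub>C\<^esub> g \<cdot> f'"
  by (intro meq_comp_cong meq_refl)

text \<open>Two diagrams side by side can be moved to different heights: insert identities and apply
  the interchange law. The right factor lies in \<open>KLRW\<close>, because a \<rho> may have no
  strands on its left.\<close>

lemma tens_expand:
  assumes "mor_in Q \<tau> C f" "mor_in Q \<tau> KLRW g"
  shows "f \<otimes> g \<approx>\<^bsub>C\<^esub> (f \<otimes> Ident (tgt \<tau> g)) \<cdot> (Ident (src f) \<otimes> g)"
    and "f \<otimes> g \<approx>\<^bsub>C\<^esub> (Ident (tgt \<tau> f) \<otimes> g) \<cdot> (f \<otimes> Ident (src g))"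
proof -
  note w = mor_in_words[OF assms(1)] mor_in_words[OF assms(2)]
  have "f \<otimes> g \<approx>\<^bsub>C\<^esub> (f \<cdot> Ident (src f)) \<otimes> (Ident (tgt \<tau> g) \<cdot> g)"
    using assms by (intro meq_tens_cong meq_sym[OF meq_comp_id_right] meq_sym[OF meq_comp_id_left])
  also have "\<dots> \<approx>\<^bsub>C\<^esub> (f \<otimes> Ident (tgt \<tau> g)) \<cdot> (Ident (src f) \<otimes> g)"
    using assms w by (intro meq_interchange) simp
  finally show "f \<otimes> g \<approx>\<^bsub>C\<^esub> (f \<otimes> Ident (tgt \<tau> g)) \<cdot> (Ident (src f) \<otimes> g)" .
  have "f \<otimes> g \<approx>\<^bsub>C\<^esub> (Ident (tgt \<tau> f) \<cdot> f) \<otimes> (g \<cdot> Ident (src g))"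
    using assms by (intro meq_tens_cong meq_sym[OF meq_comp_id_right] meq_sym[OF meq_comp_id_left])
  also have "\<dots> \<approx>\<^bsub>C\<^esub> (Ident (tgt \<tau> f) \<otimes> g) \<cdot> (f \<otimes> Ident (src g))"
    using assms w by (intro meq_interchange) simp
  finally show "f \<otimes> g \<approx>\<^bsub>C\<^esub> (Ident (tgt \<tau> f) \<otimes> g) \<cdot> (f \<otimes> Ident (src g))" .
qed

lemma tens_exchange:
  assumes "mor_in Q \<tau> C f" "mor_in Q \<tau> KLRW g"
  shows "(f \<otimes> Ident (tgt \<tau> g)) \<cdot> (Ident (src f) \<otimes> g) \<approx>\<^bsub>C\<^esub> (Ident (tgt \<tau> f) \<otimes> g) \<cdot> (f \<otimes> Ident (src g))"
  using meq_trans[OF meq_sym[OF tens_expand(1)] tens_expand(2)] assms by blast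

lemma comp_tens_Ident:
  assumes "mor_in Q \<tau> C (g \<cdot> f)" "b \<in> words Q"
  shows "(g \<cdot> f) \<otimes> Ident b \<approx>\<^bsub>C\<^esub> (g \<otimes> Ident b) \<cdot> (f \<otimes> Ident b)"
proof -
  have "Ident b \<approx>\<^bsub>KLRW\<^esub> Ident b \<cdot> Ident b"
    using meq_sym[OF meq_comp_id_left[of Q \<tau> KLRW "Ident b"]] assms by simp
  then have "(g \<cdot> f) \<otimes> Ident b \<approx>\<^bsub>C\<^esub> (g \<cdot> f) \<otimes> (Ident b \<cdot> Ident b)"
    using assms by (intro meq_tens_cong meq_refl)
  also have "\<dots> \<approx>\<^bsub>C\<^esub> (g \<otimes> Ident b) \<cdot> (f \<otimes> Ident b)"
    using assms by (intro meq_interchange) simp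
  finally show ?thesis .
qed

lemma Ident_tens_comp:
  assumes "mor_in Q \<tau> KLRW (g \<cdot> f)" "a \<in> words Q"
  shows "Ident a \<otimes> (g \<cdot> f) \<approx>\<^bsub>C\<^esub> (Ident a \<otimes> g) \<cdot> (Ident a \<otimes> f)"
proof -
  have "Ident a \<approx>\<^bsub>C\<^esub> Ident a \<cdot> Ident a"
    using meq_sym[OF meq_comp_id_left[of Q \<tau> C "Ident a"]] assms by simp
  then have "Ident a \<otimes> (g \<cdot> f) \<approx>\<^bsub>C\<^esub> (Ident a \<cdot> Ident a) \<otimes> (g \<cdot> f)"
    using assms by (intro meq_tens_cong meq_refl)
  also have "\<dots> \<approx>\<^bsub>C\<^esub> (Ident a \<otimes> g) \<cdot> (Ident a \<otimes> f)"
    using assms by (intro meq_interchange) simp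
  finally show ?thesis .
qed

lemma Ident_tens_Ident_tens:
  assumes "mor_in Q \<tau> KLRW f" "a \<in> words Q" "b \<in> words Q"
  shows "Ident a \<otimes> Ident b \<otimes> f \<approx>\<^bsub>C\<^esub> Ident (a @ b) \<otimes> f"
proof -
  have "Ident a \<otimes> Ident b \<otimes> f \<approx>\<^bsub>C\<^esub> (Ident a \<otimes> Ident b) \<otimes> f"
    using assms by (intro meq_sym[OF meq_tens_assoc]) simp
  also have "\<dots> \<approx>\<^bsub>C\<^esub> Ident (a @ b) \<otimes> f"
    using assms by (intro meq_tens_cong meq_refl meq_tens_ident)
  finally show ?thesis .
qed

lemma tens_Ident_tens_Ident:
  assumes "mor_in Q \<tau> C f" "a \<in> words Q" "b \<in> words Q"
  shows "(f \<otimes> Ident a) \<otimes> Ident b \<approx>\<^bsub>C\<^esub> f \<otimes> Ident (a @ b)"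
proof -
  have "(f \<otimes> Ident a) \<otimes> Ident b \<approx>\<^bsub>C\<^esub> f \<otimes> Ident a \<otimes> Ident b"
    using assms by (intro meq_tens_assoc) simp
  also have "\<dots> \<approx>\<^bsub>C\<^esub> f \<otimes> Ident (a @ b)"
    using assms by (intro meq_tens_cong meq_refl meq_tens_ident)
  finally show ?thesis .
qed

section \<open>Zero morphisms and differences\<close>

lemma scale_0: "mor_in Q \<tau> C f \<Longrightarrow> 0 \<odot> f \<approx>\<^bsub>C\<^esub> Zero (src f) (tgt \<tau> f)"
proof -
  assume f: "mor_in Q \<tau> C f"
  have "(1 + - 1) \<odot> f \<approx>\<^bsub>C\<^esub> 1 \<odot> f \<oplus> (- 1) \<odot> f"
    using f by (rule meq_scale_add_left)
  also have "\<dots> \<approx>\<^bsub>C\<^esub> f \<ominus> f"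
    using f by (intro meq_add_cong meq_scale_one meq_refl) simp_all
  also have "\<dots> \<approx>\<^bsub>C\<^esub> Zero (src f) (tgt \<tau> f)"
    using f by (rule meq_add_minus)
  finally show ?thesis by simp
qed

text \<open>The axioms of linearity mention \<open>Zero\<close> only in connection with addition.
  Written as 0 times itself, it moves through composites and tensor products by the axioms for
  scalars.\<close>

lemma Zero_scale_0: "v \<in> words Q \<Longrightarrow> w \<in> words Q \<Longrightarrow> Zero v w \<approx>\<^bsub>C\<^esub> 0 \<odot> Zero v w"
  using meq_sym[OF scale_0[of C "Zero v w"]] by simp

lemma comp_Zero:
  assumes "mor_in Q \<tau> C g" "v \<in> words Q"
  shows "g \<cdot> Zero v (src g) \<approx>\<^bsub>C\<^esub> Zero v (tgt \<tau> g)"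
proof -
  have w: "src g \<in> words Q" "tgt \<tau> g \<in> words Q" using mor_in_words[OF assms(1)] by auto
  have "g \<cdot> Zero v (src g) \<approx>\<^bsub>C\<^esub> g \<cdot> (0 \<odot> Zero v (src g))"
    using assms w by (intro eqv_comp_right Zero_scale_0) simp_all
  also have "\<dots> \<approx>\<^bsub>C\<^esub> 0 \<odot> (g \<cdot> Zero v (src g))"
    using assms w by (intro meq_comp_scale_right) simp
  also have "\<dots> \<approx>\<^bsub>C\<^esub> Zero v (tgt \<tau> g)"
    using scale_0[of C "g \<cdot> Zero v (src g)"] assms w by simp
  finally show ?thesis .
qed

lemma Zero_comp:
  assumes "mor_in Q \<tau> C f" "v \<in> words Q"
  shows "Zero (tgt \<tau> f) v \<cdot> f \<approx>\<^bsub>C\<^esub> Zero (src f) v"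
proof -
  have w: "src f \<in> words Q" "tgt \<tau> f \<in> words Q" using mor_in_words[OF assms(1)] by auto
  have "Zero (tgt \<tau> f) v \<cdot> f \<approx>\<^bsub>C\<^esub> (0 \<odot> Zero (tgt \<tau> f) v) \<cdot> f"
    using assms w by (intro eqv_comp_left Zero_scale_0) simp_all
  also have "\<dots> \<approx>\<^bsub>C\<^esub> 0 \<odot> (Zero (tgt \<tau> f) v \<cdot> f)"
    using assms w by (intro meq_comp_scale_left) simp
  also have "\<dots> \<approx>\<^bsub>C\<^esub> Zero (src f) v"
    using scale_0[of C "Zero (tgt \<tau> f) v \<cdot> f"] assms w by simp
  finally show ?thesis .
qed

lemma Zero_tens:
  assumes "mor_in Q \<tau> KLRW f" "v \<in> words Q" "w \<in> words Q"
  shows "Zero v w \<otimes> f \<approx>\<^bsub>C\<^esub> Zero (v @ src f) (w @ tgt \<tau> f)"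
proof -
  have "Zero v w \<otimes> f \<approx>\<^bsub>C\<^esub> (0 \<odot> Zero v w) \<otimes> f"
    using assms by (intro meq_tens_cong Zero_scale_0 meq_refl)
  also have "\<dots> \<approx>\<^bsub>C\<^esub> 0 \<odot> (Zero v w \<otimes> f)"
    using assms by (intro meq_tens_scale_left) simp
  also have "\<dots> \<approx>\<^bsub>C\<^esub> Zero (v @ src f) (w @ tgt \<tau> f)"
    using scale_0[of C "Zero v w \<otimes> f"] assms by simp
  finally show ?thesis .
qed

lemma tens_Zero:
  assumes "mor_in Q \<tau> C f" "v \<in> words Q" "w \<in> words Q"
  shows "f \<otimes> Zero v w \<approx>\<^bsub>C\<^esub> Zero (src f @ v) (tgt \<tau> f @ w)"
proof -
  have "f \<otimes> Zero v w \<approx>\<^bsub>C\<^esub> f \<otimes> (0 \<odot> Zero v w)"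
    using assms by (intro meq_tens_cong Zero_scale_0 meq_refl)
  also have "\<dots> \<approx>\<^bsub>C\<^esub> 0 \<odot> (f \<otimes> Zero v w)"
    using assms by (intro meq_tens_scale_right) simp
  also have "\<dots> \<approx>\<^bsub>C\<^esub> Zero (src f @ v) (tgt \<tau> f @ w)"
    using scale_0[of C "f \<otimes> Zero v w"] assms by simp
  finally show ?thesis .
qed

lemma add_zero_right:
  assumes "mor_in Q \<tau> C f" "z \<approx>\<^bsub>C\<^esub> Zero (src f) (tgt \<tau> f)"
  shows "f \<oplus> z \<approx>\<^bsub>C\<^esub> f"
proof -
  have "f \<oplus> z \<approx>\<^bsub>C\<^esub> f \<oplus> Zero (src f) (tgt \<tau> f)"
    using assms mor_eq_typing[OF assms(2)] by (intro meq_add_cong meq_refl) auto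
  also have "\<dots> \<approx>\<^bsub>C\<^esub> f" using assms(1) by (rule meq_add_zero)
  finally show ?thesis .
qed

lemma add_commute_eqv:
  assumes "mor_in Q \<tau> C f" "mor_in Q \<tau> C g" "src f = src g" "tgt \<tau> f = tgt \<tau> g"
  shows "f \<oplus> g \<approx>\<^bsub>C\<^esub> g \<oplus> f"
  using assms by (intro meq_add_commute) simp

lemma add_zero_left:
  assumes "mor_in Q \<tau> C f" "z \<approx>\<^bsub>C\<^esub> Zero (src f) (tgt \<tau> f)"
  shows "z \<oplus> f \<approx>\<^bsub>C\<^esub> f"
proof -
  have "z \<oplus> f \<approx>\<^bsub>C\<^esub> f \<oplus> z"
    using assms mor_eq_typing[OF assms(2)] by (intro add_commute_eqv) auto
  also have "\<dots> \<approx>\<^bsub>C\<^esub> f" using assms by (rule add_zero_right)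
  finally show ?thesis .
qed

text \<open>The braid-like relations equate a difference with a correction; this isolates one side,
  which is the form that \<open>cong\<close> and \<open>congK\<close> ask for.\<close>

lemma eqv_diffD:
  assumes "f \<ominus> g \<approx>\<^bsub>C\<^esub> h"
  shows "f \<approx>\<^bsub>C\<^esub> g \<oplus> h"
proof -
  have t: "mor_in Q \<tau> C f" "mor_in Q \<tau> C g" "mor_in Q \<tau> C h" "src f = src g" "tgt \<tau> f = tgt \<tau> g"
    "src h = src g" "tgt \<tau> h = tgt \<tau> g" using mor_eq_typing[OF assms] by auto
  have "g \<oplus> h \<approx>\<^bsub>C\<^esub> h \<oplus> g"
    using t by (intro add_commute_eqv) auto
  also have "\<dots> \<approx>\<^bsub>C\<^esub> f \<ominus> g \<oplus> g"
    using t by (intro meq_add_cong meq_sym[OF assms] meq_refl) auto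
  also have "\<dots> \<approx>\<^bsub>C\<^esub> f \<oplus> ((- 1) \<odot> g \<oplus> g)"
    using t by (intro meq_add_assoc) auto
  also have "\<dots> \<approx>\<^bsub>C\<^esub> f \<oplus> (g \<ominus> g)"
    using t by (intro meq_add_cong add_commute_eqv meq_refl) auto
  also have "\<dots> \<approx>\<^bsub>C\<^esub> f \<oplus> Zero (src f) (tgt \<tau> f)"
    using t meq_add_minus[of Q \<tau> C g] by (intro meq_add_cong meq_refl) auto
  also have "\<dots> \<approx>\<^bsub>C\<^esub> f"
    using t by (intro meq_add_zero) auto
  finally show ?thesis by (rule meq_sym)
qed

lemma eqv_diff_zeroD:
  assumes "f \<ominus> g \<approx>\<^bsub>C\<^esub> Zero v w"
  shows "f \<approx>\<^bsub>C\<^esub> g"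
proof -
  have "f \<approx>\<^bsub>C\<^esub> g \<oplus> Zero v w" using assms by (rule eqv_diffD)
  also have "\<dots> \<approx>\<^bsub>C\<^esub> g"
    using mor_eq_typing[OF assms] by (intro add_zero_right) (auto intro!: meq_refl)
  finally show ?thesis .
qed

text \<open>A morphism of \<open>KLRW\<close> with vertical strands on both sides. Whiskered
  generators, and \<rho> with vertical strands on its right, are the horizontal slices into which
  every diagram is cut.\<close>

definition wh :: "'i word \<Rightarrow> ('i, 'k::field) mor \<Rightarrow> 'i word \<Rightarrow> ('i, 'k) mor" where
  "wh a f b = Ident a \<otimes> f \<otimes> Ident b"

lemma wh_typing [simp]:
  "src (wh a f b) = a @ src f @ b" "tgt \<tau> (wh a f b) = a @ tgt \<tau> f @ b"
  "mor_in Q \<tau> C (wh a f b) \<longleftrightarrow> a \<in> words Q \<and> b \<in> words Q \<and> mor_in Q \<tau> KLRW f"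
  by (auto simp: wh_def)

lemma wh_cong: "f \<approx>\<^bsub>KLRW\<^esub> g \<Longrightarrow> a \<in> words Q \<Longrightarrow> b \<in> words Q \<Longrightarrow> wh a f b \<approx>\<^bsub>C\<^esub> wh a g b"
  unfolding wh_def by (intro meq_tens_cong meq_refl) simp_all

lemma wh_comp:
  assumes "mor_in Q \<tau> KLRW (g \<cdot> f)" "a \<in> words Q" "b \<in> words Q"
  shows "wh a (g \<cdot> f) b \<approx>\<^bsub>C\<^esub> wh a g b \<cdot> wh a f b"
proof -
  have "wh a (g \<cdot> f) b \<approx>\<^bsub>C\<^esub> Ident a \<otimes> ((g \<otimes> Ident b) \<cdot> (f \<otimes> Ident b))"
    unfolding wh_def using assms by (intro meq_tens_cong meq_refl comp_tens_Ident) simp_all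
  also have "\<dots> \<approx>\<^bsub>C\<^esub> wh a g b \<cdot> wh a f b"
    unfolding wh_def using assms by (intro Ident_tens_comp) simp_all
  finally show ?thesis .
qed

lemma wh_Ident:
  assumes "a \<in> words Q" "w \<in> words Q" "b \<in> words Q"
  shows "wh a (Ident w) b \<approx>\<^bsub>C\<^esub> Ident (a @ w @ b)"
proof -
  have "wh a (Ident w) b \<approx>\<^bsub>C\<^esub> Ident a \<otimes> Ident (w @ b)"
    unfolding wh_def using assms by (intro meq_tens_cong meq_refl meq_tens_ident) simp_all
  also have "\<dots> \<approx>\<^bsub>C\<^esub> Ident (a @ w @ b)"
    using assms by (intro meq_tens_ident) simp_all
  finally show ?thesis .
qed

lemma wh_left:
  assumes "a \<in> words Q" "b \<in> words Q" "c \<in> words Q" "mor_in Q \<tau> KLRW f"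
  shows "wh a (Ident c \<otimes> f) b \<approx>\<^bsub>C\<^esub> wh (a @ c) f b"
proof -
  have "wh a (Ident c \<otimes> f) b \<approx>\<^bsub>C\<^esub> Ident a \<otimes> Ident c \<otimes> (f \<otimes> Ident b)"
    unfolding wh_def using assms by (intro meq_tens_cong meq_refl meq_tens_assoc) simp_all
  also have "\<dots> \<approx>\<^bsub>C\<^esub> wh (a @ c) f b"
    unfolding wh_def using assms by (intro Ident_tens_Ident_tens) simp_all
  finally show ?thesis .
qed

lemma wh_right:
  assumes "a \<in> words Q" "b \<in> words Q" "c \<in> words Q" "mor_in Q \<tau> KLRW f"
  shows "wh a (f \<otimes> Ident c) b \<approx>\<^bsub>C\<^esub> wh a f (c @ b)"
  unfolding wh_def using assms by (intro meq_tens_cong meq_refl tens_Ident_tens_Ident) simp_all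

lemma wh_Nil:
  assumes "mor_in Q \<tau> KLRW f" "b \<in> words Q"
  shows "wh [] f b \<approx>\<^bsub>C\<^esub> f \<otimes> Ident b"
  unfolding wh_def using assms mor_in_KLRW by (intro meq_tens_unit_left) simp

lemma wh_add:
  assumes "mor_in Q \<tau> KLRW (f \<oplus> g)" "a \<in> words Q" "b \<in> words Q"
  shows "wh a (f \<oplus> g) b \<approx>\<^bsub>C\<^esub> wh a f b \<oplus> wh a g b"
proof -
  have "wh a (f \<oplus> g) b \<approx>\<^bsub>C\<^esub> Ident a \<otimes> (f \<otimes> Ident b \<oplus> g \<otimes> Ident b)"
    unfolding wh_def using assms by (intro meq_tens_cong meq_refl meq_tens_add_left) simp_all
  also have "\<dots> \<approx>\<^bsub>C\<^esub> wh a f b \<oplus> wh a g b"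
    unfolding wh_def using assms by (intro meq_tens_add_right) simp_all
  finally show ?thesis .
qed

lemma wh_scale:
  assumes "mor_in Q \<tau> KLRW f" "a \<in> words Q" "b \<in> words Q"
  shows "wh a (c \<odot> f) b \<approx>\<^bsub>C\<^esub> c \<odot> wh a f b"
proof -
  have "wh a (c \<odot> f) b \<approx>\<^bsub>C\<^esub> Ident a \<otimes> (c \<odot> (f \<otimes> Ident b))"
    unfolding wh_def using assms by (intro meq_tens_cong meq_refl meq_tens_scale_left) simp_all
  also have "\<dots> \<approx>\<^bsub>C\<^esub> c \<odot> wh a f b"
    unfolding wh_def using assms by (intro meq_tens_scale_right) simp_all
  finally show ?thesis .
qed

lemma wh_Zero:
  assumes "v \<in> words Q" "w \<in> words Q" "a \<in> words Q" "b \<in> words Q"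
  shows "wh a (Zero v w) b \<approx>\<^bsub>C\<^esub> Zero (a @ v @ b) (a @ w @ b)"
proof -
  have "wh a (Zero v w) b \<approx>\<^bsub>C\<^esub> Ident a \<otimes> Zero (v @ b) (w @ b)"
    unfolding wh_def using assms Zero_tens[of "Ident b" v w] by (intro meq_tens_cong meq_refl) simp_all
  also have "\<dots> \<approx>\<^bsub>C\<^esub> Zero (a @ v @ b) (a @ w @ b)"
    using assms tens_Zero[of C "Ident a" "v @ b" "w @ b"] by simp
  finally show ?thesis .
qed

text \<open>Height exchange of two slices separated by the strands \<open>b\<close>: both composites
  are rewritten as whiskerings, with the same outer strands, of the two sides of one interchange
  law.\<close>

lemma wh_exchange:
  assumes "mor_in Q \<tau> KLRW f" "mor_in Q \<tau> KLRW g" "a \<in> words Q" "b \<in> words Q" "c \<in> words Q"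
  shows "wh a f (b @ tgt \<tau> g @ c) \<cdot> wh (a @ src f @ b) g c \<approx>\<^bsub>C\<^esub>
    wh (a @ tgt \<tau> f @ b) g c \<cdot> wh a f (b @ src g @ c)"
proof -
  note w = mor_in_words[OF assms(1)] mor_in_words[OF assms(2)]
  let ?h = "Ident b \<otimes> g"
  have 1: "wh a (f \<otimes> Ident (b @ v)) c \<approx>\<^bsub>C\<^esub> wh a f (b @ v @ c)" if "v \<in> words Q" for v
    using wh_right[of a c "b @ v" f] assms that by simp
  have 2: "wh a (Ident v \<otimes> ?h) c \<approx>\<^bsub>C\<^esub> wh (a @ v @ b) g c" if "v \<in> words Q" for v
  proof -
    have "wh a (Ident v \<otimes> ?h) c \<approx>\<^bsub>C\<^esub> wh a (Ident (v @ b) \<otimes> g) c"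
      using assms that by (intro wh_cong Ident_tens_Ident_tens) simp_all
    also have "\<dots> \<approx>\<^bsub>C\<^esub> wh (a @ v @ b) g c"
      using wh_left[of a c "v @ b" g] assms that by simp
    finally show ?thesis .
  qed
  have "wh a f (b @ tgt \<tau> g @ c) \<cdot> wh (a @ src f @ b) g c \<approx>\<^bsub>C\<^esub>
      wh a (f \<otimes> Ident (tgt \<tau> ?h)) c \<cdot> wh a (Ident (src f) \<otimes> ?h) c"
    using assms w 1 2 by (intro eqv_comp meq_sym[OF 1] meq_sym[OF 2]) (simp_all add: meq_sym)
  also have "\<dots> \<approx>\<^bsub>C\<^esub> wh a ((f \<otimes> Ident (tgt \<tau> ?h)) \<cdot> (Ident (src f) \<otimes> ?h)) c"
    using assms w by (intro meq_sym[OF wh_comp]) simp_all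
  also have "\<dots> \<approx>\<^bsub>C\<^esub> wh a ((Ident (tgt \<tau> f) \<otimes> ?h) \<cdot> (f \<otimes> Ident (src ?h))) c"
    using assms by (intro wh_cong tens_exchange) simp_all
  also have "\<dots> \<approx>\<^bsub>C\<^esub> wh a (Ident (tgt \<tau> f) \<otimes> ?h) c \<cdot> wh a (f \<otimes> Ident (src ?h)) c"
    using assms w by (intro wh_comp) simp_all
  also have "\<dots> \<approx>\<^bsub>C\<^esub> wh (a @ tgt \<tau> f @ b) g c \<cdot> wh a f (b @ src g @ c)"
    using assms w 1 2 by (intro eqv_comp) simp_all
  finally show ?thesis .
qed

text \<open>The exchange at the left edge of the diagram. Here \<open>f\<close> may contain a
  \<rho>, so it carries no strands on its left.\<close>

lemma tens_wh_exchange: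
  assumes "mor_in Q \<tau> C f" "mor_in Q \<tau> KLRW g" "b \<in> words Q" "c \<in> words Q"
  shows "(f \<otimes> Ident (b @ tgt \<tau> g @ c)) \<cdot> wh (src f @ b) g c \<approx>\<^bsub>C\<^esub>
    wh (tgt \<tau> f @ b) g c \<cdot> (f \<otimes> Ident (b @ src g @ c))"
proof -
  note w = mor_in_words[OF assms(1)] mor_in_words[OF assms(2)]
  have 1: "Ident v \<otimes> wh b g c \<approx>\<^bsub>C\<^esub> wh (v @ b) g c" if "v \<in> words Q" for v
    unfolding wh_def using assms that by (intro Ident_tens_Ident_tens) simp_all
  have "(f \<otimes> Ident (b @ tgt \<tau> g @ c)) \<cdot> wh (src f @ b) g c \<approx>\<^bsub>C\<^esub>
      (f \<otimes> Ident (tgt \<tau> (wh b g c))) \<cdot> (Ident (src f) \<otimes> wh b g c)"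
    using assms w by (intro eqv_comp meq_sym[OF 1]) (simp_all add: meq_refl)
  also have "\<dots> \<approx>\<^bsub>C\<^esub> (Ident (tgt \<tau> f) \<otimes> wh b g c) \<cdot> (f \<otimes> Ident (src (wh b g c)))"
    using assms by (intro tens_exchange) simp_all
  also have "\<dots> \<approx>\<^bsub>C\<^esub> wh (tgt \<tau> f @ b) g c \<cdot> (f \<otimes> Ident (b @ src g @ c))"
    using assms w by (intro eqv_comp 1) (simp_all add: meq_refl)
  finally show ?thesis .
qed

end

section \<open>Diagrams of words\<close>

text \<open>A syntactic upper bound for the filtration degree. Dots count as 0, so that the
  corrections in the relations, which trade crossings for dots, have smaller degree; a \<rho> counts
  like a crossing.\<close>

primrec ncross :: "('i, 'k) mor \<Rightarrow> nat" where
  "ncross (Ident w) = 0"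
| "ncross (Dot i) = 0"
| "ncross (CrossBB i j) = 1"
| "ncross (CrossBR i \<theta>) = 1"
| "ncross (CrossRB \<theta> i) = 1"
| "ncross (Rho i) = 1"
| "ncross (g \<cdot> f) = ncross g + ncross f"
| "ncross (f \<otimes> g) = ncross f + ncross g"
| "ncross (Zero v w) = 0"
| "ncross (f \<oplus> g) = max (ncross f) (ncross g)"
| "ncross (c \<odot> f) = ncross f"

lemma ncross_dotpow [simp]: "ncross (dotpow i a) = 0"
  by (induction a) auto

lemma ncross_dotmonom [simp]: "ncross (dotmonom r w m) = 0"
  by (induction w arbitrary: r) (auto split: letter.split)

lemma ncross_dots [simp]: "ncross (dots w p :: ('i, 'k::field) mor) = 0"
proof -
  have "ncross (foldr (\<lambda>m f. Poly_Mapping.lookup p m \<odot> dotmonom 1 w m \<oplus> f) ms (Zero w w) :: ('i, 'k) mor) = 0" for ms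
    by (induction ms) simp_all
  then show ?thesis by (simp add: dots_def)
qed

text \<open>Two red letters do not cross and \<open>\<rho>\<close> and dots do not act on red letters; with the value \<open>Zero\<close> there,
  every word in the generators has a diagram on every word of letters.\<close>

fun cross :: "'i letter \<Rightarrow> 'i letter \<Rightarrow> ('i, 'k) mor" where
  "cross (Black i) (Black j) = CrossBB i j"
| "cross (Black i) (Red \<theta>) = CrossBR i \<theta>"
| "cross (Red \<theta>) (Black i) = CrossRB \<theta> i"
| "cross (Red \<theta>) (Red \<eta>) = Zero [Red \<theta>, Red \<eta>] [Red \<eta>, Red \<theta>]"

fun ldot :: "'i letter \<Rightarrow> ('i, 'k) mor" where
  "ldot (Black i) = Dot i"
| "ldot (Red \<theta>) = Zero [Red \<theta>] [Red \<theta>]"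

fun lrho :: "'i letter \<Rightarrow> ('i, 'k) mor" where
  "lrho (Black i) = Rho i"
| "lrho (Red \<theta>) = Zero [Red \<theta>] [Red \<theta>]"

lemma split_at:
  assumes "p < length X"
  obtains a l b where "X = a @ l # b" "p = length a"
  using assms id_take_nth_drop[of p X] by (metis length_take min.absorb4)

lemma split_at2:
  assumes "Suc k < length X"
  obtains a l l' b where "X = a @ l # l' # b" "k = length a"
proof -
  obtain a l b where ab: "X = a @ l # b" "k = length a"
    by (rule split_at[of k X]) (use assms in simp, blast)
  then obtain l' b' where "b = l' # b'" using assms by (cases b) auto
  then show ?thesis using ab that by blast
qed

context oklrw
begin

fun flip :: "'i letter \<Rightarrow> 'i letter" where
  "flip (Black i) = Black (\<tau> i)"
| "flip (Red \<theta>) = Red \<theta>"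

text \<open>List positions count from 0 and crossings from 1: \<open>Suc k\<close> exchanges the
  positions \<open>k\<close> and \<open>Suc k\<close>, and 0 is left for \<rho>, which changes the
  label of the first letter.\<close>

fun sw :: "nat \<Rightarrow> 'i word \<Rightarrow> 'i word" where
  "sw 0 X = flip (hd X) # tl X"
| "sw (Suc k) X = take k X @ X ! Suc k # X ! k # drop (Suc (Suc k)) X"

fun gen :: "nat \<Rightarrow> 'i word \<Rightarrow> ('i, 'k::field) mor" where
  "gen 0 X = lrho (hd X) \<otimes> Ident (tl X)"
| "gen (Suc k) X = wh (take k X) (cross (X ! k) (X ! Suc k)) (drop (Suc (Suc k)) X)"

definition dot :: "nat \<Rightarrow> 'i word \<Rightarrow> ('i, 'k::field) mor" where
  "dot p X = wh (take p X) (ldot (X ! p)) (drop (Suc p) X)"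

text \<open>In a list of generators the head is applied last.\<close>

abbreviation sws :: "nat list \<Rightarrow> 'i word \<Rightarrow> 'i word" where
  "sws w X \<equiv> foldr sw w X"

primrec path :: "nat list \<Rightarrow> 'i word \<Rightarrow> ('i, 'k::field) mor" where
  "path [] X = Ident X"
| "path (m # w) X = gen m (sws w X) \<cdot> path w X"

definition letter_ok :: "'i letter \<Rightarrow> bool" where
  "letter_ok l \<longleftrightarrow> [l] \<in> words Q"

lemma letter_ok_simps [simp]:
  "letter_ok (Black i) \<longleftrightarrow> i \<in> verts Q" "letter_ok (Red \<theta>) \<longleftrightarrow> \<theta> \<in> dominant_weights Q"
  by (simp_all add: letter_ok_def)

lemma words_Cons [simp]: "l # w \<in> words Q \<longleftrightarrow> letter_ok l \<and> w \<in> words Q"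
  by (cases l) auto

lemma letter_ok_nth: "X \<in> words Q \<Longrightarrow> t < length X \<Longrightarrow> letter_ok (X ! t)"
proof -
  assume X: "X \<in> words Q" and t: "t < length X"
  have "take t X @ X ! t # drop (Suc t) X \<in> words Q"
    unfolding id_take_nth_drop[OF t, symmetric] by (rule X)
  then show ?thesis by simp
qed

lemma letter_ok_flip [simp]: "letter_ok l \<Longrightarrow> letter_ok (flip l)"
  by (cases l) (auto simp: tau_verts)

lemma flip_flip [simp]: "letter_ok l \<Longrightarrow> flip (flip l) = l"
  by (cases l) (auto simp: tau_invol)

lemma cross_typing [simp]:
  "src (cross l l') = [l, l']" "tgt \<tau> (cross l l') = [l', l]"
  "letter_ok l \<Longrightarrow> letter_ok l' \<Longrightarrow> mor_in Q \<tau> C (cross l l')"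
  by (cases l; cases l'; simp)+

lemma ldot_typing [simp]:
  "src (ldot l) = [l]" "tgt \<tau> (ldot l) = [l]" "letter_ok l \<Longrightarrow> mor_in Q \<tau> C (ldot l)"
  by (cases l; simp)+

lemma lrho_typing [simp]:
  "src (lrho l) = [l]" "tgt \<tau> (lrho l) = [flip l]" "letter_ok l \<Longrightarrow> mor_in Q \<tau> oKLRW (lrho l)"
  by (cases l; simp)+

lemma sw_append [simp]: "sw (Suc (length a)) (a @ l # l' # b) = a @ l' # l # b"
  by (simp add: nth_append)

lemma gen_append: "gen (Suc (length a)) (a @ l # l' # b) = wh a (cross l l') b"
  by (simp add: nth_append)

lemma dot_append: "dot (length a) (a @ l # b) = wh a (ldot l) b"
  by (simp add: dot_def nth_append)

lemma length_sw [simp]: "m < length X \<Longrightarrow> length (sw m X) = length X"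
  by (cases m) (auto simp: min_def)

lemma sw_words: "m < length X \<Longrightarrow> X \<in> words Q \<Longrightarrow> sw m X \<in> words Q"
proof (cases m)
  case 0
  moreover assume "m < length X" "X \<in> words Q"
  ultimately show ?thesis by (cases X) auto
next
  case (Suc k)
  assume m: "m < length X" and X: "X \<in> words Q"
  obtain a l l' b where eq: "X = a @ l # l' # b" "k = length a"
    by (rule split_at2[of k X]) (use m Suc in simp, blast)
  show ?thesis using X unfolding Suc eq sw_append by simp
qed

lemma sw_sw: "m < length X \<Longrightarrow> X \<in> words Q \<Longrightarrow> sw m (sw m X) = X"
proof (cases m)
  case 0
  moreover assume "m < length X" "X \<in> words Q"
  ultimately show ?thesis by (cases X) auto
next
  case (Suc k)
  assume m: "m < length X" and X: "X \<in> words Q"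
  obtain a l l' b where eq: "X = a @ l # l' # b" "k = length a"
    by (rule split_at2[of k X]) (use m Suc in simp, blast)
  show ?thesis unfolding Suc eq sw_append ..
qed

lemma gen_typing [simp]:
  assumes "m < length X" "X \<in> words Q"
  shows "src (gen m X) = X" "tgt \<tau> (gen m X) = sw m X" "mor_in Q \<tau> oKLRW (gen m X)"
proof -
  have "src (gen m X) = X \<and> tgt \<tau> (gen m X) = sw m X \<and> mor_in Q \<tau> oKLRW (gen m X)"
  proof (cases m)
    case 0
    then show ?thesis using assms by (cases X) auto
  next
    case (Suc k)
    obtain a l l' b where X: "X = a @ l # l' # b" "k = length a"
      by (rule split_at2[of k X]) (use assms Suc in simp, blast)
    show ?thesis using assms unfolding Suc X by (simp only: gen_append sw_append)
      (auto)
  qed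
  then show "src (gen m X) = X" "tgt \<tau> (gen m X) = sw m X" "mor_in Q \<tau> oKLRW (gen m X)" by auto
qed

lemma dot_typing [simp]:
  assumes "p < length X" "X \<in> words Q"
  shows "src (dot p X) = X" "tgt \<tau> (dot p X) = X" "mor_in Q \<tau> C (dot p X)"
proof -
  obtain a l b where X: "X = a @ l # b" "p = length a"
    by (rule split_at[of p X]) (use assms in simp, blast)
  show "src (dot p X) = X" "tgt \<tau> (dot p X) = X" "mor_in Q \<tau> C (dot p X)"
    using assms unfolding X by (auto simp: dot_append)
qed

lemma sws_typing [simp]:
  assumes "set w \<subseteq> {..<length X}"
  shows "length (sws w X) = length X" "X \<in> words Q \<Longrightarrow> sws w X \<in> words Q"
proof -
  have "length (sws w X) = length X \<and> (X \<in> words Q \<longrightarrow> sws w X \<in> words Q)"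
    using assms by (induction w) (auto simp: sw_words)
  then show "length (sws w X) = length X" "X \<in> words Q \<Longrightarrow> sws w X \<in> words Q" by auto
qed

lemma path_typing [simp]:
  assumes "set w \<subseteq> {..<length X}" "X \<in> words Q"
  shows "src (path w X) = X" "tgt \<tau> (path w X) = sws w X" "mor_in Q \<tau> oKLRW (path w X)"
proof -
  have "src p = X \<and> tgt \<tau> p = sws w X \<and> mor_in Q \<tau> oKLRW p"
    if "p = path w X" for p :: "('i, 'k::field) mor"
    using assms that
  proof (induction w arbitrary: p)
    case (Cons m w)
    then show ?case using Cons.IH[of "path w X"] by auto
  qed simp
  then show "src (path w X) = X" "tgt \<tau> (path w X) = sws w X" "mor_in Q \<tau> oKLRW (path w X)" by auto
qed

text \<open>The relations are homogeneous only up to terms with fewer crossings and \<open>\<rho>\<close>s.\<close>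

inductive filt :: "nat \<Rightarrow> ('i, 'k::field) mor \<Rightarrow> bool" where
  filt_Zero: "v \<in> words Q \<Longrightarrow> w \<in> words Q \<Longrightarrow> filt n (Zero v w)"
| filt_Ident: "w \<in> words Q \<Longrightarrow> filt n (Ident w)"
| filt_gen: "filt n f \<Longrightarrow> m < length (tgt \<tau> f) \<Longrightarrow> filt (Suc n) (gen m (tgt \<tau> f) \<cdot> f)"
| filt_dot: "filt n f \<Longrightarrow> p < length (tgt \<tau> f) \<Longrightarrow> filt n (dot p (tgt \<tau> f) \<cdot> f)"
| filt_add: "filt n f \<Longrightarrow> filt n g \<Longrightarrow> src f = src g \<Longrightarrow> tgt \<tau> f = tgt \<tau> g \<Longrightarrow> filt n (f \<oplus> g)"
| filt_scale: "filt n f \<Longrightarrow> filt n (c \<odot> f)"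
| filt_eqv: "filt n f \<Longrightarrow> f \<approx> g \<Longrightarrow> filt n g"

section \<open>The filtration by the number of crossings\<close>

lemma filt_mor_in: "filt n f \<Longrightarrow> mor_in Q \<tau> oKLRW f"
proof (induction rule: filt.induct)
  case (filt_gen n f m)
  then show ?case using mor_in_words[OF filt_gen.IH] by auto
next
  case (filt_dot n f p)
  then show ?case using mor_in_words[OF filt_dot.IH] by auto
next
  case (filt_eqv n f g)
  then show ?case using mor_eq_typing by blast
qed auto

lemma filt_mono: "filt n f \<Longrightarrow> n \<le> n' \<Longrightarrow> filt n' f"
proof (induction arbitrary: n' rule: filt.induct)
  case (filt_gen n f m)
  then obtain k where "n' = Suc k" "n \<le> k" by (cases n') auto
  then show ?case using filt_gen by (auto intro: filt.filt_gen)
next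
  case (filt_eqv n f g)
  then show ?case by (blast intro: filt.filt_eqv)
qed (auto intro: filt.intros(1,2,4,5,6))

lemma filt_eqv': "filt n g \<Longrightarrow> f \<approx> g \<Longrightarrow> filt n f"
  by (blast intro: filt.filt_eqv meq_sym)

text \<open>Induction on the upper factor \<open>g\<close>, since \<open>filt\<close> builds a
  diagram by adding slices on top; associativity moves \<open>f\<close> below all of them.\<close>

lemma filt_comp: "filt n g \<Longrightarrow> filt n' f \<Longrightarrow> src g = tgt \<tau> f \<Longrightarrow> filt (n + n') (g \<cdot> f)"
proof (induction arbitrary: rule: filt.induct)
  case (filt_Zero v w n)
  have "filt (n + n') (Zero (src f) w)"
    using filt_Zero mor_in_words[OF filt_mor_in[of n' f]] by (auto intro: filt.filt_Zero)
  moreover have "Zero v w \<cdot> f \<approx> Zero (src f) w"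
    using Zero_comp[of oKLRW f w] filt_Zero filt_mor_in[of n' f] by simp
  ultimately show ?case by (rule filt_eqv')
next
  case (filt_Ident w n)
  have "Ident w \<cdot> f \<approx> f"
    using meq_comp_id_left[of Q \<tau> oKLRW f] filt_Ident filt_mor_in[of n' f] by simp
  moreover have "filt (n + n') f" using filt_Ident by (auto intro: filt_mono)
  ultimately show ?case by (metis filt_eqv')
next
  case (filt_gen n g m)
  have g: "mor_in Q \<tau> oKLRW g" "mor_in Q \<tau> oKLRW f" using filt_gen.hyps filt_gen.prems filt_mor_in by blast+
  have "filt (Suc n + n') (gen m (tgt \<tau> g) \<cdot> g \<cdot> f)"
    using filt_gen filt.filt_gen[of "n + n'" "g \<cdot> f" m] by simp
  moreover have "(gen m (tgt \<tau> g) \<cdot> g) \<cdot> f \<approx> gen m (tgt \<tau> g) \<cdot> g \<cdot> f"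
    using filt_gen g mor_in_words[OF g(1)] by (intro meq_comp_assoc) auto
  ultimately show ?case by (rule filt_eqv')
next
  case (filt_dot n g p)
  have g: "mor_in Q \<tau> oKLRW g" "mor_in Q \<tau> oKLRW f" using filt_dot.hyps filt_dot.prems filt_mor_in by blast+
  have "filt (n + n') (dot p (tgt \<tau> g) \<cdot> g \<cdot> f)"
    using filt_dot filt.filt_dot[of "n + n'" "g \<cdot> f" p] by simp
  moreover have "(dot p (tgt \<tau> g) \<cdot> g) \<cdot> f \<approx> dot p (tgt \<tau> g) \<cdot> g \<cdot> f"
    using filt_dot g mor_in_words[OF g(1)] by (intro meq_comp_assoc) auto
  ultimately show ?case by (rule filt_eqv')
next
  case (filt_add n g g')
  have g: "mor_in Q \<tau> oKLRW g" "mor_in Q \<tau> oKLRW g'" "mor_in Q \<tau> oKLRW f"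
    using filt_add.hyps filt_add.prems filt_mor_in by blast+
  have "filt (n + n') (g \<cdot> f \<oplus> g' \<cdot> f)"
    using filt_add by (intro filt.filt_add) auto
  moreover have "(g \<oplus> g') \<cdot> f \<approx> g \<cdot> f \<oplus> g' \<cdot> f"
    using filt_add g by (intro meq_comp_add_left) auto
  ultimately show ?case by (rule filt_eqv')
next
  case (filt_scale n g c)
  have g: "mor_in Q \<tau> oKLRW g" "mor_in Q \<tau> oKLRW f" using filt_scale.hyps filt_scale.prems filt_mor_in by blast+
  have "filt (n + n') (c \<odot> (g \<cdot> f))" using filt_scale by (intro filt.filt_scale) auto
  moreover have "(c \<odot> g) \<cdot> f \<approx> c \<odot> (g \<cdot> f)"
    using filt_scale g by (intro meq_comp_scale_left) auto
  ultimately show ?case by (rule filt_eqv')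
next
  case (filt_eqv n g g')
  have "mor_in Q \<tau> oKLRW f" using filt_eqv.prems filt_mor_in by blast
  moreover have "src g = tgt \<tau> f" using filt_eqv mor_eq_typing by metis
  ultimately show ?case using filt_eqv by (blast intro: filt.filt_eqv eqv_comp_left)
qed

lemma filt_gen_single: "m < length X \<Longrightarrow> X \<in> words Q \<Longrightarrow> filt (Suc 0) (gen m X)"
  using filt.filt_gen[OF filt_Ident, of X m 0] meq_comp_id_right[of Q \<tau> oKLRW "gen m X"]
  by (auto intro: filt_eqv)

lemma filt_dot_single: "p < length X \<Longrightarrow> X \<in> words Q \<Longrightarrow> filt 0 (dot p X)"
  using filt.filt_dot[OF filt_Ident, of X p 0] meq_comp_id_right[of Q \<tau> oKLRW "dot p X"]
  by (auto intro: filt_eqv)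

lemma filt_wh_cross:
  assumes "a @ l # l' # b \<in> words Q"
  shows "filt (Suc 0) (wh a (cross l l') b)"
  using filt_gen_single[of "Suc (length a)" "a @ l # l' # b"] assms by (simp add: gen_append del: gen.simps)

text \<open>A diagram is cut into slices: a tensor product is the composite of its two whiskered
  factors at different heights, and their crossing numbers add up.\<close>

lemma filt_wh:
  "mor_in Q \<tau> KLRW f \<Longrightarrow> a \<in> words Q \<Longrightarrow> b \<in> words Q \<Longrightarrow> filt (ncross f) (wh a f b)"
proof (induction f arbitrary: a b)
  case (Ident w)
  then show ?case by (auto intro!: filt_eqv[OF filt_Ident meq_sym[OF wh_Ident]])
next
  case (Dot i)
  then show ?case using filt_dot_single[of "length a" "a @ Black i # b"] by (simp add: dot_append)
next
  case (CrossBB i j)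
  then show ?case using filt_wh_cross[of a "Black i" "Black j" b] by simp
next
  case (CrossBR i \<theta>)
  then show ?case using filt_wh_cross[of a "Black i" "Red \<theta>" b] by simp
next
  case (CrossRB \<theta> i)
  then show ?case using filt_wh_cross[of a "Red \<theta>" "Black i" b] by simp
next
  case (Comp g f)
  then have "filt (ncross g + ncross f) (wh a g b \<cdot> wh a f b)" by (intro filt_comp) auto
  then show ?case unfolding ncross.simps
    by (rule filt_eqv) (use Comp.prems in \<open>auto intro!: meq_sym[OF wh_comp]\<close>)
next
  case (Tens f g)
  have w: "src f \<in> words Q" "tgt \<tau> g \<in> words Q" using Tens.prems mor_in_words by auto
  have "wh a (f \<otimes> g) b \<approx> wh a ((f \<otimes> Ident (tgt \<tau> g)) \<cdot> (Ident (src f) \<otimes> g)) b"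
    using Tens.prems by (intro wh_cong tens_expand) auto
  also have "\<dots> \<approx> wh a (f \<otimes> Ident (tgt \<tau> g)) b \<cdot> wh a (Ident (src f) \<otimes> g) b"
    using Tens.prems w by (intro wh_comp) auto
  also have "\<dots> \<approx> wh a f (tgt \<tau> g @ b) \<cdot> wh (a @ src f) g b"
    using Tens.prems w by (intro eqv_comp wh_left wh_right) auto
  finally have "wh a f (tgt \<tau> g @ b) \<cdot> wh (a @ src f) g b \<approx> wh a (f \<otimes> g) b" by (rule meq_sym)
  moreover have "filt (ncross f + ncross g) (wh a f (tgt \<tau> g @ b) \<cdot> wh (a @ src f) g b)"
    using Tens w by (intro filt_comp) auto
  ultimately show ?case unfolding ncross.simps by (rule filt.filt_eqv[rotated])
next
  case (Zero v w)
  then show ?case by (auto intro!: filt_eqv[OF filt_Zero meq_sym[OF wh_Zero]])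
next
  case (Add f g)
  have "filt (max (ncross f) (ncross g)) (wh a f b)" "filt (max (ncross f) (ncross g)) (wh a g b)"
    using Add by (auto intro: filt_mono[OF _ max.cobounded1] filt_mono[OF _ max.cobounded2])
  then have "filt (max (ncross f) (ncross g)) (wh a f b \<oplus> wh a g b)"
    using Add.prems by (intro filt_add) auto
  then show ?case unfolding ncross.simps
    by (rule filt_eqv) (use Add.prems in \<open>auto intro!: meq_sym[OF wh_add]\<close>)
next
  case (Scale c f)
  then have "filt (ncross f) (c \<odot> wh a f b)" by (intro filt_scale) auto
  then show ?case unfolding ncross.simps
    by (rule filt_eqv) (use Scale.prems in \<open>auto intro!: meq_sym[OF wh_scale]\<close>)
qed simp

text \<open>At the left edge only the right factor of a tensor product is whiskered; the left
  factor, which may contain a \<rho>, stands again at the edge and is covered by the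
  induction.\<close>

lemma filt_tens_Ident:
  "mor_in Q \<tau> oKLRW f \<Longrightarrow> b \<in> words Q \<Longrightarrow> filt (ncross f) (f \<otimes> Ident b)"
proof (induction f arbitrary: b)
  case (Rho i)
  then show ?case using filt_gen_single[of 0 "Black i # b"] by simp
next
  case (Comp g f)
  then have "filt (ncross g + ncross f) ((g \<otimes> Ident b) \<cdot> (f \<otimes> Ident b))" by (intro filt_comp) auto
  then show ?case unfolding ncross.simps
    by (rule filt_eqv) (use Comp.prems in \<open>auto intro!: meq_sym[OF comp_tens_Ident]\<close>)
next
  case (Tens f g)
  have w: "src f \<in> words Q" "tgt \<tau> g \<in> words Q" using Tens.prems mor_in_words by auto
  have "(f \<otimes> g) \<otimes> Ident b \<approx> f \<otimes> g \<otimes> Ident b"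
    using Tens.prems by (intro meq_tens_assoc) auto
  also have "\<dots> \<approx> (f \<otimes> Ident (tgt \<tau> g @ b)) \<cdot> wh (src f) g b"
    using Tens.prems tens_expand(1)[of oKLRW f "g \<otimes> Ident b"] by (simp add: wh_def)
  finally have "(f \<otimes> Ident (tgt \<tau> g @ b)) \<cdot> wh (src f) g b \<approx> (f \<otimes> g) \<otimes> Ident b" by (rule meq_sym)
  moreover have "filt (ncross f + ncross g) ((f \<otimes> Ident (tgt \<tau> g @ b)) \<cdot> wh (src f) g b)"
    using Tens w by (intro filt_comp filt_wh) auto
  ultimately show ?case unfolding ncross.simps by (rule filt.filt_eqv[rotated])
next
  case (Zero v w)
  have "Zero (v @ b) (w @ b) \<approx> (Zero v w \<otimes> Ident b :: ('i, 'b) mor)"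
    using meq_sym[OF Zero_tens[of "Ident b" v w oKLRW]] Zero by simp
  from filt.filt_eqv[OF filt_Zero this] show ?case using Zero by simp
next
  case (Add f g)
  have "filt (max (ncross f) (ncross g)) (f \<otimes> Ident b)" "filt (max (ncross f) (ncross g)) (g \<otimes> Ident b)"
    using Add by (auto intro: filt_mono[OF _ max.cobounded1] filt_mono[OF _ max.cobounded2])
  then have "filt (max (ncross f) (ncross g)) (f \<otimes> Ident b \<oplus> g \<otimes> Ident b)"
    using Add.prems by (intro filt_add) auto
  then show ?case unfolding ncross.simps
    by (rule filt_eqv) (use Add.prems in \<open>auto intro!: meq_sym[OF meq_tens_add_left]\<close>)
next
  case (Scale c f)
  then have "filt (ncross f) (c \<odot> (f \<otimes> Ident b))" by (intro filt_scale) auto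
  then show ?case unfolding ncross.simps
    by (rule filt_eqv) (use Scale.prems in \<open>auto intro!: meq_sym[OF meq_tens_scale_left]\<close>)
qed (rule filt_eqv[OF filt_wh wh_Nil]; simp)+

text \<open>Entry point of the spanning argument: tensoring with the identity of the empty word puts
  an arbitrary morphism in the position of \<open>filt_tens_Ident\<close>.\<close>

lemma filt_ncross: "mor_in Q \<tau> oKLRW f \<Longrightarrow> filt (ncross f) f"
  by (rule filt_eqv[OF filt_tens_Ident meq_tens_unit_right[of Q \<tau> oKLRW f]]) auto

text \<open>Equality in the associated graded space, when \<open>n\<close> is one less than the
  number of generators of the diagrams compared. The term \<open>h\<close> collects all corrections
  without naming them.\<close>

definition cong :: "nat \<Rightarrow> ('i, 'k::field) mor \<Rightarrow> ('i, 'k) mor \<Rightarrow> bool" where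
  "cong n f g \<longleftrightarrow> (\<exists>h. filt n h \<and> f \<approx> g \<oplus> h)"

lemma cong_eqv: "f \<approx> g \<Longrightarrow> cong n f g"
proof -
  assume fg: "f \<approx> g"
  then have g: "mor_in Q \<tau> oKLRW g" using mor_eq_typing by blast
  have "f \<approx> g \<oplus> Zero (src g) (tgt \<tau> g)" using fg meq_sym[OF meq_add_zero[OF g]] by (rule meq_trans)
  then show ?thesis unfolding cong_def using mor_in_words[OF g] filt_Zero by blast
qed

lemma cong_sym:
  assumes "cong n f g" shows "cong n g f"
proof -
  obtain h where h: "filt n h" "f \<approx> g \<oplus> h" using assms unfolding cong_def by blast
  have t: "mor_in Q \<tau> oKLRW f" "mor_in Q \<tau> oKLRW g" "mor_in Q \<tau> oKLRW h" "src f = src g" "tgt \<tau> f = tgt \<tau> g"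
    "src h = src g" "tgt \<tau> h = tgt \<tau> g" using mor_eq_typing[OF h(2)] by auto
  have "f \<ominus> h \<approx> g \<oplus> h \<ominus> h" using t h by (intro meq_add_cong meq_refl) auto
  also have "\<dots> \<approx> g \<oplus> (h \<ominus> h)" using t by (intro meq_add_assoc) auto
  also have "\<dots> \<approx> g" using t meq_add_minus[OF t(3)] by (intro add_zero_right) auto
  finally show ?thesis unfolding cong_def using h filt_scale meq_sym by blast
qed

lemma cong_trans [trans]:
  assumes "cong n f g" "cong n g k" shows "cong n f k"
proof -
  obtain h h' where h: "filt n h" "f \<approx> g \<oplus> h" "filt n h'" "g \<approx> k \<oplus> h'" using assms unfolding cong_def by blast
  have t: "mor_in Q \<tau> oKLRW g" "mor_in Q \<tau> oKLRW k" "mor_in Q \<tau> oKLRW h" "mor_in Q \<tau> oKLRW h'"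
    "src g = src k" "tgt \<tau> g = tgt \<tau> k" "src h = src k" "tgt \<tau> h = tgt \<tau> k" "src h' = src k" "tgt \<tau> h' = tgt \<tau> k"
    using mor_eq_typing[OF h(2)] mor_eq_typing[OF h(4)] by auto
  have "f \<approx> g \<oplus> h" by fact
  also have "\<dots> \<approx> k \<oplus> h' \<oplus> h" using t h by (intro meq_add_cong meq_refl) auto
  also have "\<dots> \<approx> k \<oplus> (h' \<oplus> h)" using t by (intro meq_add_assoc) auto
  finally show ?thesis unfolding cong_def using h t filt_add by fastforce
qed

lemma cong_mono: "cong n f g \<Longrightarrow> n \<le> n' \<Longrightarrow> cong n' f g"
  unfolding cong_def using filt_mono by blast

lemma cong_filt: "cong n f g \<Longrightarrow> filt n g \<Longrightarrow> filt n f"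
proof -
  assume fg: "cong n f g" and g: "filt n g"
  obtain h where h: "filt n h" "f \<approx> g \<oplus> h" using fg unfolding cong_def by blast
  have "filt n (g \<oplus> h)" using g h mor_eq_typing[OF h(2)] by (intro filt_add) auto
  then show ?thesis using h meq_sym filt_eqv by blast
qed

lemma cong_comp_left:
  assumes "cong n f g" "filt k a" "src a = tgt \<tau> f" shows "cong (k + n) (a \<cdot> f) (a \<cdot> g)"
proof -
  obtain h where h: "filt n h" "f \<approx> g \<oplus> h" using assms unfolding cong_def by blast
  have t: "mor_in Q \<tau> oKLRW f" "mor_in Q \<tau> oKLRW g" "mor_in Q \<tau> oKLRW h" "src f = src g" "tgt \<tau> f = tgt \<tau> g"
    "src h = src g" "tgt \<tau> h = tgt \<tau> g" "mor_in Q \<tau> oKLRW a"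
    using mor_eq_typing[OF h(2)] filt_mor_in[OF assms(2)] by auto
  have "a \<cdot> f \<approx> a \<cdot> (g \<oplus> h)" using t h assms by (intro eqv_comp_right) auto
  also have "\<dots> \<approx> a \<cdot> g \<oplus> a \<cdot> h" using t assms by (intro meq_comp_add_right) auto
  finally show ?thesis unfolding cong_def using filt_comp[OF assms(2) h(1)] assms t by auto
qed

lemma cong_comp_right:
  assumes "cong n f g" "filt k a" "tgt \<tau> a = src f" shows "cong (n + k) (f \<cdot> a) (g \<cdot> a)"
proof -
  obtain h where h: "filt n h" "f \<approx> g \<oplus> h" using assms unfolding cong_def by blast
  have t: "mor_in Q \<tau> oKLRW f" "mor_in Q \<tau> oKLRW g" "mor_in Q \<tau> oKLRW h" "src f = src g" "tgt \<tau> f = tgt \<tau> g"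
    "src h = src g" "tgt \<tau> h = tgt \<tau> g" "mor_in Q \<tau> oKLRW a"
    using mor_eq_typing[OF h(2)] filt_mor_in[OF assms(2)] by auto
  have "f \<cdot> a \<approx> (g \<oplus> h) \<cdot> a" using t h assms by (intro eqv_comp_left) auto
  also have "\<dots> \<approx> g \<cdot> a \<oplus> h \<cdot> a" using t assms by (intro meq_comp_add_left) auto
  finally show ?thesis unfolding cong_def using filt_comp[OF h(1) assms(2)] assms t by auto
qed

section \<open>Diagrams of words in the generators\<close>

lemma path_filt:
  "set w \<subseteq> {..<length X} \<Longrightarrow> X \<in> words Q \<Longrightarrow> filt (length w) (path w X)"
proof (induction w)
  case Nil
  then show ?case by (auto intro: filt_Ident)
next
  case (Cons m w)
  then show ?case using filt_gen[of "length w" "path w X" m] by simp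
qed

lemma path_append:
  "set v \<subseteq> {..<length X} \<Longrightarrow> set w \<subseteq> {..<length X} \<Longrightarrow> X \<in> words Q \<Longrightarrow>
    path (v @ w) X \<approx> path v (sws w X) \<cdot> path w X"
proof (induction v)
  case Nil
  then show ?case using meq_sym[OF meq_comp_id_left[of Q \<tau> oKLRW "path w X"]] by simp
next
  case (Cons m v)
  let ?Z = "sws w X"
  have "gen m (sws (v @ w) X) \<cdot> path (v @ w) X \<approx> gen m (sws v ?Z) \<cdot> (path v ?Z \<cdot> path w X :: ('i, 'b) mor)"
    using Cons by (auto intro!: eqv_comp_right)
  also have "\<dots> \<approx> path (m # v) ?Z \<cdot> path w X"
    using Cons.prems by (auto intro!: meq_sym[OF meq_comp_assoc])
  finally show ?case by simp
qed


declare gen.simps(2) [simp del] sw.simps(2) [simp del]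

section \<open>Local relations up to fewer crossings\<close>

text \<open>Handles the combinations of letters for which no generator exists: a relation in which
  one occurs has zero on both sides, which \<open>null_eqv\<close> turns into an equality.\<close>

definition null :: "cat \<Rightarrow> ('i, 'k::field) mor \<Rightarrow> bool" where
  "null C f \<longleftrightarrow> f \<approx>\<^bsub>C\<^esub> Zero (src f) (tgt \<tau> f)"

lemma null_mor_in: "null C f \<Longrightarrow> mor_in Q \<tau> C f"
  unfolding null_def using mor_eq_typing by blast

lemma null_Zero: "v \<in> words Q \<Longrightarrow> w \<in> words Q \<Longrightarrow> null C (Zero v w)"
  unfolding null_def by (auto intro: meq_refl)

lemma null_comp_left:
  assumes "null C g" "mor_in Q \<tau> C f" "src g = tgt \<tau> f" shows "null C (g \<cdot> f)"
proof -
  have "g \<cdot> f \<approx>\<^bsub>C\<^esub> Zero (tgt \<tau> f) (tgt \<tau> g) \<cdot> f"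
    using assms unfolding null_def by (intro eqv_comp_left) auto
  also have "\<dots> \<approx>\<^bsub>C\<^esub> Zero (src f) (tgt \<tau> g)"
    using assms mor_in_words[OF null_mor_in[OF assms(1)]] by (intro Zero_comp) auto
  finally show ?thesis by (simp add: null_def)
qed

lemma null_comp_right:
  assumes "null C f" "mor_in Q \<tau> C g" "src g = tgt \<tau> f" shows "null C (g \<cdot> f)"
proof -
  have "g \<cdot> f \<approx>\<^bsub>C\<^esub> g \<cdot> Zero (src f) (src g)"
    using assms unfolding null_def by (intro eqv_comp_right) auto
  also have "\<dots> \<approx>\<^bsub>C\<^esub> Zero (src f) (tgt \<tau> g)"
    using assms mor_in_words[OF null_mor_in[OF assms(1)]] by (intro comp_Zero) auto
  finally show ?thesis by (simp add: null_def)
qed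

lemma null_tens_left:
  assumes "null C f" "mor_in Q \<tau> KLRW g" shows "null C (f \<otimes> g)"
proof -
  have "f \<otimes> g \<approx>\<^bsub>C\<^esub> Zero (src f) (tgt \<tau> f) \<otimes> g"
    using assms unfolding null_def by (intro meq_tens_cong meq_refl) auto
  also have "\<dots> \<approx>\<^bsub>C\<^esub> Zero (src f @ src g) (tgt \<tau> f @ tgt \<tau> g)"
    using assms mor_in_words[OF null_mor_in[OF assms(1)]] by (intro Zero_tens) auto
  finally show ?thesis by (simp add: null_def)
qed

lemma null_tens_right:
  assumes "mor_in Q \<tau> C f" "null KLRW g" shows "null C (f \<otimes> g)"
proof -
  have "f \<otimes> g \<approx>\<^bsub>C\<^esub> f \<otimes> Zero (src g) (tgt \<tau> g)"
    using assms unfolding null_def by (intro meq_tens_cong meq_refl) auto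
  also have "\<dots> \<approx>\<^bsub>C\<^esub> Zero (src f @ src g) (tgt \<tau> f @ tgt \<tau> g)"
    using assms mor_in_words[OF null_mor_in[OF assms(2)]] by (intro tens_Zero) auto
  finally show ?thesis by (simp add: null_def)
qed

lemma null_eqv:
  assumes "null C f" "null C g" "src f = src g" "tgt \<tau> f = tgt \<tau> g"
  shows "f \<approx>\<^bsub>C\<^esub> g"
proof -
  have "f \<approx>\<^bsub>C\<^esub> Zero (src g) (tgt \<tau> g)" using assms by (simp add: null_def)
  also have "\<dots> \<approx>\<^bsub>C\<^esub> g" using assms by (simp add: null_def meq_sym)
  finally show ?thesis .
qed

lemma null_wh: "null KLRW f \<Longrightarrow> a \<in> words Q \<Longrightarrow> b \<in> words Q \<Longrightarrow> null C (wh a f b)"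
  unfolding wh_def by (intro null_tens_right null_tens_left) auto

text \<open>In the braid and dot relations of \<open>KLRW\<close> the corrections have no crossings
  at all. Recorded inside \<open>KLRW\<close>, this survives whiskering and yields a congruence
  modulo \<open>filt n\<close> for every \<open>n\<close>.\<close>

definition congK :: "('i, 'k::field) mor \<Rightarrow> ('i, 'k) mor \<Rightarrow> bool" where
  "congK f g \<longleftrightarrow> (\<exists>h. ncross h = 0 \<and> f \<approx>\<^bsub>KLRW\<^esub> g \<oplus> h)"

lemma congK_eqv: "f \<approx>\<^bsub>KLRW\<^esub> g \<Longrightarrow> congK f g"
proof -
  assume fg: "f \<approx>\<^bsub>KLRW\<^esub> g"
  then have g: "mor_in Q \<tau> KLRW g" using mor_eq_typing by blast
  have "f \<approx>\<^bsub>KLRW\<^esub> g \<oplus> Zero (src g) (tgt \<tau> g)" using fg meq_sym[OF meq_add_zero[OF g]] by (rule meq_trans)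
  then show ?thesis unfolding congK_def by (intro exI[of _ "Zero (src g) (tgt \<tau> g)"]) simp
qed

lemma cong_wh:
  assumes "congK f g" "a \<in> words Q" "b \<in> words Q"
  shows "cong n (wh a f b) (wh a g b)"
proof -
  obtain h where h: "ncross h = 0" "f \<approx>\<^bsub>KLRW\<^esub> g \<oplus> h" using assms unfolding congK_def by blast
  have t: "mor_in Q \<tau> KLRW g" "mor_in Q \<tau> KLRW h" "src g = src h" "tgt \<tau> g = tgt \<tau> h"
    using mor_eq_typing[OF h(2)] by auto
  have "wh a f b \<approx> wh a (g \<oplus> h) b" using h assms by (intro wh_cong)
  also have "\<dots> \<approx> wh a g b \<oplus> wh a h b" using t assms by (intro wh_add) auto
  finally have "cong 0 (wh a f b) (wh a g b)"
    unfolding cong_def using filt_wh[of h a b] h t assms by auto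
  then show ?thesis by (rule cong_mono) simp
qed

lemma cong_tens_Ident:
  assumes "f \<approx> g \<oplus> h" "ncross h \<le> n" "b \<in> words Q"
  shows "cong n (f \<otimes> Ident b) (g \<otimes> Ident b)"
proof -
  have t: "mor_in Q \<tau> oKLRW g" "mor_in Q \<tau> oKLRW h" "src g = src h" "tgt \<tau> g = tgt \<tau> h"
    using mor_eq_typing[OF assms(1)] by auto
  have "f \<otimes> Ident b \<approx> (g \<oplus> h) \<otimes> Ident b" using assms by (intro meq_tens_cong meq_refl) auto
  also have "\<dots> \<approx> g \<otimes> Ident b \<oplus> h \<otimes> Ident b" using t assms by (intro meq_tens_add_left) auto
  finally show ?thesis
    unfolding cong_def using filt_mono[OF filt_tens_Ident[of h b] assms(2)] t assms by auto
qed

lemma eqv_cong_trans: "f \<approx> g \<Longrightarrow> cong n g h \<Longrightarrow> cong n f h"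
  by (rule cong_trans[OF cong_eqv])

lemma cong_eqv_trans: "cong n f g \<Longrightarrow> g \<approx> h \<Longrightarrow> cong n f h"
  by (rule cong_trans[OF _ cong_eqv])

lemma cong_refl: "mor_in Q \<tau> oKLRW f \<Longrightarrow> cong n f f"
  by (rule cong_eqv[OF meq_refl])

lemma cong_scale: "cong n f g \<Longrightarrow> cong n (c \<odot> f) (c \<odot> g)"
proof -
  assume "cong n f g"
  then obtain h where h: "filt n h" "f \<approx> g \<oplus> h" unfolding cong_def by blast
  have "c \<odot> f \<approx> c \<odot> (g \<oplus> h)" using h(2) by (rule meq_scale_cong)
  also have "\<dots> \<approx> c \<odot> g \<oplus> c \<odot> h" using mor_eq_typing[OF h(2)] by (intro meq_scale_add_right) auto
  finally show ?thesis unfolding cong_def using filt_scale[OF h(1)] by blast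
qed

text \<open>Case distinction by colours: three black letters, or one red letter on the left, in the
  middle or on the right, each have their own defining relation. With two red letters, both sides
  contain the crossing of these two, which is \<open>Zero\<close>.\<close>

lemma cross_braid:
  assumes "letter_ok l" "letter_ok l'" "letter_ok l''"
  shows "congK
    ((cross l' l'' \<otimes> Ident [l]) \<cdot> (Ident [l'] \<otimes> cross l l'') \<cdot> (cross l l' \<otimes> Ident [l'']))
    ((Ident [l''] \<otimes> cross l l') \<cdot> (cross l l'' \<otimes> Ident [l']) \<cdot> (Ident [l] \<otimes> cross l' l''))"
    (is "congK ?L ?R")
proof -
  have t: "src ?L = src ?R" "tgt \<tau> ?L = tgt \<tau> ?R" by simp_all
  have zero: ?thesis if "null KLRW ?L" "null KLRW ?R"
    by (rule congK_eqv[OF null_eqv[OF that t]])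
  show ?thesis
  proof (cases l)
    case l: (Black i)
    show ?thesis
    proof (cases l')
      case l': (Black j)
      show ?thesis
      proof (cases l'')
        case l'': (Black k)
        \<comment> \<open>The correction stays a schematic variable until the relation instantiates
          it; what remains is that it has no crossings. The other relations with corrections are
          applied in the same way.\<close>
        show ?thesis
          unfolding congK_def l l' l'' cross.simps
          by (intro exI conjI, rule_tac[2] eqv_diffD[OF meq_klrw_rel[OF klrw_braid]])
            (use assms l l' l'' in auto)
      next
        case l'': (Red \<theta>)
        show ?thesis
          unfolding l l' l'' cross.simps
          by (intro congK_eqv meq_klrw_rel klrw_red_right) (use assms l l' l'' in auto)
      qed
    next
      case l': (Red \<theta>)
      show ?thesis
      proof (cases l'')
        case l'': (Black k)
        show ?thesis
          unfolding congK_def l l' l'' cross.simps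
          by (intro exI conjI, rule_tac[2] eqv_diffD[OF meq_klrw_rel[OF klrw_red_middle]])
            (use assms l l' l'' in auto)
      next
        case l'': (Red \<eta>)
        have "null KLRW (cross l' l'')" using assms l' l'' by (auto intro: null_Zero)
        then show ?thesis using assms
          by (intro zero null_comp_left[OF null_tens_left] null_comp_right[OF null_comp_right[OF null_tens_right]]) auto
      qed
    qed
  next
    case l: (Red \<theta>)
    show ?thesis
    proof (cases l')
      case l': (Black j)
      show ?thesis
      proof (cases l'')
        case l'': (Black k)
        show ?thesis
          unfolding l l' l'' cross.simps
          by (intro congK_eqv meq_klrw_rel klrw_red_left) (use assms l l' l'' in auto)
      next
        case l'': (Red \<eta>)
        have "null KLRW (cross l l'')" using assms l l'' by (auto intro: null_Zero)
        then show ?thesis using assms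
          by (intro zero null_comp_right[OF null_comp_left[OF null_tens_right]]
             null_comp_right[OF null_comp_left[OF null_tens_left]]) auto
      qed
    next
      case l': (Red \<eta>)
      have "null KLRW (cross l l')" using assms l l' by (auto intro: null_Zero)
      then show ?thesis using assms
        by (intro zero null_comp_right[OF null_comp_right[OF null_tens_left]]
           null_comp_left[OF null_tens_right]) auto
    qed
  qed
qed

lemma cross_cross:
  assumes "letter_ok l" "letter_ok l'"
  shows "\<exists>h. ncross h = 0 \<and> cross l' l \<cdot> cross l l' \<approx>\<^bsub>KLRW\<^esub> h"
proof (cases l; cases l')
  fix i j assume l: "l = Black i" "l' = Black j"
  show ?thesis
  proof (cases "i = j")
    case True
    show ?thesis unfolding l True cross.simps
      by (intro exI conjI, rule_tac[2] meq_klrw_rel[OF klrw_cross_cross_same]) (use assms l True in auto)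
  next
    case False
    show ?thesis unfolding l cross.simps
      by (intro exI conjI, rule_tac[2] meq_klrw_rel[OF klrw_cross_cross]) (use assms l False in auto)
  qed
next
  fix i \<theta> assume l: "l = Black i" "l' = Red \<theta>"
  show ?thesis unfolding l cross.simps
    by (intro exI conjI, rule_tac[2] meq_klrw_rel[OF klrw_red_red_right]) (use assms l in auto)
next
  fix i \<theta> assume l: "l = Red \<theta>" "l' = Black i"
  show ?thesis unfolding l cross.simps
    by (intro exI conjI, rule_tac[2] meq_klrw_rel[OF klrw_red_red_left]) (use assms l in auto)
next
  fix \<theta> \<eta> assume l: "l = Red \<theta>" "l' = Red \<eta>"
  have "null KLRW (cross l' l \<cdot> cross l l')"
    using assms l by (intro null_comp_left) (auto intro: null_Zero)
  then show ?thesis unfolding null_def by (intro exI[of _ "Zero [l, l'] [l, l']"]) simp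
qed

lemma ldot_cross:
  assumes "letter_ok l" "letter_ok l'"
  shows "congK ((ldot l' \<otimes> Ident [l]) \<cdot> cross l l') (cross l l' \<cdot> (Ident [l] \<otimes> ldot l'))" (is "congK ?L ?R")
    and "congK (cross l l' \<cdot> (ldot l \<otimes> Ident [l'])) ((Ident [l'] \<otimes> ldot l) \<cdot> cross l l')" (is "congK ?L' ?R'")
proof -
  have t: "src ?L = src ?R" "tgt \<tau> ?L = tgt \<tau> ?R" "src ?L' = src ?R'" "tgt \<tau> ?L' = tgt \<tau> ?R'" by simp_all
  show "congK ?L ?R"
  proof (cases l')
    case l': (Black j)
    show ?thesis
    proof (cases l)
      case l: (Black i)
      show ?thesis unfolding congK_def l l' cross.simps ldot.simps
        by (intro exI conjI, rule_tac[2] meq_klrw_rel[OF klrw_dot_cross]) (use assms l l' in auto)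
    next
      case l: (Red \<theta>)
      show ?thesis unfolding l l' cross.simps ldot.simps
        by (intro congK_eqv meq_klrw_rel klrw_dot_red_left) (use assms l l' in auto)
    qed
  next
    case l': (Red \<theta>)
    have "null KLRW (ldot l')" using assms l' by (auto intro: null_Zero)
    then show ?thesis using assms t
      by (intro congK_eqv null_eqv null_comp_left[OF null_tens_left] null_comp_right[OF null_tens_right]) auto
  qed
  show "congK ?L' ?R'"
  proof (cases l)
    case l: (Black i)
    show ?thesis
    proof (cases l')
      case l': (Black j)
      show ?thesis unfolding congK_def l l' cross.simps ldot.simps
        by (intro exI conjI, rule_tac[2] meq_klrw_rel[OF klrw_cross_dot]) (use assms l l' in auto)
    next
      case l': (Red \<theta>)
      show ?thesis unfolding l l' cross.simps ldot.simps
        by (intro congK_eqv meq_klrw_rel klrw_dot_red_right) (use assms l l' in auto)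
    qed
  next
    case l: (Red \<theta>)
    have "null KLRW (ldot l)" using assms l by (auto intro: null_Zero)
    then show ?thesis using assms t
      by (intro congK_eqv null_eqv null_comp_left[OF null_tens_right] null_comp_right[OF null_tens_left]) auto
  qed
qed

text \<open>Both sides contain four crossings or \<rho>s, so the single crossing left in the
  correction for j = \<tau> i is still of smaller degree. If a letter is red, its \<rho> is
  \<open>Zero\<close> and both sides vanish.\<close>

lemma lrho_cross:
  assumes "letter_ok l" "letter_ok l'"
  shows "\<exists>h. ncross h \<le> 1 \<and>
    cross (flip l') (flip l) \<cdot> (lrho l' \<otimes> Ident [flip l]) \<cdot> cross (flip l) l' \<cdot> (lrho l \<otimes> Ident [l']) \<approx>
    (lrho l \<otimes> Ident [flip l']) \<cdot> cross (flip l') l \<cdot> (lrho l' \<otimes> Ident [l]) \<cdot> cross l l' \<oplus> h"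
    (is "\<exists>h. _ \<and> ?L \<approx> ?R \<oplus> h")
proof -
  have t: "src ?L = src ?R" "tgt \<tau> ?L = tgt \<tau> ?R" by simp_all
  have m: "mor_in Q \<tau> oKLRW ?R" using assms by simp
  have zero: ?thesis if "null oKLRW ?L" "null oKLRW ?R"
  proof (intro exI conjI)
    have "?L \<approx> ?R" by (rule null_eqv[OF that t])
    also have "?R \<approx> ?R \<oplus> Zero (src ?R) (tgt \<tau> ?R)" by (rule meq_sym[OF meq_add_zero[OF m]])
    finally show "?L \<approx> ?R \<oplus> Zero (src ?R) (tgt \<tau> ?R)" .
  qed simp
  consider i j where "l = Black i" "l' = Black j" | \<theta> where "l = Red \<theta>" | \<theta> where "l' = Red \<theta>"
    by (cases l; cases l')
  then show ?thesis
  proof cases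
    case 1
    show ?thesis unfolding 1 cross.simps lrho.simps flip.simps
      by (intro exI conjI, rule_tac[2] eqv_diffD[OF meq_oklrw_rel[OF oklrw_rho_cross]]) (use assms 1 in auto)
  next
    case 2
    have "null oKLRW (lrho l)" using assms 2 by (auto intro: null_Zero)
    then show ?thesis using assms
      by (intro zero null_comp_right[OF null_comp_right[OF null_comp_right[OF null_tens_left]]]
          null_comp_left[OF null_tens_left]) auto
  next
    case 3
    have "null oKLRW (lrho l')" using assms 3 by (auto intro: null_Zero)
    then show ?thesis using assms
      by (intro zero null_comp_right[OF null_comp_left[OF null_tens_left]]
          null_comp_right[OF null_comp_right[OF null_comp_left[OF null_tens_left]]]) auto
  qed
qed

lemma lrho_lrho:
  assumes "letter_ok l"
  shows "\<exists>h. ncross h = 0 \<and> lrho (flip l) \<cdot> lrho l \<approx> h"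
proof (cases l)
  case (Black i)
  show ?thesis unfolding Black lrho.simps flip.simps
    by (intro exI conjI, rule_tac[2] meq_oklrw_rel[OF oklrw_rho_rho]) (use assms Black in auto)
next
  case (Red \<theta>)
  have "null oKLRW (lrho (flip l) \<cdot> lrho l)" using assms Red by (intro null_comp_left) (auto intro: null_Zero)
  then show ?thesis unfolding null_def by (intro exI[of _ "Zero [l] [flip (flip l)]"]) simp
qed

text \<open>The defining relation has its sign on the other side; multiplying by -1 twice moves it.
  For a red letter both composites are zero.\<close>

lemma ldot_lrho:
  assumes "letter_ok l"
  shows "ldot (flip l) \<cdot> lrho l \<approx> (- 1) \<odot> (lrho l \<cdot> ldot l)"
proof (cases l)
  case (Black i)
  have i: "i \<in> verts Q" using assms Black by simp
  have "(- 1) \<odot> (Rho i \<cdot> Dot i) \<approx> (- 1) \<odot> (- 1) \<odot> (Dot (\<tau> i) \<cdot> Rho i)"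
    by (intro meq_scale_cong meq_oklrw_rel oklrw_rho_dot i)
  also have "\<dots> \<approx> (- 1 * - 1) \<odot> (Dot (\<tau> i) \<cdot> Rho i)"
    using i tau_verts by (intro meq_scale_scale) simp
  also have "\<dots> \<approx> Dot (\<tau> i) \<cdot> Rho i"
    using i tau_verts meq_scale_one[of Q \<tau> oKLRW "Dot (\<tau> i) \<cdot> Rho i"] by simp
  finally show ?thesis unfolding Black ldot.simps lrho.simps flip.simps by (rule meq_sym)
next
  case (Red \<theta>)
  have n: "null oKLRW (ldot (flip l) \<cdot> lrho l)" "null oKLRW (lrho l \<cdot> ldot l)"
    using assms Red by (auto intro!: null_comp_left null_Zero)
  have "(- 1) \<odot> (lrho l \<cdot> ldot l) \<approx> (- 1) \<odot> Zero [l] [flip l]"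
    using n(2) by (intro meq_scale_cong) (simp add: null_def)
  also have "\<dots> \<approx> (- 1) \<odot> 0 \<odot> Zero [l] [flip l]"
    using assms by (intro meq_scale_cong Zero_scale_0) auto
  also have "\<dots> \<approx> (- 1 * 0) \<odot> Zero [l] [flip l]"
    using assms by (intro meq_scale_scale) auto
  also have "\<dots> \<approx> Zero [l] [flip l]"
    using assms scale_0[of oKLRW "Zero [l] [flip l]"] by simp
  also have "\<dots> \<approx> ldot (flip l) \<cdot> lrho l"
    using meq_sym n(1) by (simp add: null_def)
  finally show ?thesis by (rule meq_sym)
qed

section \<open>Braid relations, squares and sliding dots on whole words\<close>

lemma path_single: "m < length X \<Longrightarrow> X \<in> words Q \<Longrightarrow> path [m] X \<approx> gen m X"
  using meq_comp_id_right[of Q \<tau> oKLRW "gen m X"] by simp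

lemma path_Cons_eqv:
  "path w X \<approx> f \<Longrightarrow> m < length X \<Longrightarrow> set w \<subseteq> {..<length X} \<Longrightarrow> X \<in> words Q \<Longrightarrow>
    path (m # w) X \<approx> gen m (sws w X) \<cdot> f"
  using eqv_comp_right[of oKLRW "path w X" f "gen m (sws w X)"] by simp

lemma path_pair:
  "m < length X \<Longrightarrow> m' < length X \<Longrightarrow> X \<in> words Q \<Longrightarrow> path [m, m'] X \<approx> gen m (sw m' X) \<cdot> gen m' X"
  using path_Cons_eqv[OF path_single, of m' X m] by (simp del: path.simps)

lemma path_far:
  assumes "Suc i < j" "j < length X" "X \<in> words Q"
  shows "sws [i, j] X = sws [j, i] X" "path [i, j] X \<approx> path [j, i] X"
proof -
  obtain k where j: "j = Suc k" using assms by (cases j) auto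
  have "sws [i, j] X = sws [j, i] X \<and> gen i (sw j X) \<cdot> gen j X \<approx> gen j (sw i X) \<cdot> gen i X"
  proof (cases i)
    case 0
    \<comment> \<open>No strands may stand to the left of \<rho>, so this case uses the exchange at
      the left edge. The crossing at positions k, k+1 of X lies at k-1, k of Y.\<close>
    obtain l Y where X: "X = l # Y" using assms by (cases X) auto
    obtain c m m' b where Y: "Y = c @ m # m' # b" "k - 1 = length c"
      by (rule split_at2[of "k - 1" Y]) (use assms j 0 X in simp, blast)
    have k: "k = length (l # c)" using Y assms 0 j by simp
    have s: "sw (Suc k) (v # c @ m # m' # b) = v # c @ m' # m # b"
      "gen (Suc k) (v # c @ m # m' # b) = wh (v # c) (cross m m') b" for v
      using sw_append[of "v # c" m m' b] gen_append[of "v # c" m m' b] k by simp_all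
    show ?thesis using assms tens_wh_exchange[of oKLRW "lrho l" "cross m m'" c b]
      unfolding 0 j X Y by (simp add: s)
  next
    case (Suc i')
    obtain a l l' d where X: "X = a @ l # l' # d" "i' = length a"
      by (rule split_at2[of i' X]) (use assms j Suc in simp, blast)
    \<comment> \<open>The second crossing is at positions k, k+1 of X, and \<open>d\<close> starts
      at position i' + 2.\<close>
    obtain c m m' b where d: "d = c @ m # m' # b" "k - i' - 2 = length c"
      by (rule split_at2[of "k - i' - 2" d]) (use assms j Suc X in simp, blast)
    have k: "k = length (a @ u # u' # c)" for u u' using d X assms Suc j by simp
    have s: "sw (Suc k) (a @ u # u' # c @ m # m' # b) = a @ u # u' # c @ m' # m # b"
      "gen (Suc k) (a @ u # u' # c @ m # m' # b) = wh (a @ u # u' # c) (cross m m') b" for u u'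
      using sw_append[of "a @ u # u' # c" m m' b] gen_append[of "a @ u # u' # c" m m' b] k[of u u'] by simp_all
    show ?thesis using assms wh_exchange[of "cross l l'" "cross m m'" a c b oKLRW]
      unfolding Suc j X d by (simp add: s gen_append)
  qed
  note * = this
  show "sws [i, j] X = sws [j, i] X" using * by blast
  have "path [i, j] X \<approx> gen i (sw j X) \<cdot> gen j X" using assms by (intro path_pair) auto
  also have "\<dots> \<approx> gen j (sw i X) \<cdot> gen i X" using * by blast
  also have "\<dots> \<approx> path [j, i] X" using assms by (intro meq_sym[OF path_pair]) auto
  finally show "path [i, j] X \<approx> path [j, i] X" .
qed


declare sw_words [simp] eqv_cong_trans [trans] cong_eqv_trans [trans]

lemma wh_comp3:
  assumes "mor_in Q \<tau> KLRW (h \<cdot> g \<cdot> f)" "a \<in> words Q" "b \<in> words Q"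
  shows "wh a h b \<cdot> wh a g b \<cdot> wh a f b \<approx>\<^bsub>C\<^esub> wh a (h \<cdot> g \<cdot> f) b"
proof -
  have "wh a h b \<cdot> wh a g b \<cdot> wh a f b \<approx>\<^bsub>C\<^esub> wh a h b \<cdot> wh a (g \<cdot> f) b"
    using assms by (intro eqv_comp_right meq_sym[OF wh_comp]) auto
  also have "\<dots> \<approx>\<^bsub>C\<^esub> wh a (h \<cdot> g \<cdot> f) b"
    using assms by (intro meq_sym[OF wh_comp]) auto
  finally show ?thesis .
qed

text \<open>The three slices come with different outer strands. They are rewritten over the common
  strands \<open>a\<close> and \<open>b\<close>, so that their composite is one whiskered local
  diagram to which the relation applies, and afterwards cut again.\<close>

lemma path_three:
  assumes "1 \<le> i" "Suc i < length X" "X \<in> words Q"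
  shows "sws [i, Suc i, i] X = sws [Suc i, i, Suc i] X"
    "cong n (path [i, Suc i, i] X) (path [Suc i, i, Suc i] X :: ('i, 'k::field) mor)"
proof -
  obtain k where i: "i = Suc k" using assms by (cases i) auto
  obtain a l m d where X: "X = a @ l # m # d" "k = length a"
    by (rule split_at2[of k X]) (use assms i in simp, blast)
  obtain r b where d: "d = r # b" using X assms i by (cases d) auto
  have ok: "a \<in> words Q" "b \<in> words Q" "letter_ok l" "letter_ok m" "letter_ok r"
    using assms X d by auto
  have s: "sw (Suc (Suc k)) (a @ u # v # w # b) = a @ u # w # v # b"
    "gen (Suc (Suc k)) (a @ u # v # w # b) = wh (a @ [u]) (cross v w) b" for u v w
    using sw_append[of "a @ [u]" v w b] gen_append[of "a @ [u]" v w b] X by simp_all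
  have s': "sw (Suc k) (a @ u # v # w # b) = a @ v # u # w # b"
    "gen (Suc k) (a @ u # v # w # b) = wh a (cross u v) (w # b)" for u v w
    using sw_append[of a u v "w # b"] gen_append[of a u v "w # b"] X by simp_all
  show sw: "sws [i, Suc i, i] X = sws [Suc i, i, Suc i] X"
    unfolding i X(1) d by (simp add: s s')
  have R: "wh a f (u # b) \<approx> wh a (f \<otimes> Ident [u]) b" if "mor_in Q \<tau> KLRW f" "letter_ok u" for f :: "('i, 'k) mor" and u
    using meq_sym[OF wh_right[of a b "[u]" f oKLRW]] that ok by simp
  have L: "wh (a @ [u]) f b \<approx> wh a (Ident [u] \<otimes> f) b" if "mor_in Q \<tau> KLRW f" "letter_ok u" for f :: "('i, 'k) mor" and u
    using meq_sym[OF wh_left[of a b "[u]" f oKLRW]] that ok by simp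
  have "path [i, Suc i, i] X \<approx> wh a (cross m r) (l # b) \<cdot> wh (a @ [m]) (cross l r) b \<cdot> (wh a (cross l m) (r # b) :: ('i, 'k) mor)"
    using path_Cons_eqv[OF path_pair, of "Suc i" X i i] assms ok unfolding i X(1) d by (simp add: s s')
  also have "\<dots> \<approx> wh a (cross m r \<otimes> Ident [l]) b \<cdot> wh a (Ident [m] \<otimes> cross l r) b \<cdot> wh a (cross l m \<otimes> Ident [r]) b"
    using ok by (intro eqv_comp R L) simp_all
  also have "\<dots> \<approx> wh a ((cross m r \<otimes> Ident [l]) \<cdot> (Ident [m] \<otimes> cross l r) \<cdot> (cross l m \<otimes> Ident [r])) b"
    using ok by (intro wh_comp3) simp_all
  also have "cong n \<dots> (wh a ((Ident [r] \<otimes> cross l m) \<cdot> (cross l r \<otimes> Ident [m]) \<cdot> (Ident [l] \<otimes> cross m r)) b)"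
    using ok by (intro cong_wh cross_braid)
  also have "wh a ((Ident [r] \<otimes> cross l m) \<cdot> (cross l r \<otimes> Ident [m]) \<cdot> (Ident [l] \<otimes> cross m r)) b \<approx>
      wh a (Ident [r] \<otimes> cross l m) b \<cdot> wh a (cross l r \<otimes> Ident [m]) b \<cdot> (wh a (Ident [l] \<otimes> cross m r) b :: ('i, 'k) mor)"
    using ok by (intro meq_sym[OF wh_comp3]) simp_all
  also have "\<dots> \<approx> wh (a @ [r]) (cross l m) b \<cdot> wh a (cross l r) (m # b) \<cdot> wh (a @ [l]) (cross m r) b"
    using ok by (intro eqv_comp meq_sym[OF R] meq_sym[OF L]) simp_all
  also have "\<dots> \<approx> path [Suc i, i, Suc i] X"
    using meq_sym[OF path_Cons_eqv[OF path_pair, of i X "Suc i" "Suc i"]] assms ok unfolding i X(1) d by (simp add: s s')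
  finally show "cong n (path [i, Suc i, i] X) (path [Suc i, i, Suc i] X :: ('i, 'k) mor)" .
qed

lemma comp4_tens_Ident:
  assumes "mor_in Q \<tau> C (k \<cdot> h \<cdot> g \<cdot> f)" "b \<in> words Q"
  shows "(k \<otimes> Ident b) \<cdot> (h \<otimes> Ident b) \<cdot> (g \<otimes> Ident b) \<cdot> (f \<otimes> Ident b) \<approx>\<^bsub>C\<^esub> (k \<cdot> h \<cdot> g \<cdot> f) \<otimes> Ident b"
proof -
  have "(k \<otimes> Ident b) \<cdot> (h \<otimes> Ident b) \<cdot> (g \<otimes> Ident b) \<cdot> (f \<otimes> Ident b) \<approx>\<^bsub>C\<^esub>
      (k \<otimes> Ident b) \<cdot> (h \<otimes> Ident b) \<cdot> ((g \<cdot> f) \<otimes> Ident b)"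
    using assms by (intro eqv_comp_right meq_sym[OF comp_tens_Ident]) auto
  also have "\<dots> \<approx>\<^bsub>C\<^esub> (k \<otimes> Ident b) \<cdot> ((h \<cdot> g \<cdot> f) \<otimes> Ident b)"
    using assms by (intro eqv_comp_right meq_sym[OF comp_tens_Ident]) auto
  also have "\<dots> \<approx>\<^bsub>C\<^esub> (k \<cdot> h \<cdot> g \<cdot> f) \<otimes> Ident b"
    using assms by (intro meq_sym[OF comp_tens_Ident]) auto
  finally show ?thesis .
qed

lemma path_four:
  assumes "1 < length X" "X \<in> words Q"
  shows "sws [1, 0, 1, 0] X = sws [0, 1, 0, 1] X"
    "1 \<le> n \<Longrightarrow> cong n (path [1, 0, 1, 0] X) (path [0, 1, 0, 1] X :: ('i, 'k::field) mor)"
proof -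
  obtain l Y where X1: "X = l # Y" using assms by (cases X) auto
  obtain m b where X: "X = l # m # b" using assms X1 by (cases Y) auto
  have ok: "b \<in> words Q" "letter_ok l" "letter_ok m" using assms X by auto
  have s: "sw (Suc 0) (u # v # b) = v # u # b" "gen (Suc 0) (u # v # b) = wh [] (cross u v) b" for u v
    using sw_append[of "[]" u v b] gen_append[of "[]" u v b] by simp_all
  show sw: "sws [1, 0, 1, 0] X = sws [0, 1, 0, 1] X"
    unfolding X by (simp add: s)
  assume n: "1 \<le> n"
  have R: "lrho u \<otimes> Ident (v # b) \<approx> ((lrho u \<otimes> Ident [v]) \<otimes> Ident b :: ('i, 'k) mor)" if "letter_ok u" "letter_ok v" for u v
    using meq_sym[OF tens_Ident_tens_Ident[of oKLRW "lrho u" "[v]" b]] that ok by simp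
  have L: "wh [] (cross u v) b \<approx> (cross u v \<otimes> Ident b :: ('i, 'k) mor)" if "letter_ok u" "letter_ok v" for u v
    using that ok by (intro wh_Nil) simp_all
  obtain h :: "('i, 'k) mor" where h: "ncross h \<le> 1"
    "cross (flip m) (flip l) \<cdot> (lrho m \<otimes> Ident [flip l]) \<cdot> cross (flip l) m \<cdot> (lrho l \<otimes> Ident [m]) \<approx>
    (lrho l \<otimes> Ident [flip m]) \<cdot> cross (flip m) l \<cdot> (lrho m \<otimes> Ident [l]) \<cdot> cross l m \<oplus> h"
    using lrho_cross[of l m] ok by blast
  have "path [1, 0, 1, 0] X \<approx> wh [] (cross (flip m) (flip l)) b \<cdot> (lrho m \<otimes> Ident (flip l # b)) \<cdot>
      wh [] (cross (flip l) m) b \<cdot> (lrho l \<otimes> Ident (m # b) :: ('i, 'k) mor)"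
    using path_Cons_eqv[OF path_Cons_eqv[OF path_pair], of "Suc 0" X 0 0 "Suc 0"] assms ok unfolding X by (simp add: s)
  also have "\<dots> \<approx> (cross (flip m) (flip l) \<otimes> Ident b) \<cdot> ((lrho m \<otimes> Ident [flip l]) \<otimes> Ident b) \<cdot>
      (cross (flip l) m \<otimes> Ident b) \<cdot> ((lrho l \<otimes> Ident [m]) \<otimes> Ident b)"
    using ok by (intro eqv_comp R L) simp_all
  also have "\<dots> \<approx> (cross (flip m) (flip l) \<cdot> (lrho m \<otimes> Ident [flip l]) \<cdot> cross (flip l) m \<cdot> (lrho l \<otimes> Ident [m])) \<otimes> Ident b"
    using ok by (intro comp4_tens_Ident) simp_all
  also have "cong n \<dots> (((lrho l \<otimes> Ident [flip m]) \<cdot> cross (flip m) l \<cdot> (lrho m \<otimes> Ident [l]) \<cdot> cross l m) \<otimes> Ident b)"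
    using ok n h by (intro cong_tens_Ident) auto
  also have "((lrho l \<otimes> Ident [flip m]) \<cdot> cross (flip m) l \<cdot> (lrho m \<otimes> Ident [l]) \<cdot> cross l m) \<otimes> Ident b \<approx>
     ((lrho l \<otimes> Ident [flip m]) \<otimes> Ident b) \<cdot> (cross (flip m) l \<otimes> Ident b) \<cdot> ((lrho m \<otimes> Ident [l]) \<otimes> Ident b) \<cdot> (cross l m \<otimes> Ident b :: ('i, 'k) mor)"
    using ok by (intro meq_sym[OF comp4_tens_Ident]) simp_all
  also have "\<dots> \<approx> (lrho l \<otimes> Ident (flip m # b)) \<cdot> wh [] (cross (flip m) l) b \<cdot> (lrho m \<otimes> Ident (l # b)) \<cdot> wh [] (cross l m) b"
    using ok by (intro eqv_comp meq_sym[OF R] meq_sym[OF L]) simp_all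
  also have "\<dots> \<approx> path [0, 1, 0, 1] X"
    using meq_sym[OF path_Cons_eqv[OF path_Cons_eqv[OF path_pair], of 0 X "Suc 0" "Suc 0" 0]] assms ok unfolding X by (simp add: s)
  finally show "cong n (path [1, 0, 1, 0] X) (path [0, 1, 0, 1] X :: ('i, 'k) mor)" .
qed

text \<open>Every quadratic relation, including the one for \<rho>, has a right side without
  crossings, so the degree drops from 2 to 0.\<close>

lemma path_same:
  assumes "m < length X" "X \<in> words Q"
  shows "filt 0 (gen m (sw m X) \<cdot> (gen m X :: ('i, 'k::field) mor))"
proof (cases m)
  case 0
  obtain l b where X: "X = l # b" using assms by (cases X) auto
  have ok: "b \<in> words Q" "letter_ok l" using assms X by auto
  obtain h :: "('i, 'k) mor" where h: "ncross h = 0" "lrho (flip l) \<cdot> lrho l \<approx> h" using lrho_lrho[OF ok(2)] by blast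
  have "gen m (sw m X) \<cdot> (gen m X :: ('i, 'k) mor) = (lrho (flip l) \<otimes> Ident b) \<cdot> (lrho l \<otimes> Ident b)"
    unfolding 0 X by simp
  also have "\<dots> \<approx> (lrho (flip l) \<cdot> lrho l) \<otimes> Ident b"
    using ok by (intro meq_sym[OF comp_tens_Ident]) simp_all
  also have "\<dots> \<approx> h \<otimes> Ident b" using h ok by (intro meq_tens_cong meq_refl) simp_all
  finally show ?thesis using filt_tens_Ident[of h b] h mor_eq_typing[OF h(2)] ok by (auto intro: filt_eqv')
next
  case (Suc k)
  obtain a l l' b where X: "X = a @ l # l' # b" "k = length a"
    by (rule split_at2[of k X]) (use assms Suc in simp, blast)
  have ok: "a \<in> words Q" "b \<in> words Q" "letter_ok l" "letter_ok l'" using assms X by auto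
  obtain h :: "('i, 'k) mor" where h: "ncross h = 0" "cross l' l \<cdot> cross l l' \<approx>\<^bsub>KLRW\<^esub> h"
    using cross_cross[OF ok(3,4)] by blast
  have "gen m (sw m X) \<cdot> (gen m X :: ('i, 'k) mor) = wh a (cross l' l) b \<cdot> wh a (cross l l') b"
    unfolding Suc X by (simp add: gen_append)
  also have "\<dots> \<approx> wh a (cross l' l \<cdot> cross l l') b"
    using ok by (intro meq_sym[OF wh_comp]) simp_all
  also have "\<dots> \<approx> wh a h b" using h ok by (intro wh_cong)
  finally show ?thesis using filt_wh[of h a b] h mor_eq_typing[OF h(2)] ok by (auto intro: filt_eqv')
qed

text \<open>\<open>p'\<close> is the position from which the strand at \<open>p\<close> comes;
  \<open>c\<close> is -1 if the dot meets \<rho> and 1 otherwise. The error for two equal labels is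
  an identity, of degree 0, so that any \<open>n\<close> is allowed.\<close>

lemma dot_gen:
  assumes "m < length X" "p < length X" "X \<in> words Q"
  shows "\<exists>p' c. p' < length X \<and> cong n (dot p (sw m X) \<cdot> gen m X) (c \<odot> (gen m X \<cdot> (dot p' X :: ('i, 'k::field) mor)))"
proof -
  have one: "\<exists>p' c. p' < length X \<and> cong n (dot p (sw m X) \<cdot> gen m X) (c \<odot> (gen m X \<cdot> (dot p' X :: ('i, 'k) mor)))"
    if "p' < length X" "cong n (dot p (sw m X) \<cdot> gen m X) (gen m X \<cdot> (dot p' X :: ('i, 'k) mor))" for p'
  proof (intro exI conjI)
    show "cong n (dot p (sw m X) \<cdot> gen m X) (1 \<odot> (gen m X \<cdot> (dot p' X :: ('i, 'k) mor)))"
      using that(2) by (rule cong_eqv_trans) (use assms that in \<open>intro meq_sym[OF meq_scale_one], simp\<close>)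
  qed fact
  show ?thesis
  proof (cases m)
    case m: 0
    obtain l Y where X: "X = l # Y" using assms by (cases X) auto
    have ok: "Y \<in> words Q" "letter_ok l" using assms X by auto
    show ?thesis
    proof (cases p)
      case 0
      have d: "dot 0 (u # Y) = wh [] (ldot u) Y" for u using dot_append[of "[]" u Y] by simp
      have "dot p (sw m X) \<cdot> gen m X \<approx> (ldot (flip l) \<otimes> Ident Y) \<cdot> (lrho l \<otimes> Ident Y :: ('i, 'k) mor)"
        unfolding 0 m X using ok by (simp add: d) (intro eqv_comp wh_Nil meq_refl; simp)
      also have "\<dots> \<approx> (ldot (flip l) \<cdot> lrho l) \<otimes> Ident Y"
        using ok by (intro meq_sym[OF comp_tens_Ident]) simp_all
      also have "\<dots> \<approx> ((- 1) \<odot> (lrho l \<cdot> ldot l)) \<otimes> Ident Y"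
        using ok by (intro meq_tens_cong ldot_lrho meq_refl) simp_all
      also have "\<dots> \<approx> (- 1) \<odot> ((lrho l \<cdot> ldot l) \<otimes> Ident Y)"
        using ok by (intro meq_tens_scale_left) simp_all
      also have "\<dots> \<approx> (- 1) \<odot> ((lrho l \<otimes> Ident Y) \<cdot> (ldot l \<otimes> Ident Y))"
        using ok by (intro meq_scale_cong comp_tens_Ident) simp_all
      also have "\<dots> \<approx> (- 1) \<odot> (gen m X \<cdot> dot 0 X)"
        unfolding m X using ok by (simp add: d) (intro meq_scale_cong eqv_comp meq_sym[OF wh_Nil] meq_refl; simp)
      finally have "cong n (dot p (sw m X) \<cdot> gen m X) ((- 1) \<odot> (gen m X \<cdot> (dot 0 X :: ('i, 'k) mor)))" by (rule cong_eqv)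
      then show ?thesis using X by (intro exI[of _ 0] exI[of _ "- 1"]) simp
    next
      case (Suc q)
      obtain c u b where Y: "Y = c @ u # b" "q = length c"
        by (rule split_at[of q Y]) (use assms Suc X in simp, blast)
      have d: "dot (Suc q) (v # Y) = wh (v # c) (ldot u) b" for v using dot_append[of "v # c" u b] Y by simp
      have "gen m X \<cdot> dot p X \<approx> dot p (sw m X) \<cdot> (gen m X :: ('i, 'k) mor)"
        using tens_wh_exchange[of oKLRW "lrho l" "ldot u" c b] ok
        unfolding m X Suc by (simp add: d) (simp add: Y)
      then show ?thesis using assms by (intro one[of p] cong_eqv[OF meq_sym]) auto
    qed
  next
    case m: (Suc k)
    obtain a l l' b where X: "X = a @ l # l' # b" "k = length a"
      by (rule split_at2[of k X]) (use assms m in simp, blast)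
    have ok: "a \<in> words Q" "b \<in> words Q" "letter_ok l" "letter_ok l'" using assms X by auto
    have s: "sw m X = a @ l' # l # b" "gen m X = wh a (cross l l') b"
      unfolding m X by (simp_all add: gen_append)
    consider "p < k" | "p = k" | "p = Suc k" | "Suc (Suc k) \<le> p" by linarith
    then show ?thesis
    proof cases
      case 1
      obtain c u e where a: "a = c @ u # e" "p = length c"
        by (rule split_at[of p a]) (use 1 X in simp, blast)
      have d: "dot p (a @ w) = wh c (ldot u) (e @ w)" for w using dot_append[of c u "e @ w"] a by simp
      have "dot p (sw m X) \<cdot> gen m X \<approx> gen m X \<cdot> (dot p X :: ('i, 'k) mor)"
        unfolding s unfolding X d using wh_exchange[of "ldot u" "cross l l'" c e b oKLRW] ok a by simp
      then show ?thesis using assms by (intro one[of p] cong_eqv) auto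
    next
      case 2
      have d: "dot p (sw m X) = wh a (ldot l') (l # b)" "dot (Suc p) X = wh (a @ [l]) (ldot l') b"
        using dot_append[of a l' "l # b"] dot_append[of "a @ [l]" l' b] unfolding s unfolding X 2 by simp_all
      have "dot p (sw m X) \<cdot> gen m X \<approx> wh a (ldot l' \<otimes> Ident [l]) b \<cdot> (wh a (cross l l') b :: ('i, 'k) mor)"
        unfolding d unfolding s using ok wh_right[of a b "[l]" "ldot l'" oKLRW]
        by (intro eqv_comp meq_refl meq_sym[OF wh_right[of a b "[l]" "ldot l'" oKLRW, simplified]]) simp_all
      also have "\<dots> \<approx> wh a ((ldot l' \<otimes> Ident [l]) \<cdot> cross l l') b"
        using ok by (intro meq_sym[OF wh_comp]) simp_all
      also have "cong n \<dots> (wh a (cross l l' \<cdot> (Ident [l] \<otimes> ldot l')) b)"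
        using ok by (intro cong_wh ldot_cross)
      also have "wh a (cross l l' \<cdot> (Ident [l] \<otimes> ldot l')) b \<approx> wh a (cross l l') b \<cdot> (wh a (Ident [l] \<otimes> ldot l') b :: ('i, 'k) mor)"
        using ok by (intro wh_comp) simp_all
      also have "\<dots> \<approx> gen m X \<cdot> dot (Suc p) X"
        unfolding d unfolding s using ok by (intro eqv_comp meq_refl wh_left) simp_all
      finally show ?thesis using 2 X by (intro one[of "Suc p"]) auto
    next
      case 3
      have d: "dot p (sw m X) = wh (a @ [l']) (ldot l) b" "dot k X = wh a (ldot l) (l' # b)"
        using dot_append[of a l "l' # b"] dot_append[of "a @ [l']" l b] X(2) unfolding s unfolding X(1) 3 by simp_all
      have "gen m X \<cdot> dot k X \<approx> wh a (cross l l') b \<cdot> (wh a (ldot l \<otimes> Ident [l']) b :: ('i, 'k) mor)"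
        unfolding d unfolding s using ok
        by (intro eqv_comp meq_refl meq_sym[OF wh_right[of a b "[l']" "ldot l" oKLRW, simplified]]) simp_all
      also have "\<dots> \<approx> wh a (cross l l' \<cdot> (ldot l \<otimes> Ident [l'])) b"
        using ok by (intro meq_sym[OF wh_comp]) simp_all
      also have "cong n \<dots> (wh a ((Ident [l'] \<otimes> ldot l) \<cdot> cross l l') b)"
        using ok by (intro cong_wh ldot_cross)
      also have "wh a ((Ident [l'] \<otimes> ldot l) \<cdot> cross l l') b \<approx> wh a (Ident [l'] \<otimes> ldot l) b \<cdot> (wh a (cross l l') b :: ('i, 'k) mor)"
        using ok by (intro wh_comp) simp_all
      also have "\<dots> \<approx> dot p (sw m X) \<cdot> gen m X"
        unfolding d unfolding s using ok by (intro eqv_comp meq_refl wh_left) simp_all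
      finally show ?thesis using 3 X by (intro one[OF _ cong_sym, of k]) auto
    next
      case 4
      obtain c u e where b: "b = c @ u # e" "p - k - 2 = length c"
        by (rule split_at[of "p - k - 2" b]) (use 4 X assms in simp, blast)
      have p: "p = length (a @ v # v' # c)" for v v' using b 4 X by simp
      have d: "dot p (a @ v # v' # b) = wh (a @ v # v' # c) (ldot u) e" for v v'
        using dot_append[of "a @ v # v' # c" u e] b(1) p[of v v'] by simp
      have "gen m X \<cdot> dot p X \<approx> dot p (sw m X) \<cdot> (gen m X :: ('i, 'k) mor)"
        unfolding s unfolding X d using wh_exchange[of "cross l l'" "ldot u" a c e oKLRW] ok b by simp
      then show ?thesis using assms by (intro one[of p] cong_eqv[OF meq_sym]) auto
    qed
  qed
qed

lemma dot_path:
  assumes "set w \<subseteq> {..<length X}" "p < length X" "X \<in> words Q" "length w \<le> Suc n"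
  shows "\<exists>p' c. p' < length X \<and> cong n (dot p (sws w X) \<cdot> path w X) (c \<odot> (path w X \<cdot> (dot p' X :: ('i, 'k::field) mor)))"
  using assms
proof (induction w arbitrary: p n)
  case Nil
  have "dot p X \<cdot> Ident X \<approx> (dot p X :: ('i, 'k) mor)" using Nil meq_comp_id_right[of Q \<tau> oKLRW "dot p X"] by simp
  also have "\<dots> \<approx> Ident X \<cdot> dot p X" using Nil meq_sym[OF meq_comp_id_left[of Q \<tau> oKLRW "dot p X"]] by simp
  also have "\<dots> \<approx> 1 \<odot> (Ident X \<cdot> dot p X)" using Nil by (intro meq_sym[OF meq_scale_one]) simp
  finally show ?case using Nil by (intro exI[of _ p] exI[of _ 1]) (simp add: cong_eqv)
next
  case (Cons m w)
  let ?Z = "sws w X" and ?P = "path w X :: ('i, 'k) mor"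
  have Z: "?Z \<in> words Q" "length ?Z = length X" "m < length X" "set w \<subseteq> {..<length X}" using Cons.prems by auto
  obtain q c where q: "q < length X" "cong 0 (dot p (sw m ?Z) \<cdot> gen m ?Z) (c \<odot> (gen m ?Z \<cdot> (dot q ?Z :: ('i, 'k) mor)))"
    using dot_gen[of m ?Z p 0] Z Cons.prems by auto
  \<comment> \<open>For empty \<open>w\<close> the dot moves without error. Otherwise the induction
    hypothesis is used one degree lower, since the generator on top raises the degree of the error
    by one; then n is positive and \<open>n - 1\<close> is a true difference.\<close>
  obtain q' c' where q': "q' < length X"
    "cong n (gen m ?Z \<cdot> dot q ?Z \<cdot> ?P) (gen m ?Z \<cdot> (c' \<odot> (?P \<cdot> dot q' X)))"
  proof (cases "w = []")
    case True
    have "dot q X \<cdot> Ident X \<approx> (dot q X :: ('i, 'k) mor)"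
      using q Cons.prems meq_comp_id_right[of Q \<tau> oKLRW "dot q X"] by simp
    also have "\<dots> \<approx> Ident X \<cdot> dot q X"
      using q Cons.prems meq_sym[OF meq_comp_id_left[of Q \<tau> oKLRW "dot q X"]] by simp
    also have "\<dots> \<approx> 1 \<odot> (Ident X \<cdot> dot q X)"
      using q Cons.prems by (intro meq_sym[OF meq_scale_one]) simp
    finally have "gen m X \<cdot> dot q X \<cdot> Ident X \<approx> (gen m X \<cdot> (1 \<odot> (Ident X \<cdot> dot q X)) :: ('i, 'k) mor)"
      using Z q Cons.prems by (intro eqv_comp_right) simp_all
    then show ?thesis using that[of q 1] True q(1) by (simp add: cong_eqv)
  next
    case False
    obtain q' c' where q': "q' < length X" "cong (n - 1) (dot q ?Z \<cdot> ?P) (c' \<odot> (?P \<cdot> dot q' X))"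
    proof -
      have "length w \<le> Suc (n - 1)" using Cons.prems by simp
      from Cons.IH[OF Z(4) q(1) Cons.prems(3) this] show ?thesis using that by blast
    qed
    have "cong (Suc 0 + (n - 1)) (gen m ?Z \<cdot> dot q ?Z \<cdot> ?P) (gen m ?Z \<cdot> (c' \<odot> (?P \<cdot> dot q' X)))"
      using Z q Cons.prems by (intro cong_comp_left[OF q'(2) filt_gen_single]) simp_all
    then show ?thesis using that[of q' c'] q'(1) False Cons.prems by (cases w) simp_all
  qed
  have "dot p (sws (m # w) X) \<cdot> path (m # w) X \<approx> (dot p (sw m ?Z) \<cdot> gen m ?Z) \<cdot> ?P"
    using Z Cons.prems by (simp, intro meq_sym[OF meq_comp_assoc]) simp
  \<comment> \<open>The error made at the top generator has degree 0 and is composed with the path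
    of \<open>w\<close>, which has at most n generators.\<close>
  also have "cong n \<dots> ((c \<odot> (gen m ?Z \<cdot> dot q ?Z)) \<cdot> ?P)"
    using cong_comp_right[OF q(2) path_filt[of w X]] Z q Cons.prems by (auto intro: cong_mono)
  also have "(c \<odot> (gen m ?Z \<cdot> dot q ?Z)) \<cdot> ?P \<approx> c \<odot> ((gen m ?Z \<cdot> dot q ?Z) \<cdot> ?P)"
    using Z q Cons.prems by (intro meq_comp_scale_left) simp
  also have "\<dots> \<approx> c \<odot> (gen m ?Z \<cdot> dot q ?Z \<cdot> ?P)"
    using Z q Cons.prems by (intro meq_scale_cong meq_comp_assoc) simp
  also have "cong n \<dots> (c \<odot> (gen m ?Z \<cdot> (c' \<odot> (?P \<cdot> dot q' X))))"
    using q'(2) by (rule cong_scale)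
  also have "c \<odot> (gen m ?Z \<cdot> (c' \<odot> (?P \<cdot> dot q' X))) \<approx> c \<odot> c' \<odot> (gen m ?Z \<cdot> ?P \<cdot> dot q' X)"
    using Z q q' Cons.prems by (intro meq_scale_cong meq_comp_scale_right) simp
  also have "\<dots> \<approx> (c * c') \<odot> (gen m ?Z \<cdot> ?P \<cdot> dot q' X)"
    using Z q q' Cons.prems by (intro meq_scale_scale) simp
  also have "\<dots> \<approx> (c * c') \<odot> (path (m # w) X \<cdot> dot q' X)"
    using Z q q' Cons.prems by (simp, intro meq_scale_cong meq_sym[OF meq_comp_assoc]) simp
  finally show ?case using q'(1) by blast
qed

end

lemma dotmonom_cong:
  "(\<And>j. r \<le> j \<Longrightarrow> Poly_Mapping.lookup m j = Poly_Mapping.lookup m' j) \<Longrightarrow> dotmonom r w m = dotmonom r w m'"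
proof (induction w arbitrary: r)
  case (Cons l w)
  then show ?case by (cases l) auto
qed simp

context oklrw
begin

text \<open>Each relation loses at least one generator locally, and a context adds its own length to
  the degree of the error; so the error stays below the common length of the two words.\<close>

lemma path_braid:
  assumes "braid v w" "X \<in> words Q" "set v \<subseteq> {..<length X}"
  shows "sws v X = sws w X"
    "length v \<le> Suc n \<Longrightarrow> cong n (path v X) (path w X :: ('i, 'k::field) mor)"
proof -
  have "sws v X = sws w X \<and> (\<forall>n. length v \<le> Suc n \<longrightarrow> cong n (path v X) (path w X :: ('i, 'k) mor))"
    using assms
  proof (induction arbitrary: X rule: braid.induct)
    case (braid_far i j)
    then show ?case using path_far(1)[of i j X] by (auto simp del: path.simps intro!: cong_eqv path_far(2))
  next
    case (braid_three i)
    then show ?case using path_three(1)[of i X] by (auto simp del: path.simps intro!: path_three(2))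
  next
    case braid_four
    then show ?case using path_four(1)[of X] by (auto simp del: path.simps intro!: cong_sym[OF path_four(2)[unfolded One_nat_def]])
  next
    case (braid_refl w)
    then show ?case by (simp add: cong_refl)
  next
    case (braid_sym v w)
    have "set v = set w" "length v = length w" using braid_set braid_length braid_sym by blast+
    then show ?case using braid_sym by (auto intro: cong_sym)
  next
    case (braid_trans u v w)
    have "set u = set v" "length u = length v" using braid_set braid_length braid_trans by blast+
    then show ?case using braid_trans.IH(1)[of X] braid_trans.IH(2)[of X] braid_trans.prems
      by (auto intro: cong_trans)
  next
    case (braid_context v w a b)
    let ?Z = "sws b X"
    have vw: "set v = set w" "length v = length w" using braid_set braid_length braid_context by blast+
    have sub: "set a \<subseteq> {..<length X}" "set b \<subseteq> {..<length X}" "set v \<subseteq> {..<length X}" "X \<in> words Q"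
      using braid_context.prems by auto
    have IH: "sws v ?Z = sws w ?Z" "length v \<le> Suc k \<Longrightarrow> cong k (path v ?Z) (path w ?Z :: ('i, 'k) mor)" for k
      using braid_context.IH[of ?Z] sub by auto
    have e: "path (a @ u @ b) X \<approx> (path a (sws u ?Z) \<cdot> path u ?Z \<cdot> path b X :: ('i, 'k) mor)"
      if "set u \<subseteq> {..<length X}" for u
    proof -
      have "path (a @ u @ b) X \<approx> (path a (sws (u @ b) X) \<cdot> path (u @ b) X :: ('i, 'k) mor)"
        using that sub by (intro path_append) auto
      also have "\<dots> \<approx> path a (sws u ?Z) \<cdot> path u ?Z \<cdot> path b X"
        unfolding foldr_append comp_apply using that sub
        by (intro eqv_comp_right path_append) (auto simp flip: foldr_append)
      finally show ?thesis .
    qed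
    have "cong n (path (a @ v @ b) X) (path (a @ w @ b) X :: ('i, 'k) mor)" if n: "length (a @ v @ b) \<le> Suc n" for n
    proof (cases "v = []")
      case True
      then show ?thesis using vw(2) sub by (auto intro: cong_refl)
    next
      case False
      \<comment> \<open>\<open>v\<close> is not empty here, so \<open>length v - 1\<close> is a true
        difference and bounds the degree of the local error; for empty \<open>v\<close> the word
        \<open>w\<close> is empty too.\<close>
      then have l: "length v \<le> Suc (length v - 1)" "length a + (length v - 1 + length b) \<le> n" using n by (cases v; simp)+
      have "path (a @ v @ b) X \<approx> (path a (sws v ?Z) \<cdot> path v ?Z \<cdot> path b X :: ('i, 'k) mor)" using sub by (intro e)
      also have "cong (length a + (length v - 1 + length b)) \<dots> (path a (sws v ?Z) \<cdot> path w ?Z \<cdot> path b X)"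
        using sub by (intro cong_comp_left cong_comp_right IH(2)[OF l(1)] path_filt) auto
      then have "cong n (path a (sws v ?Z) \<cdot> path v ?Z \<cdot> path b X) (path a (sws v ?Z) \<cdot> path w ?Z \<cdot> path b X :: ('i, 'k) mor)"
        using l(2) by (rule cong_mono)
      also have "path a (sws v ?Z) \<cdot> path w ?Z \<cdot> path b X \<approx> (path (a @ w @ b) X :: ('i, 'k) mor)"
        unfolding IH(1) using sub vw by (intro meq_sym[OF e]) auto
      finally show ?thesis .
    qed
    then show ?case using IH(1) by simp
  qed
  then show "sws v X = sws w X"
    "length v \<le> Suc n \<Longrightarrow> cong n (path v X) (path w X :: ('i, 'k) mor)" by blast+
qed

text \<open>The squared generator has degree 0, so both of its copies are lost, while the letters
  around it keep their contribution.\<close>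

lemma path_repeat:
  assumes "X \<in> words Q" "set (a @ s # s # b) \<subseteq> {..<length X}"
  shows "sws (a @ s # s # b) X = sws (a @ b) X"
    "filt (length a + length b) (path (a @ s # s # b) X :: ('i, 'k::field) mor)"
proof -
  let ?Z = "sws b X"
  have Z: "?Z \<in> words Q" "length ?Z = length X" "s < length X" "set a \<subseteq> {..<length X}" "set b \<subseteq> {..<length X}"
    using assms by auto
  show "sws (a @ s # s # b) X = sws (a @ b) X"
    using sw_sw[of s ?Z] Z by simp
  have "path (s # s # b) X \<approx> (gen s (sw s ?Z) \<cdot> gen s ?Z) \<cdot> (path b X :: ('i, 'k) mor)"
    using Z assms by (simp, intro meq_sym[OF meq_comp_assoc]) (simp add: sw_words)
  moreover have "filt (0 + length b) ((gen s (sw s ?Z) \<cdot> gen s ?Z) \<cdot> (path b X :: ('i, 'k) mor))"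
    using Z assms by (intro filt_comp path_same path_filt) auto
  ultimately have 1: "filt (length b) (path (s # s # b) X :: ('i, 'k) mor)" using filt_eqv' by fastforce
  have "path (a @ s # s # b) X \<approx> (path a (sws (s # s # b) X) \<cdot> path (s # s # b) X :: ('i, 'k) mor)"
    using assms by (intro path_append) auto
  moreover have "filt (length a + length b) (path a (sws (s # s # b) X) \<cdot> (path (s # s # b) X :: ('i, 'k) mor))"
    using 1 assms Z by (intro filt_comp path_filt) (auto simp: sw_words)
  ultimately show "filt (length a + length b) (path (a @ s # s # b) X :: ('i, 'k) mor)" using filt_eqv' by blast
qed

section \<open>Monomials in the dots\<close>

lemma tens_comp_tens:
  assumes "mor_in Q \<tau> C (g \<cdot> f)" "mor_in Q \<tau> KLRW (g' \<cdot> f')"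
  shows "(g \<otimes> g') \<cdot> (f \<otimes> f') \<approx>\<^bsub>C\<^esub> (g \<cdot> f) \<otimes> (g' \<cdot> f')"
  using assms by (intro meq_sym[OF meq_interchange]) simp

lemma dotmonom_0: "X \<in> words Q \<Longrightarrow> dotmonom r X 0 \<approx>\<^bsub>C\<^esub> (Ident X :: ('i, 'k::field) mor)"
proof (induction X arbitrary: r C)
  case Nil
  then show ?case by (auto intro: meq_refl)
next
  case (Cons l Y)
  have "dotmonom r (l # Y) 0 \<approx>\<^bsub>C\<^esub> (Ident [l] \<otimes> Ident Y :: ('i, 'k) mor)"
    using Cons by (cases l) (auto intro!: meq_tens_cong meq_refl)
  also have "\<dots> \<approx>\<^bsub>C\<^esub> Ident (l # Y)" using Cons.prems meq_tens_ident[of "[l]" Q Y] by simp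
  finally show ?case .
qed

text \<open>Exponents are indexed by the number of a strand among the black ones, starting at
  \<open>r\<close>, whereas \<open>p\<close> is a position in the whole word;
  \<open>nblack (take p X)\<close> converts one into the other.\<close>

lemma dot_dotmonom:
  "X \<in> words Q \<Longrightarrow> p < length X \<Longrightarrow> is_black (X ! p) \<Longrightarrow>
    dot p X \<cdot> dotmonom r X m \<approx>\<^bsub>C\<^esub> (dotmonom r X (m + Poly_Mapping.single (r + nblack (take p X)) 1) :: ('i, 'k::field) mor)"
proof (induction X arbitrary: p r C)
  case (Cons l Y)
  have ok: "letter_ok l" "Y \<in> words Q" using Cons.prems by auto
  show ?case
  proof (cases p)
    case 0
    then obtain i where l: "l = Black i" using Cons.prems by (cases l) auto
    let ?m = "m + Poly_Mapping.single r 1"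
    have d: "dotmonom (Suc r) Y ?m = (dotmonom (Suc r) Y m :: ('i, 'k) mor)"
      by (rule dotmonom_cong) (simp add: lookup_add lookup_single)
    have dot0: "dot 0 (Black i # Y) = wh [] (Dot i) Y" using dot_append[of "[]" "Black i" Y] by simp
    have "dot p (l # Y) \<cdot> dotmonom r (l # Y) m \<approx>\<^bsub>C\<^esub> (Dot i \<otimes> Ident Y) \<cdot> (dotpow i (Poly_Mapping.lookup m r) \<otimes> dotmonom (Suc r) Y m :: ('i, 'k) mor)"
      unfolding 0 l using ok l by (simp add: dot0, intro eqv_comp wh_Nil meq_refl) simp_all
    also have "\<dots> \<approx>\<^bsub>C\<^esub> (Dot i \<cdot> dotpow i (Poly_Mapping.lookup m r)) \<otimes> (Ident Y \<cdot> dotmonom (Suc r) Y m)"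
      using ok l by (intro tens_comp_tens) simp_all
    also have "\<dots> \<approx>\<^bsub>C\<^esub> (Dot i \<cdot> dotpow i (Poly_Mapping.lookup m r)) \<otimes> dotmonom (Suc r) Y m"
      using ok l meq_comp_id_left[of Q \<tau> KLRW "dotmonom (Suc r) Y m"] by (intro meq_tens_cong meq_refl) simp_all
    also have "\<dots> = dotmonom r (l # Y) ?m" using l d by (simp add: lookup_add lookup_single)
    finally show ?thesis using 0 by simp
  next
    case (Suc q)
    let ?k = "(if is_black l then Suc r else r)"
    let ?s = "Poly_Mapping.single (r + nblack (take p (l # Y))) 1"
    have k: "r + nblack (take p (l # Y)) = ?k + nblack (take q Y)" using Suc by (cases l) auto
    define H :: "('i, 'k) mor" where
      "H = (case l of Black i \<Rightarrow> dotpow i (Poly_Mapping.lookup m r) | Red \<theta> \<Rightarrow> Ident [Red \<theta>])"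
    have H: "mor_in Q \<tau> C' H" "src H = [l]" "tgt \<tau> H = [l]" for C'
      using ok by (cases l; simp add: H_def)+
    have D: "dotmonom r (l # Y) m = H \<otimes> dotmonom ?k Y m" by (cases l) (simp_all add: H_def)
    have D': "dotmonom r (l # Y) (m + ?s) = H \<otimes> dotmonom ?k Y (m + ?s)"
      using Suc by (cases l) (simp_all add: H_def lookup_add lookup_single)
    have q: "q < length Y" "is_black (Y ! q)" using Cons.prems Suc by auto
    have t: "take q Y \<in> words Q" "drop (Suc q) Y \<in> words Q" "letter_ok (Y ! q)"
      using ok q append_take_drop_id[of q Y] id_take_nth_drop[OF q(1)] by (metis words_simps(4) words_Cons)+
    have "Ident [l] \<otimes> dot q Y \<approx>\<^bsub>C\<^esub> (dot p (l # Y) :: ('i, 'k) mor)"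
      using ok t Ident_tens_Ident_tens[of "ldot (Y ! q) \<otimes> Ident (drop (Suc q) Y)" "[l]" "take q Y" C]
      unfolding Suc by (simp add: dot_def wh_def)
    then have "dot p (l # Y) \<cdot> dotmonom r (l # Y) m \<approx>\<^bsub>C\<^esub> (Ident [l] \<otimes> dot q Y) \<cdot> (H \<otimes> dotmonom ?k Y m)"
      unfolding D using ok q H by (intro eqv_comp_left meq_sym[of Q \<tau> \<mu> C "Ident [l] \<otimes> dot q Y"]) (simp_all add: Suc)
    also have "\<dots> \<approx>\<^bsub>C\<^esub> (Ident [l] \<cdot> H) \<otimes> (dot q Y \<cdot> dotmonom ?k Y m)"
      using ok q H by (intro tens_comp_tens) simp_all
    also have "\<dots> \<approx>\<^bsub>C\<^esub> H \<otimes> dotmonom ?k Y (m + ?s)"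
      using ok q H meq_comp_id_left[of Q \<tau> C H] Cons.IH[of q KLRW ?k] unfolding k
      by (intro meq_tens_cong) simp_all
    also have "\<dots> = dotmonom r (l # Y) (m + ?s)" by (rule D'[symmetric])
    finally show ?thesis .
  qed
qed simp

text \<open>No \<rho> on a red letter and no crossing of two red letters: exactly the steps whose
  generator was not set to \<open>Zero\<close> by convention.\<close>

fun legal_step :: "nat \<Rightarrow> 'i word \<Rightarrow> bool" where
  "legal_step 0 X \<longleftrightarrow> is_black (hd X)"
| "legal_step (Suc k) X \<longleftrightarrow> is_black (X ! k) \<or> is_black (X ! Suc k)"

primrec legal :: "nat list \<Rightarrow> 'i word \<Rightarrow> bool" where
  "legal [] X \<longleftrightarrow> True"
| "legal (m # w) X \<longleftrightarrow> legal_step m (sws w X) \<and> legal w X"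

lemma gen_illegal:
  assumes "m < length X" "X \<in> words Q" "\<not> legal_step m X"
  shows "null oKLRW (gen m X :: ('i, 'k::field) mor)"
proof (cases m)
  case 0
  obtain l Y where X: "X = l # Y" using assms by (cases X) auto
  then obtain \<theta> where l: "l = Red \<theta>" using assms 0 by (cases l) auto
  have "null oKLRW (lrho l :: ('i, 'k) mor)" using assms l X by (auto intro: null_Zero)
  then show ?thesis unfolding 0 X using assms X by (auto intro: null_tens_left)
next
  case (Suc k)
  obtain a l l' b where X: "X = a @ l # l' # b" "k = length a"
    by (rule split_at2[of k X]) (use assms Suc in simp, blast)
  obtain \<theta> \<eta> where l: "l = Red \<theta>" "l' = Red \<eta>"
    using assms(3) X Suc by (cases l; cases l') (auto simp: nth_append)
  have "null KLRW (cross l l' :: ('i, 'k) mor)" using assms l X by (auto intro: null_Zero)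
  then show ?thesis unfolding Suc X using assms X by (simp add: gen_append null_wh)
qed

lemma path_illegal:
  "X \<in> words Q \<Longrightarrow> set w \<subseteq> {..<length X} \<Longrightarrow> \<not> legal w X \<Longrightarrow> null oKLRW (path w X :: ('i, 'k::field) mor)"
proof (induction w)
  case (Cons m w)
  show ?case
  proof (cases "legal w X")
    case True
    then have "null oKLRW (gen m (sws w X) :: ('i, 'k) mor)" using Cons.prems by (intro gen_illegal) auto
    then show ?thesis using Cons.prems by (auto intro: null_comp_left)
  next
    case False
    then have "null oKLRW (path w X :: ('i, 'k) mor)" using Cons by simp
    then show ?thesis using Cons.prems by (auto intro: null_comp_right)
  qed
qed simp


section \<open>Spanning\<close>

definition basis :: "'i word \<Rightarrow> 'i word \<Rightarrow> (nat list \<times> (nat \<Rightarrow>\<^sub>0 nat)) set" where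
  "basis X Y = {(w, m). w \<in> nf (length X) \<and> legal w X \<and> sws w X = Y \<and> Poly_Mapping.keys m \<subseteq> {1..nblack X}}"

definition diagram :: "'i word \<Rightarrow> nat list \<times> (nat \<Rightarrow>\<^sub>0 nat) \<Rightarrow> ('i, 'k::field) mor" where
  "diagram X = (\<lambda>(w, m). path w X \<cdot> dotmonom 1 X m)"

inductive spanned :: "'i word \<Rightarrow> 'i word \<Rightarrow> nat \<Rightarrow> ('i, 'k::field) mor \<Rightarrow> bool"
  for X Y :: "'i word" and n :: nat where
  spanned_Zero: "spanned X Y n (Zero X Y)"
| spanned_diagram: "b \<in> basis X Y \<Longrightarrow> length (fst b) \<le> n \<Longrightarrow> spanned X Y n (diagram X b)"
| spanned_add: "spanned X Y n f \<Longrightarrow> spanned X Y n g \<Longrightarrow> spanned X Y n (f \<oplus> g)"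
| spanned_scale: "spanned X Y n f \<Longrightarrow> spanned X Y n (c \<odot> f)"
| spanned_eqv: "spanned X Y n f \<Longrightarrow> f \<approx> g \<Longrightarrow> spanned X Y n g"

lemma spanned_eqv': "spanned X Y n g \<Longrightarrow> f \<approx> g \<Longrightarrow> spanned X Y n f"
  by (blast intro: spanned.spanned_eqv meq_sym)

lemma spanned_mono: "spanned X Y n f \<Longrightarrow> n \<le> n' \<Longrightarrow> spanned X Y n' f"
proof (induction rule: spanned.induct)
  case (spanned_eqv f g)
  then show ?case by (blast intro: spanned.spanned_eqv)
qed (auto intro: spanned.intros(1-4))

lemma diagram_typing [simp]:
  assumes "b \<in> basis X Y" "X \<in> words Q"
  shows "src (diagram X b) = X" "tgt \<tau> (diagram X b) = Y" "mor_in Q \<tau> oKLRW (diagram X b)"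
  using assms set_nf[of "fst b" "length X"] by (auto simp: basis_def diagram_def)

lemma spanned_typing:
  assumes "spanned X Y n f" "X \<in> words Q" "Y \<in> words Q"
  shows "src f = X" "tgt \<tau> f = Y" "mor_in Q \<tau> oKLRW f"
proof -
  have "src f = X \<and> tgt \<tau> f = Y \<and> mor_in Q \<tau> oKLRW f"
    using assms
  proof (induction rule: spanned.induct)
    case (spanned_eqv f g)
    then show ?case using mor_eq_typing[OF spanned_eqv.hyps(2)] by auto
  qed auto
  then show "src f = X" "tgt \<tau> f = Y" "mor_in Q \<tau> oKLRW f" by auto
qed

lemma spanned_null:
  "null oKLRW f \<Longrightarrow> src f = X \<Longrightarrow> tgt \<tau> f = Y \<Longrightarrow> spanned X Y n f"
  unfolding null_def by (rule spanned_eqv'[OF spanned_Zero]) simp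

lemma spanned_path:
  assumes "X \<in> words Q" "w \<in> nf (length X)" "sws w X = Y" "length w \<le> n" "Poly_Mapping.keys m \<subseteq> {1..nblack X}"
  shows "spanned X Y n (path w X \<cdot> dotmonom 1 X m)"
proof (cases "legal w X")
  case True
  then have "(w, m) \<in> basis X Y" using assms by (simp add: basis_def)
  from spanned_diagram[OF this, of n] show ?thesis using assms by (simp add: diagram_def)
next
  case False
  have w: "set w \<subseteq> {..<length X}" by (rule set_nf) fact
  have "null oKLRW (path w X \<cdot> dotmonom 1 X m)"
    using assms w by (intro null_comp_left path_illegal False) simp_all
  then show ?thesis by (rule spanned_null) (use assms w in simp_all)
qed

text \<open>By \<open>nf_step\<close> the extended word is braid equivalent to a normal form, whose
  diagram is spanned directly, or to a word with a square. The error of the braid moves in the first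
  case and the whole diagram in the second have degree at most n and are covered by
  \<open>IH\<close>.\<close>

lemma spanned_gen_path:
  fixes X Y :: "'i word"
  assumes X: "X \<in> words Q" and w: "w \<in> nf (length X)" "sws w X = Y" "length w \<le> n"
    and mm: "Poly_Mapping.keys mm \<subseteq> {1..nblack X}" and m: "m < length X"
    and IH: "\<And>g :: ('i, 'k::field) mor. filt n g \<Longrightarrow> spanned (src g) (tgt \<tau> g) n g"
  shows "spanned X (sw m Y) (Suc n) (gen m Y \<cdot> path w X \<cdot> (dotmonom 1 X mm :: ('i, 'k) mor))"
proof -
  let ?D = "dotmonom 1 X mm :: ('i, 'k) mor"
  have sw: "set w \<subseteq> {..<length X}" by (rule set_nf) fact
  have Y: "Y \<in> words Q" "length Y = length X" using w sw X by auto
  have D: "filt 0 ?D" using filt_ncross[of ?D] X by simp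
  have e: "gen m Y \<cdot> path w X \<cdot> ?D \<approx> path (m # w) X \<cdot> ?D"
    using X Y w sw m by (auto intro!: meq_sym[OF meq_comp_assoc])
  have low: "spanned X (sw m Y) (Suc n) (h \<cdot> ?D)"
    if "filt (length w) h" "src h = X" "tgt \<tau> h = sw m Y" for h
  proof -
    have "filt (length w + 0) (h \<cdot> ?D)" by (rule filt_comp[OF that(1) D]) (simp add: that X)
    then have "filt n (h \<cdot> ?D)" using w by (auto intro: filt_mono)
    from IH[OF this] have "spanned X (sw m Y) n (h \<cdot> ?D)" by (simp add: that)
    then show ?thesis by (rule spanned_mono) simp
  qed
  from nf_step[OF w(1) m] have "spanned X (sw m Y) (Suc n) (path (m # w) X \<cdot> ?D)"
  proof
    assume "\<exists>a\<in>nf (length X). braid (m # w) a"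
    then obtain a where a: "a \<in> nf (length X)" "braid (m # w) a" by blast
    have sa: "sws a X = sw m Y" using path_braid(1)[OF a(2) X] sw m w by simp
    have c: "cong (length w) (path (m # w) X) (path a X :: ('i, 'k) mor)"
      using sw m by (intro path_braid(2)[OF a(2) X]) auto
    then obtain h where h: "filt (length w) h" "path (m # w) X \<approx> path a X \<oplus> (h :: ('i, 'k) mor)"
      unfolding cong_def by blast
    have set_a: "set a \<subseteq> {..<length X}" using set_nf[OF a(1)] .
    have t: "src h = X" "tgt \<tau> h = sw m Y" "mor_in Q \<tau> oKLRW h" using mor_eq_typing[OF h(2)] set_a X sa by auto
    have "path (m # w) X \<cdot> ?D \<approx> (path a X \<oplus> h) \<cdot> ?D"
      using h(2) X sw m by (intro eqv_comp_left) auto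
    also have "\<dots> \<approx> path a X \<cdot> ?D \<oplus> h \<cdot> ?D"
      using t X sw set_a sa by (intro meq_comp_add_left) auto
    finally have e': "path (m # w) X \<cdot> ?D \<approx> path a X \<cdot> ?D \<oplus> h \<cdot> ?D" .
    have "length a = Suc (length w)" using braid_length[OF a(2)] by simp
    then have "spanned X (sw m Y) (Suc n) (path a X \<cdot> ?D)"
      using a w sa X mm by (intro spanned_path) auto
    from spanned_add[OF this low[OF h(1) t(1,2)]] e' show ?thesis by (rule spanned_eqv')
  next
    assume "reducible (m # w)"
    then obtain a s b where a: "braid (m # w) (a @ s # s # b)" unfolding reducible_def by blast
    have set: "set (a @ s # s # b) \<subseteq> {..<length X}" using braid_set[OF a] sw m by auto
    have l: "length a + length b \<le> length w" using braid_length[OF a] by simp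
    have "cong (length w) (path (m # w) X) (path (a @ s # s # b) X :: ('i, 'k) mor)"
      using sw m by (intro path_braid(2)[OF a X]) auto
    then have "filt (length w) (path (m # w) X :: ('i, 'k) mor)"
      by (rule cong_filt) (rule filt_mono[OF path_repeat(2)[OF X set] l])
    then show ?thesis by (rule low) (use X Y sw m w in simp_all)
  qed
  then show ?thesis using e by (rule spanned_eqv')
qed

lemma spanned_comp:
  fixes f g :: "('i, 'k::field) mor"
  assumes "spanned X Y n f" "X \<in> words Q" "Y \<in> words Q" and g: "mor_in Q \<tau> oKLRW g" "src g = Y"
    and diagram: "\<And>b. b \<in> basis X Y \<Longrightarrow> length (fst b) \<le> n \<Longrightarrow> spanned X (tgt \<tau> g) n' (g \<cdot> diagram X b)"
  shows "spanned X (tgt \<tau> g) n' (g \<cdot> f)"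
  using assms(1)
proof (induction rule: spanned.induct)
  case spanned_Zero
  have "null oKLRW (g \<cdot> (Zero X Y :: ('i, 'k) mor))"
    using assms by (intro null_comp_right null_Zero) auto
  then show ?case by (rule spanned_null) simp_all
next
  case (spanned_diagram b)
  then show ?case by (rule diagram)
next
  case (spanned_add f f')
  have "g \<cdot> (f \<oplus> f') \<approx> g \<cdot> f \<oplus> g \<cdot> f'"
    using spanned_typing[OF spanned_add.hyps(1)] spanned_typing[OF spanned_add.hyps(2)] assms
    by (intro meq_comp_add_right) auto
  then show ?case using spanned_eqv'[OF spanned.spanned_add[OF spanned_add.IH]] by blast
next
  case (spanned_scale f c)
  have "g \<cdot> (c \<odot> f) \<approx> c \<odot> (g \<cdot> f)"
    using spanned_typing[OF spanned_scale.hyps(1)] assms by (intro meq_comp_scale_right) auto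
  then show ?case using spanned_eqv'[OF spanned.spanned_scale[OF spanned_scale.IH]] by blast
next
  case (spanned_eqv f f')
  have "g \<cdot> f \<approx> g \<cdot> f'"
    using spanned_typing[OF spanned_eqv.hyps(1)] spanned_eqv.hyps assms by (intro eqv_comp_right) auto
  then show ?case by (rule spanned.spanned_eqv[OF spanned_eqv.IH])
qed

lemma spanned_gen:
  fixes f :: "('i, 'k::field) mor"
  assumes "spanned X Y n f" and X: "X \<in> words Q" "Y \<in> words Q" and m: "m < length Y"
    and IH: "\<And>g :: ('i, 'k) mor. filt n g \<Longrightarrow> spanned (src g) (tgt \<tau> g) n g"
  shows "spanned X (sw m Y) (Suc n) (gen m Y \<cdot> f)"
proof -
  have "spanned X (tgt \<tau> (gen m Y :: ('i, 'k) mor)) (Suc n) (gen m Y \<cdot> f)"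
  proof (rule spanned_comp[OF assms(1) X])
    fix b assume *: "b \<in> basis X Y" "length (fst b) \<le> n"
    obtain w mm where b: "b = (w, mm)" by (cases b)
    then have w: "w \<in> nf (length X)" "sws w X = Y" "length w \<le> n" "Poly_Mapping.keys mm \<subseteq> {1..nblack X}"
      using * by (auto simp: basis_def)
    then have "length Y = length X" using set_nf[OF w(1)] by auto
    then show "spanned X (tgt \<tau> (gen m Y :: ('i, 'k) mor)) (Suc n) (gen m Y \<cdot> (diagram X b :: ('i, 'k) mor))"
      using spanned_gen_path[OF X(1) w(1-4) _ IH, of m] X m by (simp add: diagram_def b)
  qed (use X m in simp_all)
  then show ?thesis using X m by simp
qed

lemma ldot_red: "letter_ok l \<Longrightarrow> \<not> is_black l \<Longrightarrow> null C (ldot l)"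
  by (cases l) (auto intro: null_Zero)

text \<open>A dot at the bottom raises an exponent of the monomial if its strand is black; on a red
  strand it is zero by convention.\<close>

lemma spanned_path_dot:
  assumes X: "X \<in> words Q" and w: "w \<in> nf (length X)" "sws w X = Y" "length w \<le> n"
    and m: "Poly_Mapping.keys m \<subseteq> {1..nblack X}" and p: "p < length X"
  shows "spanned X Y n (path w X \<cdot> dot p X \<cdot> (dotmonom 1 X m :: ('i, 'k::field) mor))"
proof -
  have sw: "set w \<subseteq> {..<length X}" by (rule set_nf) fact
  obtain a l b where eq: "X = a @ l # b" "p = length a"
    by (rule split_at[of p X]) (use p in simp, blast)
  show ?thesis
  proof (cases "is_black (X ! p)")
    case True
    let ?m = "m + Poly_Mapping.single (1 + nblack (take p X)) 1"
    have "nblack (take p X) < nblack X" using True unfolding eq by (cases l) (auto simp: nth_append)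
    then have "Poly_Mapping.keys ?m \<subseteq> {1..nblack X}" using m keys_add[of m "Poly_Mapping.single (1 + nblack (take p X)) 1"] by auto
    then have "spanned X Y n (path w X \<cdot> (dotmonom 1 X ?m :: ('i, 'k) mor))"
      using assms by (intro spanned_path) auto
    moreover have "path w X \<cdot> dot p X \<cdot> (dotmonom 1 X m :: ('i, 'k) mor) \<approx> path w X \<cdot> (dotmonom 1 X ?m :: ('i, 'k) mor)"
      using X p sw True by (intro eqv_comp_right dot_dotmonom) auto
    ultimately show ?thesis by (rule spanned_eqv')
  next
    case False
    then have "null oKLRW (dot p X :: ('i, 'k) mor)"
      using X unfolding eq dot_append by (intro null_wh ldot_red) (auto simp: nth_append)
    then have "null oKLRW (path w X \<cdot> dot p X \<cdot> (dotmonom 1 X m :: ('i, 'k) mor))"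
      using X p sw by (intro null_comp_right null_comp_left) auto
    then show ?thesis by (rule spanned_null) (use X w sw in simp_all)
  qed
qed

text \<open>A dot on top slides down through the path and is absorbed by the monomial at the bottom.
  The errors made on the way have strictly smaller degree and are covered by
  \<open>IH\<close>.\<close>

lemma spanned_dot_path:
  fixes X Y :: "'i word"
  assumes X: "X \<in> words Q" and w: "w \<in> nf (length X)" "sws w X = Y" "length w \<le> n"
    and m: "Poly_Mapping.keys m \<subseteq> {1..nblack X}" and p: "p < length X"
    and IH: "\<And>n' g :: ('i, 'k::field) mor. n' < n \<Longrightarrow> filt n' g \<Longrightarrow> spanned (src g) (tgt \<tau> g) n' g"
  shows "spanned X Y n (dot p Y \<cdot> path w X \<cdot> (dotmonom 1 X m :: ('i, 'k) mor))"
proof -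
  let ?D = "dotmonom 1 X m :: ('i, 'k) mor"
  have sw: "set w \<subseteq> {..<length X}" by (rule set_nf) fact
  have D: "filt 0 ?D" using filt_ncross[of ?D] X by simp
  have Y: "Y \<in> words Q" "length Y = length X" using w sw X by auto
  show ?thesis
  proof (cases w)
    case Nil
    have "dot p X \<cdot> Ident X \<cdot> ?D \<approx> dot p X \<cdot> ?D"
      using X p meq_comp_id_left[of Q \<tau> oKLRW ?D] by (intro eqv_comp_right) auto
    also have "\<dots> \<approx> Ident X \<cdot> dot p X \<cdot> ?D"
      using X p meq_sym[OF meq_comp_id_left[of Q \<tau> oKLRW "dot p X \<cdot> ?D"]] by simp
    finally have "dot p Y \<cdot> path w X \<cdot> ?D \<approx> path w X \<cdot> dot p X \<cdot> ?D" using w Nil by simp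
    then show ?thesis using spanned_eqv'[OF spanned_path_dot[OF X w m p]] by blast
  next
    \<comment> \<open>\<open>length w'\<close> is the largest degree below the length of
      \<open>w\<close>, and the errors of the sliding dot lie there. For empty \<open>w\<close> no
      such degree exists, but there the dot passes without error.\<close>
    case (Cons k w')
    then have l: "length w \<le> Suc (length w')" "length w' < n" using w by auto
    obtain p' c where p': "p' < length X" "cong (length w') (dot p Y \<cdot> path w X) (c \<odot> (path w X \<cdot> (dot p' X :: ('i, 'k) mor)))"
      using dot_path[OF sw p X l(1), unfolded w(2)] by blast
    then obtain h where h: "filt (length w') h" "dot p Y \<cdot> path w X \<approx> c \<odot> (path w X \<cdot> (dot p' X :: ('i, 'k) mor)) \<oplus> h"
      unfolding cong_def by blast
    have t: "src h = X" "tgt \<tau> h = Y" "mor_in Q \<tau> oKLRW h" using mor_eq_typing[OF h(2)] sw X w p' by auto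
    have "(c \<odot> (path w X \<cdot> dot p' X)) \<cdot> ?D \<approx> c \<odot> ((path w X \<cdot> dot p' X) \<cdot> ?D)"
      using X sw p'(1) by (intro meq_comp_scale_left) auto
    also have "\<dots> \<approx> c \<odot> (path w X \<cdot> dot p' X \<cdot> ?D)"
      using X sw p'(1) by (intro meq_scale_cong meq_comp_assoc) auto
    finally have scale: "(c \<odot> (path w X \<cdot> dot p' X)) \<cdot> ?D \<approx> c \<odot> (path w X \<cdot> dot p' X \<cdot> ?D)" .
    have hD: "h \<cdot> ?D \<approx> h \<cdot> ?D" using t X by (intro meq_refl) simp
    have "dot p Y \<cdot> path w X \<cdot> ?D \<approx> (dot p Y \<cdot> path w X) \<cdot> ?D"
      using X Y p sw w by (intro meq_sym[OF meq_comp_assoc]) auto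
    also have "\<dots> \<approx> (c \<odot> (path w X \<cdot> dot p' X) \<oplus> h) \<cdot> ?D"
      using h(2) X sw by (intro eqv_comp_left) auto
    also have "\<dots> \<approx> (c \<odot> (path w X \<cdot> dot p' X)) \<cdot> ?D \<oplus> h \<cdot> ?D"
      using t X sw w p' by (intro meq_comp_add_left) auto
    also have "\<dots> \<approx> c \<odot> (path w X \<cdot> dot p' X \<cdot> ?D) \<oplus> h \<cdot> ?D"
      using t X sw w(2) by (intro meq_add_cong[OF scale hD]) simp_all
    finally have e: "dot p Y \<cdot> path w X \<cdot> ?D \<approx> c \<odot> (path w X \<cdot> dot p' X \<cdot> ?D) \<oplus> h \<cdot> ?D" .
    have "filt (length w' + 0) (h \<cdot> ?D)" by (rule filt_comp[OF h(1) D]) (simp add: t X)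
    then have "spanned X Y (length w') (h \<cdot> ?D)" using IH[of "length w'" "h \<cdot> ?D"] l(2) t X by simp
    then have "spanned X Y n (h \<cdot> ?D)" by (rule spanned_mono) (use l(2) in simp)
    from spanned_add[OF spanned_scale[OF spanned_path_dot[OF X w m p'(1)]] this] e
    show ?thesis by (rule spanned_eqv')
  qed
qed

lemma spanned_dot:
  fixes f :: "('i, 'k::field) mor"
  assumes "spanned X Y n f" and X: "X \<in> words Q" "Y \<in> words Q" and p: "p < length Y"
    and IH: "\<And>n' g :: ('i, 'k) mor. n' < n \<Longrightarrow> filt n' g \<Longrightarrow> spanned (src g) (tgt \<tau> g) n' g"
  shows "spanned X Y n (dot p Y \<cdot> f)"
proof -
  have "spanned X (tgt \<tau> (dot p Y :: ('i, 'k) mor)) n (dot p Y \<cdot> f)"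
  proof (rule spanned_comp[OF assms(1) X])
    fix b assume *: "b \<in> basis X Y" "length (fst b) \<le> n"
    obtain w mm where b: "b = (w, mm)" by (cases b)
    then have w: "w \<in> nf (length X)" "sws w X = Y" "length w \<le> n" "Poly_Mapping.keys mm \<subseteq> {1..nblack X}"
      using * by (auto simp: basis_def)
    then have "length Y = length X" using set_nf[OF w(1)] by auto
    then show "spanned X (tgt \<tau> (dot p Y :: ('i, 'k) mor)) n (dot p Y \<cdot> (diagram X b :: ('i, 'k) mor))"
      using spanned_dot_path[OF X(1) w(1-4) _ IH, of p] X p by (simp add: diagram_def b)
  qed (use X p in simp_all)
  then show ?thesis using X p by simp
qed

text \<open>Two nested inductions, on the degree and on the construction of the morphism within it.
  A new generator takes degree n to n + 1 and has errors of degree n; a new dot keeps degree n and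
  has errors below n. Both kinds are covered by the outer hypothesis.\<close>

theorem filt_spanned:
  fixes f :: "('i, 'k::field) mor"
  shows "filt n f \<Longrightarrow> spanned (src f) (tgt \<tau> f) n f"
proof (induction n arbitrary: f rule: less_induct)
  case (less n)
  from less.prems less.IH show ?case
  proof (induction rule: filt.induct)
    case (filt_Zero v w n)
    then show ?case by (simp add: spanned_Zero)
  next
    case (filt_Ident w n)
    have "(Ident w :: ('i, 'k) mor) \<approx> Ident w \<cdot> Ident w"
      using filt_Ident meq_sym[OF meq_comp_id_left[of Q \<tau> oKLRW "Ident w"]] by simp
    also have "\<dots> \<approx> path [] w \<cdot> dotmonom 1 w 0"
      using filt_Ident by (auto intro!: eqv_comp_right meq_sym[OF dotmonom_0])
    finally have "(Ident w :: ('i, 'k) mor) \<approx> path [] w \<cdot> dotmonom 1 w 0" .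
    moreover have "spanned w w n (path [] w \<cdot> (dotmonom 1 w 0 :: ('i, 'k) mor))"
      using filt_Ident by (intro spanned_path Nil_in_nf) auto
    ultimately show ?case using spanned_eqv' by fastforce
  next
    case (filt_gen n f m)
    have f: "mor_in Q \<tau> oKLRW f" using filt_gen filt_mor_in by blast
    have IH: "\<And>g :: ('i, 'k) mor. filt n g \<Longrightarrow> spanned (src g) (tgt \<tau> g) n g"
      using filt_gen.prems by blast
    have "spanned (src f) (sw m (tgt \<tau> f)) (Suc n) (gen m (tgt \<tau> f) \<cdot> f)"
      using mor_in_words[OF f] filt_gen by (intro spanned_gen IH) auto
    then show ?case using mor_in_words[OF f] filt_gen by simp
  next
    case (filt_dot n f p)
    have f: "mor_in Q \<tau> oKLRW f" using filt_dot filt_mor_in by blast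
    have "spanned (src f) (tgt \<tau> f) n (dot p (tgt \<tau> f) \<cdot> f)"
      using mor_in_words[OF f] filt_dot by (intro spanned_dot) auto
    then show ?case using mor_in_words[OF f] filt_dot by simp
  next
    case (filt_add n f g)
    then show ?case using spanned_add[of "src f" "tgt \<tau> f" n f g] by simp
  next
    case (filt_scale n f c)
    then show ?case using spanned_scale[of "src f" "tgt \<tau> f" n f c] by simp
  next
    case (filt_eqv n f g)
    then have "spanned (src f) (tgt \<tau> f) n f" by blast
    then show ?case using filt_eqv.hyps(2) mor_eq_typing[OF filt_eqv.hyps(2)] spanned.spanned_eqv by metis
  qed
qed


section \<open>Triangularity of the action\<close>

text \<open>The leading part of the operator of a generator: exchange of two variables, or sign
  change of the first. A crossing with a red letter moves no black strand past another, hence the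
  identity.\<close>

fun tstep :: "nat \<Rightarrow> 'i word \<Rightarrow> 'k::field mpoly \<Rightarrow> 'k mpoly" where
  "tstep 0 X = (if is_black (hd X) then neg1 else (\<lambda>p. p))"
| "tstep (Suc k) X =
    (if is_black (X ! k) \<and> is_black (X ! Suc k) then swap (Suc (nblack (take k X))) else (\<lambda>p. p))"

primrec twist :: "nat list \<Rightarrow> 'i word \<Rightarrow> 'k::field mpoly \<Rightarrow> 'k mpoly" where
  "twist [] X p = p"
| "twist (m # w) X p = tstep m (sws w X) (twist w X p)"

lemma tstep_simps [simp]:
  "tstep m X (p + q) = tstep m X p + tstep m X q" "tstep m X (p * q) = tstep m X p * tstep m X q"
  "tstep m X (p - q) = tstep m X p - tstep m X q" "tstep m X (- p) = - tstep m X p"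
  "tstep m X 0 = 0" "tstep m X 1 = 1" "tstep m X (tstep m X p) = p"
  by (cases m; simp)+

lemma tstep_eq_0 [simp]: "tstep m X p = 0 \<longleftrightarrow> p = 0"
  by (metis tstep_simps(5,7))

lemma tstep_sum [simp]: "tstep m X (sum f A) = (\<Sum>a\<in>A. tstep m X (f a))"
  by (induction A rule: infinite_finite_induct) simp_all

lemma twist_simps [simp]:
  "twist w X (p + q) = twist w X p + twist w X q" "twist w X (p * q) = twist w X p * twist w X q"
  "twist w X (p - q) = twist w X p - twist w X q" "twist w X 1 = 1" "twist w X (- p) = - twist w X p"
  "twist w X p = 0 \<longleftrightarrow> p = 0"
  by (induction w) simp_all

lemma twist_append: "twist (v @ w) X p = twist v (sws w X) (twist w X p)"
  by (induction v) simp_all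

lemma legal_append: "legal (v @ w) X \<longleftrightarrow> legal v (sws w X) \<and> legal w X"
  by (induction v) auto

lemma is_black_flip [simp]: "is_black (flip l) = is_black l"
  by (cases l) auto

lemma nblack_Cons: "nblack (l # w) = (if is_black l then Suc (nblack w) else nblack w)"
  by (cases l) auto

lemma tstep_append:
  "tstep (Suc (length a)) (a @ l # l' # b) =
    (if is_black l \<and> is_black l' then swap (Suc (nblack a)) else (\<lambda>p. p))"
  "legal_step (Suc (length a)) (a @ l # l' # b) \<longleftrightarrow> is_black l \<or> is_black l'"
  by (auto simp: nth_append)

text \<open>For black letters these are the braid relations of the exchanges and of the sign change
  of variables. If red letters take part, some steps become trivial on both sides alike; a distant
  step does not alter the number of black letters in front of a crossing.\<close>

lemma braid_invariants:
  assumes "braid v w" "X \<in> words Q" "set v \<subseteq> {..<length X}"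
  shows "legal v X = legal w X \<and> (\<forall>p. twist v X p = (twist w X p :: 'k::field mpoly))"
  using assms
proof (induction arbitrary: X rule: braid.induct)
  case (braid_far i j)
  obtain k where j: "j = Suc k" using braid_far by (cases j) auto
  show ?case
  proof (cases i)
    case 0
    obtain l Y where X: "X = l # Y" using braid_far by (cases X) auto
    obtain c m m' b where Y: "Y = c @ m # m' # b" "k - 1 = length c"
      by (rule split_at2[of "k - 1" Y]) (use braid_far j 0 X in simp, blast)
    have k: "k = length (l # c)" using Y braid_far 0 j by simp
    have s: "sw (Suc k) (v # c @ m # m' # b) = v # c @ m' # m # b"
      "tstep (Suc k) (v # c @ m # m' # b) = (if is_black m \<and> is_black m' then swap (Suc (nblack (v # c))) else (\<lambda>p. p :: 'k mpoly))"
      "legal_step (Suc k) (v # c @ m # m' # b) \<longleftrightarrow> is_black m \<or> is_black m'" for v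
      using sw_append[of "v # c" m m' b] tstep_append[of "v # c" m m' b] k
      by (simp_all del: tstep.simps legal_step.simps)
    show ?thesis unfolding 0 j X Y
      by (auto simp: s nblack_Cons swap_neg1_commute simp del: tstep.simps(2) legal_step.simps(2))
  next
    case (Suc i')
    obtain a l l' d where X: "X = a @ l # l' # d" "i' = length a"
      by (rule split_at2[of i' X]) (use braid_far j Suc in simp, blast)
    obtain c m m' b where d: "d = c @ m # m' # b" "k - i' - 2 = length c"
      by (rule split_at2[of "k - i' - 2" d]) (use braid_far j Suc X in simp, blast)
    have k: "k = length (a @ u # u' # c)" for u u' using d X braid_far Suc j by simp
    have s: "sw (Suc k) (a @ u # u' # c @ m # m' # b) = a @ u # u' # c @ m' # m # b"
      "tstep (Suc k) (a @ u # u' # c @ m # m' # b) = (if is_black m \<and> is_black m' then swap (Suc (nblack (a @ u # u' # c))) else (\<lambda>p. p :: 'k mpoly))"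
      "legal_step (Suc k) (a @ u # u' # c @ m # m' # b) \<longleftrightarrow> is_black m \<or> is_black m'" for u u'
      using sw_append[of "a @ u # u' # c" m m' b] tstep_append[of "a @ u # u' # c" m m' b] k[of u u']
      by (simp_all del: tstep.simps legal_step.simps)
    show ?thesis unfolding Suc j X d
      by (auto simp: s tstep_append nblack_Cons
        swap_swap_commute[of "Suc (nblack a)" "Suc (Suc (Suc (nblack a + nblack c)))"] simp del: tstep.simps legal_step.simps)
  qed
next
  case (braid_three i)
  obtain k where i: "i = Suc k" using braid_three by (cases i) auto
  obtain a l m d where X: "X = a @ l # m # d" "k = length a"
    by (rule split_at2[of k X]) (use braid_three i in simp, blast)
  obtain r b where d: "d = r # b" using X braid_three i by (cases d) auto
  have s: "sw (Suc (Suc k)) (a @ u # v # w # b) = a @ u # w # v # b"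
    "tstep (Suc (Suc k)) (a @ u # v # w # b) = (if is_black v \<and> is_black w then swap (Suc (nblack (a @ [u]))) else (\<lambda>p. p :: 'k mpoly))"
    "legal_step (Suc (Suc k)) (a @ u # v # w # b) \<longleftrightarrow> is_black v \<or> is_black w" for u v w
    using sw_append[of "a @ [u]" v w b] tstep_append[of "a @ [u]" v w b] X
    by (simp_all del: tstep.simps legal_step.simps)
  have s': "sw (Suc k) (a @ u # v # w # b) = a @ v # u # w # b"
    "tstep (Suc k) (a @ u # v # w # b) = (if is_black u \<and> is_black v then swap (Suc (nblack a)) else (\<lambda>p. p :: 'k mpoly))"
    "legal_step (Suc k) (a @ u # v # w # b) \<longleftrightarrow> is_black u \<or> is_black v" for u v w
    using sw_append[of a u v "w # b"] tstep_append[of a u v "w # b"] X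
    by (simp_all del: tstep.simps legal_step.simps)
  show ?case unfolding i X(1) d
    by (auto simp: s s' nblack_Cons swap_braid simp del: tstep.simps legal_step.simps)
next
  case braid_four
  obtain l Y where X1: "X = l # Y" using braid_four by (cases X) auto
  obtain m b where X: "X = l # m # b" using braid_four X1 by (cases Y) auto
  have s: "sw (Suc 0) (u # v # b) = v # u # b" for u v
    using sw_append[of "[]" u v b] by simp
  show ?case unfolding X by (auto simp: s swap_neg1_braid[unfolded One_nat_def])
next
  case (braid_sym v w)
  have "set v = set w" using braid_set braid_sym by blast
  then show ?case using braid_sym by auto
next
  case (braid_trans u v w)
  have "set u = set v" using braid_set braid_trans by blast
  then show ?case using braid_trans.IH(1)[of X] braid_trans.IH(2)[of X] braid_trans.prems by auto
next
  case (braid_context v w a b)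
  have "sws v (sws b X) = sws w (sws b X)"
    using path_braid(1)[OF braid_context.hyps(1), of "sws b X"] braid_context.prems by auto
  then show ?case using braid_context.IH[of "sws b X"] braid_context.prems
    by (auto simp: twist_append legal_append)
qed simp

text \<open>The exchange preserves how many of the two letters are black and the number of black
  letters before them. Hence two equal successive steps are the same involution applied
  twice.\<close>

lemma tstep_sw:
  assumes "m < length X"
  shows "tstep m (sw m X) = (tstep m X :: 'k::field mpoly \<Rightarrow> _)"
proof (cases m)
  case 0
  then show ?thesis using assms by (cases X) auto
next
  case (Suc k)
  obtain a l l' b where X: "X = a @ l # l' # b" "k = length a"
    by (rule split_at2[of k X]) (use assms Suc in simp, blast)
  show ?thesis unfolding Suc X sw_append tstep_append by auto
qed

definition nf_between :: "'i word \<Rightarrow> 'i word \<Rightarrow> nat list set" where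
  "nf_between X Y = {w \<in> nf (length X). legal w X \<and> sws w X = Y}"

lemma finite_nf_between: "finite (nf_between X Y)"
  by (rule finite_subset[OF _ finite_nf[of "length X"]]) (auto simp: nf_between_def)

text \<open>For automorphisms a repeated step cancels exactly. A word with a square is thus
  shortened, with the same target, automorphism and legality, until it is braid equivalent to a
  normal form.\<close>

lemma nf_between_twist:
  assumes "X \<in> words Q" "set w \<subseteq> {..<length X}" "legal w X"
  shows "\<exists>a \<in> nf_between X (sws w X). length a \<le> length w \<and> (\<forall>p. twist a X p = (twist w X p :: 'k::field mpoly))"
  using assms(2,3)
proof (induction w rule: length_induct)
  case (1 w)
  from nf_or_reducible[OF 1(2)] show ?case
  proof
    assume "\<exists>a\<in>nf (length X). braid w a"
    then obtain a where a: "a \<in> nf (length X)" "braid w a" by blast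
    show ?thesis
      using a braid_invariants[OF a(2) assms(1) 1(2), where 'k = 'k] 1(3)
        path_braid(1)[OF a(2) assms(1) 1(2)] braid_length[OF a(2)]
      by (intro bexI[of _ a]) (auto simp: nf_between_def)
  next
    assume "reducible w"
    then obtain a s b where a: "braid w (a @ s # s # b)" unfolding reducible_def by blast
    have set: "set (a @ s # s # b) \<subseteq> {..<length X}" using braid_set[OF a] 1(2) by auto
    have inv: "legal (a @ s # s # b) X" "twist w X p = (twist (a @ s # s # b) X p :: 'k mpoly)" for p
      using braid_invariants[OF a assms(1) 1(2), where 'k = 'k] 1(3) by auto
    have sws: "sws w X = sws (a @ b) X"
      using path_braid(1)[OF a assms(1) 1(2)] path_repeat(1)[OF assms(1) set] by simp
    have ss: "sw s (sw s (sws b X)) = sws b X" using set assms(1) by (intro sw_sw) auto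
    then have leg: "legal (a @ b) X" using inv(1) by (simp add: legal_append)
    have "twist (a @ s # s # b) X p = (twist (a @ b) X p :: 'k mpoly)" for p
      using ss set by (simp add: twist_append tstep_sw)
    then have tw: "twist w X p = (twist (a @ b) X p :: 'k mpoly)" for p using inv(2) by simp
    have len: "length (a @ b) < length w" using braid_length[OF a] by simp
    have "\<exists>c \<in> nf_between X (sws (a @ b) X). length c \<le> length (a @ b) \<and> (\<forall>p. twist c X p = (twist (a @ b) X p :: 'k mpoly))"
      using 1(1)[rule_format, of "a @ b"] len set leg by simp
    then obtain c where c: "c \<in> nf_between X (sws w X)" "length c \<le> length (a @ b)"
      "\<And>p. twist c X p = (twist (a @ b) X p :: 'k mpoly)" unfolding sws by blast
    then show ?thesis using len by (intro bexI[of _ c]) (simp_all add: tw del: length_append)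
  qed
qed

text \<open>The span, with polynomial coefficients on the left, of the automorphisms of legal normal
  forms from X to Y. The length bound is strict because the error terms of a word of length n are
  described this way.\<close>

definition twisted :: "'i word \<Rightarrow> 'i word \<Rightarrow> nat \<Rightarrow> ('k::field mpoly \<Rightarrow> 'k mpoly) \<Rightarrow> bool" where
  "twisted X Y n T \<longleftrightarrow> (\<exists>r. (\<forall>u. n \<le> length u \<longrightarrow> r u = 0) \<and>
     (\<forall>p. T p = (\<Sum>u \<in> nf_between X Y. r u * twist u X p)))"

lemma twisted_add: "twisted X Y n T \<Longrightarrow> twisted X Y n U \<Longrightarrow> twisted X Y n (\<lambda>p. T p + U p)"
proof -
  assume "twisted X Y n T" "twisted X Y n U"
  then obtain r s where "\<forall>u. n \<le> length u \<longrightarrow> r u = 0" "\<forall>p. T p = (\<Sum>u \<in> nf_between X Y. r u * twist u X p)"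
    "\<forall>u. n \<le> length u \<longrightarrow> s u = 0" "\<forall>p. U p = (\<Sum>u \<in> nf_between X Y. s u * twist u X p)"
    unfolding twisted_def by blast
  then show ?thesis unfolding twisted_def
    by (intro exI[of _ "\<lambda>u. r u + s u"]) (simp add: distrib_right sum.distrib)
qed

lemma twisted_mult: "twisted X Y n T \<Longrightarrow> twisted X Y n (\<lambda>p. g * T p)"
proof -
  assume "twisted X Y n T"
  then obtain r where "\<forall>u. n \<le> length u \<longrightarrow> r u = 0" "\<forall>p. T p = (\<Sum>u \<in> nf_between X Y. r u * twist u X p)"
    unfolding twisted_def by blast
  then show ?thesis unfolding twisted_def
    by (intro exI[of _ "\<lambda>u. g * r u"]) (simp add: sum_distrib_left mult.assoc)
qed

lemma twisted_zero: "twisted X Y n (\<lambda>p. 0)"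
  unfolding twisted_def by (intro exI[of _ "\<lambda>u. 0"]) simp

lemma twisted_sum: "(\<And>a. a \<in> A \<Longrightarrow> twisted X Y n (T a)) \<Longrightarrow> twisted X Y n (\<lambda>p. \<Sum>a\<in>A. T a p)"
  by (induction A rule: infinite_finite_induct) (auto intro: twisted_zero twisted_add)

lemma twisted_mono: "twisted X Y n T \<Longrightarrow> n \<le> n' \<Longrightarrow> twisted X Y n' T"
  unfolding twisted_def using le_trans by blast

text \<open>The coefficient is placed at the normal form with the same automorphism, which is at
  most as long as \<open>w\<close>.\<close>

lemma twisted_twist:
  fixes r :: "'k::field mpoly"
  assumes "X \<in> words Q" "set w \<subseteq> {..<length X}" "legal w X" "length w < n"
  shows "twisted X (sws w X) n (\<lambda>p. r * twist w X p)"
proof -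
  obtain a where a: "a \<in> nf_between X (sws w X)" "length a \<le> length w" "\<And>p. twist a X p = (twist w X p :: 'k mpoly)"
    using nf_between_twist[OF assms(1-3)] by blast
  have "(\<Sum>u \<in> nf_between X (sws w X). (if u = a then r else 0) * twist u X p) = r * twist w X p" for p
  proof -
    have "(\<Sum>u \<in> nf_between X (sws w X). (if u = a then r else 0) * twist u X p) =
        (\<Sum>u \<in> nf_between X (sws w X). if u = a then r * twist u X p else 0)"
      by (intro sum.cong) auto
    also have "\<dots> = r * twist w X p" using a by (simp add: finite_nf_between)
    finally show ?thesis .
  qed
  then show ?thesis unfolding twisted_def using a(2) assms(4)
    by (intro exI[of _ "\<lambda>u. if u = a then r else 0"]) auto
qed

text \<open>A step is a ring automorphism: it transforms the coefficients and prepends one letter to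
  each word. The new words are brought back to normal forms by \<open>twisted_twist\<close>.\<close>

lemma twisted_tstep:
  fixes T :: "'k::field mpoly \<Rightarrow> 'k mpoly"
  assumes "twisted X Y n T" "X \<in> words Q" "m < length X" "legal_step m Y"
  shows "twisted X (sw m Y) (Suc n) (\<lambda>p. tstep m Y (T p))"
proof -
  obtain r where r: "\<And>u. n \<le> length u \<Longrightarrow> r u = 0" "\<And>p. T p = (\<Sum>u \<in> nf_between X Y. r u * twist u X p)"
    using assms(1) unfolding twisted_def by blast
  have "twisted X (sw m Y) (Suc n) (\<lambda>p. \<Sum>u \<in> nf_between X Y. tstep m Y (r u) * twist (m # u) X p)"
  proof (rule twisted_sum)
    fix u assume u: "u \<in> nf_between X Y"
    show "twisted X (sw m Y) (Suc n) (\<lambda>p. tstep m Y (r u) * twist (m # u) X p)"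
    proof (cases "n \<le> length u")
      case True
      then show ?thesis using r by (simp add: twisted_zero)
    next
      case False
      have u': "sws u X = Y" "legal u X" "set u \<subseteq> {..<length X}"
        using u set_nf by (auto simp: nf_between_def)
      have "twisted X (sws (m # u) X) (Suc n) (\<lambda>p. tstep m Y (r u) * twist (m # u) X p)"
        using False u' assms by (intro twisted_twist) auto
      then show ?thesis using u' by simp
    qed
  qed
  moreover have "tstep m Y (T p) = (\<Sum>u \<in> nf_between X Y. tstep m Y (r u) * twist (m # u) X p)" for p
    unfolding r tstep_sum by (intro sum.cong) (auto simp: nf_between_def)
  ultimately show ?thesis by simp
qed

section \<open>Leading terms of the operators\<close>

lemma Xfac_ne_0: "a \<noteq> b \<Longrightarrow> Xfac Q i j (Var a) (Var b) \<noteq> (0 :: 'k::field mpoly)"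
  by (simp add: Xfac_def)

lemma Var_ne_0 [simp]: "Var a \<noteq> (0 :: 'k::field mpoly)"
proof
  assume "Var a = (0 :: 'k mpoly)"
  then have "Poly_Mapping.lookup (Var a :: 'k mpoly) (Poly_Mapping.single a 1) = 0" by simp
  then show False by (simp add: Var_def)
qed

text \<open>Only a crossing of two equal labels fails to be a multiple of its automorphism. It is
  the divided difference with denominator \<open>g\<close>; source and target word then agree, which
  gives a place to the identity term.\<close>

lemma act_gen:
  assumes "m < length X" "legal_step m X"
  shows "(\<exists>g. g \<noteq> 0 \<and> (\<forall>p. act Q \<mu> 1 (gen m X) p = g * (tstep m X p :: 'k::field mpoly))) \<or>
    (sw m X = X \<and> (\<exists>g. g \<noteq> 0 \<and> (\<forall>p. g * act Q \<mu> 1 (gen m X) p = (tstep m X p - p :: 'k mpoly))))"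
proof (cases m)
  case 0
  obtain l b where X: "X = l # b" using assms by (cases X) auto
  obtain i where l: "l = Black i" using assms X 0 by (cases l) auto
  show ?thesis unfolding 0 X l
    by (intro disjI1 exI[of _ "(- Var 1) ^ Poly_Mapping.lookup \<mu> i"]) simp
next
  case (Suc k)
  obtain a l l' b where X: "X = a @ l # l' # b" "k = length a"
    by (rule split_at2[of k X]) (use assms Suc in simp, blast)
  let ?r = "Suc (nblack a)"
  have act: "act Q \<mu> 1 (gen m X) p = act Q \<mu> ?r (cross l l') (p :: 'k mpoly)" for p
    unfolding Suc X gen_append by (simp add: wh_def)
  have st: "tstep m X = (if is_black l \<and> is_black l' then swap ?r else (\<lambda>p. p :: 'k mpoly))"
    unfolding Suc X tstep_append ..
  have sw: "sw m X = a @ l' # l # b" unfolding Suc X sw_append ..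
  have leg: "is_black l \<or> is_black l'" using assms(2) unfolding Suc X tstep_append .
  show ?thesis
  proof (cases l)
    case l: (Black i)
    show ?thesis
    proof (cases l')
      case l': (Black j)
      show ?thesis
      proof (cases "i = j")
        case True
        have "(Var (Suc ?r) - Var ?r) * act Q \<mu> 1 (gen m X) p = (tstep m X p - p :: 'k mpoly)" for p
          unfolding act st l l' using demazure[of ?r p] True by simp
        moreover have "sw m X = X" unfolding sw unfolding X l l' True ..
        moreover have "(Var (Suc ?r) - Var ?r :: 'k mpoly) \<noteq> 0" by simp
        ultimately show ?thesis by blast
      next
        case False
        have "act Q \<mu> 1 (gen m X) p = Xfac Q i j (Var (Suc ?r)) (Var ?r) * (tstep m X p :: 'k mpoly)" for p
          unfolding act st l l' using False by simp
        moreover have "Xfac Q i j (Var (Suc ?r)) (Var ?r) \<noteq> (0 :: 'k mpoly)" by (rule Xfac_ne_0) simp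
        ultimately show ?thesis by blast
      qed
    next
      case l': (Red \<theta>)
      have "act Q \<mu> 1 (gen m X) p = 1 * (tstep m X p :: 'k mpoly)" for p
        unfolding act st l l' by simp
      then show ?thesis by (intro disjI1 exI[of _ 1]) simp
    qed
  next
    case l: (Red \<theta>)
    then obtain j where l': "l' = Black j" using leg by (cases l') auto
    have "act Q \<mu> 1 (gen m X) p = Var ?r ^ Poly_Mapping.lookup \<theta> j * (tstep m X p :: 'k mpoly)" for p
      unfolding act st l l' by simp
    moreover have "Var ?r ^ Poly_Mapping.lookup \<theta> j \<noteq> (0 :: 'k mpoly)" by simp
    ultimately show ?thesis by blast
  qed
qed

text \<open>The factor \<open>d\<close> clears the denominators of the divided differences, so that
  triangularity can be stated over polynomials; \<open>q\<close> is the numerator of the leading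
  coefficient.\<close>

lemma act_path:
  assumes X: "X \<in> words Q"
  shows "set w \<subseteq> {..<length X} \<Longrightarrow> legal w X \<Longrightarrow> \<exists>d q. d \<noteq> 0 \<and> q \<noteq> 0 \<and>
    twisted X (sws w X) (length w) (\<lambda>p :: 'k::field mpoly. d * act Q \<mu> 1 (path w X) p - q * twist w X p)"
proof (induction w)
  case Nil
  show ?case by (intro exI[of _ 1]) (simp add: twisted_zero)
next
  case (Cons m w)
  let ?Z = "sws w X"
  obtain d q where dq: "d \<noteq> 0" "q \<noteq> 0"
    "twisted X ?Z (length w) (\<lambda>p :: 'k mpoly. d * act Q \<mu> 1 (path w X) p - q * twist w X p)"
    using Cons by auto
  let ?T = "\<lambda>p :: 'k mpoly. act Q \<mu> 1 (path w X) p"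
  let ?R = "\<lambda>p :: 'k mpoly. d * ?T p - q * twist w X p"
  let ?\<sigma> = "tstep m ?Z :: 'k mpoly \<Rightarrow> 'k mpoly"
  have m: "m < length X" "m < length ?Z" "legal_step m ?Z" "set w \<subseteq> {..<length X}" "legal w X"
    using Cons.prems by auto
  have R: "twisted X (sw m ?Z) (Suc (length w)) (\<lambda>p. ?\<sigma> (?R p))"
    by (rule twisted_tstep[OF dq(3) X m(1,3)])
  from act_gen[OF m(2,3), where 'k = 'k] show ?case
  proof (elim disjE conjE exE)
    fix g assume g: "g \<noteq> 0" "\<forall>p. act Q \<mu> 1 (gen m ?Z) p = g * ?\<sigma> p"
    \<comment> \<open>The automorphism is applied to the expansion known for \<open>w\<close>, which
      also moves the factors \<open>d\<close> and \<open>q\<close>; multiplication by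
      \<open>g\<close> completes the action of the generator.\<close>
    have "?\<sigma> d * act Q \<mu> 1 (path (m # w) X) p - g * ?\<sigma> q * twist (m # w) X p = g * ?\<sigma> (?R p)" for p
      using g(2) by (simp add: algebra_simps)
    then have "twisted X (sws (m # w) X) (length (m # w)) (\<lambda>p :: 'k mpoly. ?\<sigma> d * act Q \<mu> 1 (path (m # w) X) p - g * ?\<sigma> q * twist (m # w) X p)"
      using twisted_mult[OF R, of g] by simp
    then show ?thesis using g(1) dq by (intro exI[of _ "?\<sigma> d"] exI[of _ "g * ?\<sigma> q"]) simp
  next
    fix g assume g: "g \<noteq> 0" "\<forall>p. g * act Q \<mu> 1 (gen m ?Z) p = ?\<sigma> p - p" and Z: "sw m ?Z = ?Z"
    \<comment> \<open>Both \<open>?\<sigma> (?T p)\<close> and \<open>?T p\<close> occur, and only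
      \<open>d * ?T p\<close> has a known expansion; the factor \<open>d * ?\<sigma> d\<close>
      serves both. The terms coming from \<open>?T p\<close> belong to \<open>w\<close>, which is
      one letter shorter.\<close>
    have "d * ?\<sigma> d * g * act Q \<mu> 1 (path (m # w) X) p - d * ?\<sigma> q * twist (m # w) X p =
        d * ?\<sigma> (?R p) + (- ?\<sigma> d * q) * twist w X p + - ?\<sigma> d * ?R p" for p
    proof -
      have "d * ?\<sigma> d * g * act Q \<mu> 1 (path (m # w) X) p = d * ?\<sigma> d * (g * act Q \<mu> 1 (gen m ?Z) (?T p))"
        by (simp add: mult.assoc)
      also have "\<dots> = d * ?\<sigma> d * (?\<sigma> (?T p) - ?T p)" using g(2) by simp
      finally show ?thesis by (simp add: algebra_simps)
    qed
    moreover have "twisted X (sws (m # w) X) (length (m # w))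
        (\<lambda>p. d * ?\<sigma> (?R p) + (- ?\<sigma> d * q) * twist w X p + - ?\<sigma> d * ?R p)"
    proof (intro twisted_add)
      show "twisted X (sws (m # w) X) (length (m # w)) (\<lambda>p. d * ?\<sigma> (?R p))"
        using twisted_mult[OF R, of d] by simp
      show "twisted X (sws (m # w) X) (length (m # w)) (\<lambda>p. (- ?\<sigma> d * q) * twist w X p)"
        using twisted_twist[OF X m(4,5), of "length (m # w)" "- ?\<sigma> d * q"] Z by simp
      show "twisted X (sws (m # w) X) (length (m # w)) (\<lambda>p. - ?\<sigma> d * ?R p)"
        using twisted_mult[OF twisted_mono[OF dq(3), of "length (m # w)"], of "- ?\<sigma> d"] Z by simp
    qed
    ultimately show ?thesis using g(1) dq
      by (intro exI[of _ "d * ?\<sigma> d * g"] exI[of _ "d * ?\<sigma> q"]) simp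
  qed
qed

end

section \<open>Injectivity of the twists on normal forms\<close>

text \<open>The standard action of the group of type B on signed permutations, written on lists of
  named tokens with a sign. It separates normal forms by pure combinatorics; letters and variables
  are linked to it afterwards.\<close>

fun tok_step :: "nat \<Rightarrow> (nat \<times> bool) list \<Rightarrow> (nat \<times> bool) list" where
  "tok_step 0 T = (fst (hd T), \<not> snd (hd T)) # tl T"
| "tok_step (Suc k) T = take k T @ T ! Suc k # T ! k # drop (Suc (Suc k)) T"

abbreviation toks :: "nat list \<Rightarrow> (nat \<times> bool) list \<Rightarrow> (nat \<times> bool) list" where
  "toks w T \<equiv> foldr tok_step w T"

lemma tok_step_split: "tok_step (Suc (length a)) (a @ z # z' # b) = a @ z' # z # b"
  by (simp add: nth_append)

lemma length_tok_step: "m < length T \<Longrightarrow> length (tok_step m T) = length T"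
  by (cases m) (auto simp: min_def)

lemma length_toks: "set w \<subseteq> {..<length T} \<Longrightarrow> length (toks w T) = length T"
  by (induction w) (auto simp: length_tok_step simp del: tok_step.simps)

lemma tok_step_append: "m < length S \<Longrightarrow> tok_step m (S @ T) = tok_step m S @ T"
proof (cases m)
  case 0
  assume "m < length S"
  then show ?thesis using 0 by (cases S) auto
next
  case (Suc k)
  assume m: "m < length S"
  obtain a l l' b where S: "S = a @ l # l' # b" "k = length a"
    by (rule split_at2[of k S]) (use m Suc in simp, blast)
  show ?thesis unfolding Suc S using tok_step_split[of a l l' "b @ T"] tok_step_split[of a l l' b] by simp
qed

lemma toks_append: "set w \<subseteq> {..<length S} \<Longrightarrow> toks w (S @ T) = toks w S @ T"
  by (induction w) (auto simp: tok_step_append length_toks simp del: tok_step.simps)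

lemma set_fst_tok_step: "m < length T \<Longrightarrow> fst ` set (tok_step m T) = fst ` set T"
proof (cases m)
  case 0
  assume "m < length T"
  then show ?thesis using 0 by (cases T) auto
next
  case (Suc k)
  assume m: "m < length T"
  obtain a l l' b where T: "T = a @ l # l' # b" "k = length a"
    by (rule split_at2[of k T]) (use m Suc in simp, blast)
  show ?thesis unfolding Suc T tok_step_split by auto
qed

lemma set_fst_toks: "set w \<subseteq> {..<length T} \<Longrightarrow> fst ` set (toks w T) = fst ` set T"
  by (induction w) (auto simp: set_fst_tok_step length_toks simp del: tok_step.simps)

text \<open>The ascending run carries the last token to the left. In the other case it goes to the
  front, the generator 0 toggles its sign, and the descending part carries it back to position
  \<open>j\<close>. The Boolean equation \<open>e = snd z\<close> keeps the sign for
  \<open>e\<close> and toggles it otherwise.\<close>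

lemma toks_coset_rep:
  assumes "length S = n" "j \<le> n"
  shows "toks (coset_rep n e j) (S @ [z]) = take j S @ (fst z, e = snd z) # drop j S"
proof -
  have up: "toks [Suc i..<Suc n] (S @ [z]) = take i S @ z # drop i S" if "i \<le> n" for i
    using that
  proof (induction i rule: inc_induct)
    case base
    then show ?case using assms by simp
  next
    case (step j)
    have j: "j < length S" using step assms by simp
    have "toks [Suc j..<Suc n] (S @ [z]) = tok_step (Suc j) (take (Suc j) S @ z # drop (Suc j) S)"
      using step by (simp add: upt_conv_Cons del: upt_Suc tok_step.simps)
    also have "take (Suc j) S @ z # drop (Suc j) S = take j S @ S ! j # z # drop (Suc j) S"
      using j by (simp add: take_Suc_conv_app_nth)
    also have "tok_step (Suc j) \<dots> = take j S @ z # S ! j # drop (Suc j) S"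
      using tok_step_split[of "take j S" "S ! j" z "drop (Suc j) S"] j by (simp add: min_def del: tok_step.simps)
    also have "\<dots> = take j S @ z # drop j S" using j by (simp add: Cons_nth_drop_Suc)
    finally show ?case .
  qed
  show ?thesis
  proof (cases e)
    case True
    then show ?thesis using up[OF assms(2)] by simp
  next
    case False
    let ?z = "(fst z, \<not> snd z)"
    have 0: "toks [0..<Suc n] (S @ [z]) = ?z # S"
      using up[of 0] by (simp add: upt_conv_Cons del: upt_Suc)
    have "toks (rev [1..<Suc j]) (?z # S) = take j S @ ?z # drop j S"
      using assms(2)
    proof (induction j)
      case (Suc j)
      have j: "j < length S" using Suc assms by simp
      have "toks (rev [1..<Suc (Suc j)]) (?z # S) = tok_step (Suc j) (take j S @ ?z # drop j S)"
        using Suc by simp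
      also have "take j S @ ?z # drop j S = take j S @ ?z # S ! j # drop (Suc j) S"
        using j by (simp add: Cons_nth_drop_Suc)
      also have "tok_step (Suc j) \<dots> = take j S @ S ! j # ?z # drop (Suc j) S"
        using tok_step_split[of "take j S" ?z "S ! j" "drop (Suc j) S"] j by (simp add: min_def del: tok_step.simps)
      also have "\<dots> = take (Suc j) S @ ?z # drop (Suc j) S" using j by (simp add: take_Suc_conv_app_nth)
      finally show ?case .
    qed simp
    then show ?thesis using False 0 by (simp del: upt_Suc)
  qed
qed

text \<open>The smaller group never touches the last token, so its final position and sign reveal
  the coset representative. Deleting this token leaves the action of the remaining factor.\<close>

lemma nf_toks_inj:
  "a \<in> nf n \<Longrightarrow> b \<in> nf n \<Longrightarrow> length T = n \<Longrightarrow> distinct (map fst T) \<Longrightarrow> toks a T = toks b T \<Longrightarrow> a = b"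
proof (induction n arbitrary: a b T)
  case (Suc n)
  obtain S z where T: "T = S @ [z]" "length S = n" using Suc.prems(3) by (metis length_Suc_conv_rev)
  obtain e j a' where a: "a = coset_rep n e j @ a'" "j \<le> n" "a' \<in> nf n" using Suc.prems(1) by auto
  obtain e' j' b' where b: "b = coset_rep n e' j' @ b'" "j' \<le> n" "b' \<in> nf n" using Suc.prems(2) by auto
  let ?A = "toks a' S" and ?B = "toks b' S"
  have la: "length ?A = n" "length ?B = n" using set_nf[OF a(3)] set_nf[OF b(3)] T by (simp_all add: length_toks)
  have z: "fst z \<notin> fst ` set ?A" "fst z \<notin> fst ` set ?B"
    using set_nf[OF a(3)] set_nf[OF b(3)] T Suc.prems(4) by (simp_all add: set_fst_toks)
  have "toks a T = take j ?A @ (fst z, e = snd z) # drop j ?A"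
    using toks_coset_rep[OF la(1) a(2), of e z] set_nf[OF a(3)] T by (simp add: a(1) toks_append)
  moreover have "toks b T = take j' ?B @ (fst z, e' = snd z) # drop j' ?B"
    using toks_coset_rep[OF la(2) b(2), of e' z] set_nf[OF b(3)] T by (simp add: b(1) toks_append)
  ultimately have eq: "take j ?A @ (fst z, e = snd z) # drop j ?A = take j' ?B @ (fst z, e' = snd z) # drop j' ?B"
    using Suc.prems(5) by simp
  \<comment> \<open>Passing to the names locates the token on both sides before its sign is
    compared.\<close>
  then have "map fst (take j ?A) @ fst z # map fst (drop j ?A) = map fst (take j' ?B) @ fst z # map fst (drop j' ?B)"
    by (metis (no_types, lifting) fst_conv list.simps(9) map_append)
  moreover have "fst z \<notin> set (map fst (take j ?A))" "fst z \<notin> set (map fst (drop j ?A))"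
    using z(1) by (auto dest: in_set_takeD in_set_dropD)
  moreover have "fst z \<notin> set (map fst (take j' ?B))" "fst z \<notin> set (map fst (drop j' ?B))"
    using z(2) by (auto dest: in_set_takeD in_set_dropD)
  ultimately have "map fst (take j ?A) = map fst (take j' ?B)"
    by (metis append_Cons_eq_iff)
  then have "length (map fst (take j ?A)) = length (map fst (take j' ?B))" by (rule arg_cong)
  then have jj: "j = j'" using la a(2) b(2) by simp
  have parts: "take j ?A = take j ?B" "(e = snd z) = (e' = snd z)" "drop j ?A = drop j ?B"
    using eq la a(2) unfolding jj by (simp_all add: append_eq_append_conv)
  have "?A = ?B" using parts(1,3) by (metis append_take_drop_id)
  moreover have "e = e'" using parts(2) by (cases e; cases e'; cases "snd z") simp_all
  ultimately have "a' = b'" using Suc.IH[OF a(3) b(3) T(2)] Suc.prems(4) T by simp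
  then show ?case using a(1) b(1) jj \<open>e = e'\<close> by simp
qed simp

section \<open>Comparison of lists, and Dedekind independence\<close>

lemma nth_adjacent_swap:
  "Suc k < length T \<Longrightarrow> q < length T \<Longrightarrow>
    (take k T @ T ! Suc k # T ! k # drop (Suc (Suc k)) T) ! q = T ! transpose k (Suc k) q"
proof -
  assume k: "Suc k < length T" and q: "q < length T"
  obtain a l l' b where T: "T = a @ l # l' # b" "k = length a"
    by (rule split_at2[of k T]) (use k in simp, blast)
  have eq: "take k T @ T ! Suc k # T ! k # drop (Suc (Suc k)) T = a @ l' # l # b"
    unfolding T by (simp add: nth_append)
  consider "q < k" | "q = k" | "q = Suc k" | i where "q = Suc (Suc k) + i"
    by (metis less_iff_Suc_add add_Suc linorder_neqE_nat not_less_eq)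
  then show ?thesis
  proof cases
    case 4
    then have "transpose k (Suc k) q = q" by (simp add: transpose_def)
    then show ?thesis unfolding eq unfolding 4 T by (simp add: nth_append)
  qed (unfold eq T, simp_all add: nth_append)
qed

lemma nblack_take_less:
  "q < r \<Longrightarrow> q < length X \<Longrightarrow> is_black (X ! q) \<Longrightarrow> nblack (take q X) < nblack (take r X)"
proof -
  assume *: "q < r" "q < length X" "is_black (X ! q)"
  obtain s where r: "r = Suc q + s" using * less_iff_Suc_add by auto
  have "take r X = take q X @ X ! q # take s (drop (Suc q) X)"
    using *(2) unfolding r take_add by (simp add: take_Suc_conv_app_nth)
  then show ?thesis using *(3) by (cases "X ! q") auto
qed

text \<open>Meant for lists of tokens with \<open>P\<close> singling out the red ones: equal red
  letters cannot be told apart in the target word, but their order is known, while black tokens are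
  compared place by place.\<close>

lemma filter_determines:
  assumes "length S = length T" "filter P S = filter P T"
    "\<And>q. q < length S \<Longrightarrow> P (S ! q) = P (T ! q)" "\<And>q. q < length S \<Longrightarrow> \<not> P (S ! q) \<Longrightarrow> S ! q = T ! q"
  shows "S = T"
  using assms
proof (induction S T rule: list_induct2)
  case (Cons x xs y ys)
  have xy: "P x = P y" "\<not> P x \<Longrightarrow> x = y" using Cons.prems(2)[of 0] Cons.prems(3)[of 0] by auto
  have "xs = ys"
  proof (rule Cons.IH)
    show "filter P xs = filter P ys" using Cons.prems(1) xy by (auto split: if_splits)
    show "\<And>q. q < length xs \<Longrightarrow> P (xs ! q) = P (ys ! q)" using Cons.prems(2)[of "Suc _"] by auto
    show "\<And>q. q < length xs \<Longrightarrow> \<not> P (xs ! q) \<Longrightarrow> xs ! q = ys ! q" using Cons.prems(3)[of "Suc _"] by auto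
  qed
  then show ?case using Cons.prems(1) xy by (auto split: if_splits)
qed simp

text \<open>Dedekind's elimination of one map at a time. The relation is assumed on a
  multiplicatively closed set \<open>M\<close> only, because faithfulness provides it just for
  polynomials in the variables of the source word.\<close>

lemma multiplicative_independent:
  fixes \<phi> :: "'b \<Rightarrow> 'r::comm_ring_1 \<Rightarrow> 's::idom"
  assumes "finite A" "\<And>u x y. u \<in> A \<Longrightarrow> x \<in> M \<Longrightarrow> y \<in> M \<Longrightarrow> \<phi> u (x * y) = \<phi> u x * \<phi> u y"
    "\<And>u. u \<in> A \<Longrightarrow> \<phi> u 1 = 1" "1 \<in> M" "\<And>x y. x \<in> M \<Longrightarrow> y \<in> M \<Longrightarrow> x * y \<in> M"
    "\<And>u v. u \<in> A \<Longrightarrow> v \<in> A \<Longrightarrow> u \<noteq> v \<Longrightarrow> \<exists>x\<in>M. \<phi> u x \<noteq> \<phi> v x"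
    "\<And>x. x \<in> M \<Longrightarrow> (\<Sum>u\<in>A. r u * \<phi> u x) = 0" "u \<in> A"
  shows "r u = 0"
  using assms
proof (induction A arbitrary: r u rule: finite_induct)
  case (insert v A)
  have "r u = 0" if u: "u \<in> A" for u
  proof -
    have uv: "u \<noteq> v" using insert.hyps u by blast
    obtain y where y: "y \<in> M" "\<phi> u y \<noteq> \<phi> v y" using insert.prems(5)[of u v] u uv by blast
    \<comment> \<open>The relation at x y minus \<open>\<phi> v y\<close> times the relation at x
      has these coefficients; the one of \<open>v\<close> is zero, and \<open>y\<close> was chosen
      to separate \<open>u\<close> from \<open>v\<close>.\<close>
    have "r u * (\<phi> u y - \<phi> v y) = 0"
    proof (rule insert.IH[where r = "\<lambda>u. r u * (\<phi> u y - \<phi> v y)"])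
      fix x assume x: "x \<in> M"
      have 1: "(\<Sum>u\<in>insert v A. r u * \<phi> u (x * y)) = 0" "(\<Sum>u\<in>insert v A. r u * \<phi> u x) = 0"
        using insert.prems(4,6) x y by blast+
      have "(\<Sum>u\<in>A. r u * (\<phi> u y - \<phi> v y) * \<phi> u x) =
          (\<Sum>u\<in>insert v A. r u * (\<phi> u y - \<phi> v y) * \<phi> u x)"
        using insert.hyps by simp
      also have "\<dots> = (\<Sum>u\<in>insert v A. r u * \<phi> u (x * y) - \<phi> v y * (r u * \<phi> u x))"
        using insert.prems(1) x y by (intro sum.cong) (auto simp: algebra_simps)
      also have "\<dots> = 0" unfolding sum_subtractf sum_distrib_left[symmetric] 1 by simp
      finally show "(\<Sum>u\<in>A. r u * (\<phi> u y - \<phi> v y) * \<phi> u x) = 0" .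
    next
      show "\<And>u x y. u \<in> A \<Longrightarrow> x \<in> M \<Longrightarrow> y \<in> M \<Longrightarrow> \<phi> u (x * y) = \<phi> u x * \<phi> u y"
        by (rule insert.prems(1)) simp_all
      show "\<And>u. u \<in> A \<Longrightarrow> \<phi> u 1 = 1" by (rule insert.prems(2)) simp
      show "\<And>u v. u \<in> A \<Longrightarrow> v \<in> A \<Longrightarrow> u \<noteq> v \<Longrightarrow> \<exists>x\<in>M. \<phi> u x \<noteq> \<phi> v x"
        by (rule insert.prems(5)) simp_all
    qed (fact insert.prems(3) insert.prems(4) u)+
    then show ?thesis using y(2) by simp
  qed
  moreover have "r v = 0"
  proof -
    have "(\<Sum>u\<in>insert v A. r u * \<phi> u 1) = 0" using insert.prems(3,6) by blast
    then show ?thesis using calculation insert.hyps insert.prems(2) by simp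
  qed
  ultimately show ?case using insert.prems(7) by blast
qed simp

section \<open>Tracking letters and variables by tokens\<close>

context oklrw
begin

definition black_index :: "'i word \<Rightarrow> nat \<Rightarrow> nat" where
  "black_index X t = Suc (nblack (take t X))"

lemma black_index_inj:
  assumes "black_index X t = black_index X s" "t < length X" "s < length X" "is_black (X ! t)" "is_black (X ! s)"
  shows "t = s"
  using nblack_take_less[of t s X] nblack_take_less[of s t X] assms
  by (cases t s rule: linorder_cases) (auto simp: black_index_def)

lemma nth_sw_Suc: "Suc k < length X \<Longrightarrow> q < length X \<Longrightarrow> sw (Suc k) X ! q = X ! transpose k (Suc k) q"
  unfolding sw.simps(2) by (rule nth_adjacent_swap)

lemma nth_tok_Suc:
  "Suc k < length T \<Longrightarrow> q < length T \<Longrightarrow> tok_step (Suc k) T ! q = T ! transpose k (Suc k) q"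
  unfolding tok_step.simps(2) by (rule nth_adjacent_swap)

text \<open>A black letter that crosses a red one changes its position but not its number among the
  black letters, in agreement with the trivial automorphism of such a step.\<close>

lemma tstep_Suc_Var:
  assumes "Suc k < length X" "q < length X" "is_black (X ! q)" "legal_step (Suc k) X"
  shows "tstep (Suc k) X (Var (black_index X q)) =
    (Var (black_index (sw (Suc k) X) (transpose k (Suc k) q)) :: 'k::field mpoly)"
proof -
  obtain a l l' b where X: "X = a @ l # l' # b" "k = length a"
    by (rule split_at2[of k X]) (use assms in simp, blast)
  consider "q < k" | "q = k" | "q = Suc k" | "Suc k < q" by linarith
  then show ?thesis
  proof cases
    case 1
    then have "nblack (take q a) < nblack a"
      using nblack_take_less[of q "length a" a] assms(3) X by (simp add: nth_append)
    then show ?thesis using 1 unfolding X sw_append tstep_append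
      by (auto simp: black_index_def transpose_def)
  next
    case 2
    then show ?thesis using assms(3,4) unfolding X sw_append tstep_append
      by (auto simp: black_index_def transpose_def nblack_Cons nth_append)
  next
    case 3
    then show ?thesis using assms(3,4) unfolding X sw_append tstep_append
      by (auto simp: black_index_def transpose_def nblack_Cons nth_append)
  next
    case 4
    obtain i where q: "q = Suc (Suc k) + i" using 4 by (metis Suc_leI le_add_diff_inverse)
    show ?thesis unfolding q unfolding X sw_append tstep_append
      by (auto simp: black_index_def transpose_def nblack_Cons)
  qed
qed

text \<open>Tokens \<open>(t, s)\<close> record where the letter number \<open>t\<close> of \<open>X\<close> has moved and whether it has been
  changed by \<open>\<rho>\<close> an even number of times.\<close>

definition start :: "'i word \<Rightarrow> (nat \<times> bool) list" where
  "start X = map (\<lambda>t. (t, True)) [0..<length X]"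

text \<open>With the token \<open>(t, s)\<close> at position \<open>q\<close> of Y, letter t of X
  has arrived there, and its variable goes to the variable of that place, negated after an odd
  number of \<rho>s. Red tokens keep their sign because \<rho> on them is not legal.\<close>

definition tracks :: "'i word \<Rightarrow> 'i word \<Rightarrow> ('k::field mpoly \<Rightarrow> 'k mpoly) \<Rightarrow> nat \<Rightarrow> nat \<times> bool \<Rightarrow> bool" where
  "tracks X Y \<phi> q = (\<lambda>(t, s). t < length X \<and> Y ! q = (if s then X ! t else flip (X ! t)) \<and>
     (is_black (X ! t) \<longrightarrow> \<phi> (Var (black_index X t)) = (if s then Var (black_index Y q) else - Var (black_index Y q))) \<and>
     (\<not> is_black (X ! t) \<longrightarrow> s))"

lemma tracks_black: "tracks X Y \<phi> q z \<Longrightarrow> is_black (X ! fst z) = is_black (Y ! q)"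
  by (auto simp: tracks_def split: if_splits)

text \<open>An invariant along the word. The second part holds because a legal word never crosses
  two red letters, so their tokens keep their order.\<close>

lemma toks_track:
  assumes "X \<in> words Q"
  shows "set w \<subseteq> {..<length X} \<Longrightarrow> legal w X \<Longrightarrow>
    (\<forall>q<length X. tracks X (sws w X) (twist w X :: 'k::field mpoly \<Rightarrow> _) q (toks w (start X) ! q)) \<and>
    filter (\<lambda>z. \<not> is_black (X ! fst z)) (toks w (start X)) = filter (\<lambda>z. \<not> is_black (X ! fst z)) (start X)"
proof (induction w)
  case Nil
  then show ?case by (auto simp: tracks_def start_def)
next
  case (Cons m w)
  let ?T = "toks w (start X)" and ?Y = "sws w X" and ?\<phi> = "twist w X :: 'k mpoly \<Rightarrow> _"
  have w: "set w \<subseteq> {..<length X}" "legal w X" using Cons.prems by simp_all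
  have IH: "tracks X ?Y ?\<phi> q (?T ! q)" if "q < length X" for q using Cons.IH[OF w] that by blast
  have IH': "filter (\<lambda>z. \<not> is_black (X ! fst z)) ?T = filter (\<lambda>z. \<not> is_black (X ! fst z)) (start X)"
    using Cons.IH[OF w] by blast
  have len: "length ?T = length X" "length ?Y = length X" "m < length X" "legal_step m ?Y"
    using Cons.prems by (auto simp: length_toks start_def)
  have tw: "twist (m # w) X = (\<lambda>p. tstep m ?Y (?\<phi> p))" by (rule ext) simp
  note okX = letter_ok_nth[OF assms]
  show ?case
  proof (cases m)
    case 0
    obtain l Y where Y: "?Y = l # Y" using len by (cases ?Y) auto
    obtain z T where T: "?T = z # T" using len by (cases ?T) auto
    have l: "is_black l" using len(4) 0 Y by simp
    have z: "is_black (X ! fst z)" using tracks_black[OF IH[of 0]] len(3) 0 Y T l by auto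
    have F1: "tracks X (sw 0 ?Y) (\<lambda>p. tstep 0 ?Y (?\<phi> p)) q (tok_step 0 ?T ! q)" if q: "q < length X" for q
    proof (cases q)
      case 0
      obtain t s where ts: "z = (t, s)" by (cases z)
      have I: "tracks X (l # Y) ?\<phi> 0 (t, s)" using IH[OF q] unfolding Y T 0 ts by simp
      have t: "t < length X" "l = (if s then X ! t else flip (X ! t))"
        "?\<phi> (Var (black_index X t)) = (if s then Var 1 else - Var 1)"
        using I z unfolding tracks_def prod.case ts by (simp_all add: black_index_def)
      have "flip l = (if \<not> s then X ! t else flip (X ! t))" using t(2) okX[OF t(1)] by (cases s) simp_all
      moreover have "neg1 (?\<phi> (Var (black_index X t))) = (if \<not> s then Var 1 else - Var 1)"
        unfolding t(3) by (cases s) simp_all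
      ultimately show ?thesis using t(1) z l unfolding tracks_def Y T 0 ts prod.case by (simp add: black_index_def)
    next
      case (Suc i)
      obtain t s where ts: "T ! i = (t, s)" by (cases "T ! i")
      have I: "tracks X (l # Y) ?\<phi> (Suc i) (t, s)" using IH[OF q] unfolding Y T Suc using ts by simp
      have b: "black_index (v # Y) (Suc i) = Suc (Suc (nblack (take i Y)))" if "is_black v" for v
        using that by (simp add: black_index_def nblack_Cons)
      have t: "t < length X" "Y ! i = (if s then X ! t else flip (X ! t))" "\<not> is_black (X ! t) \<Longrightarrow> s"
        "is_black (X ! t) \<Longrightarrow> ?\<phi> (Var (black_index X t)) =
          (if s then Var (black_index (l # Y) (Suc i)) else - Var (black_index (l # Y) (Suc i)))"
        using I unfolding tracks_def prod.case by simp_all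
      have "neg1 (?\<phi> (Var (black_index X t))) =
          (if s then Var (black_index (flip l # Y) (Suc i)) else - Var (black_index (flip l # Y) (Suc i)))"
        if "is_black (X ! t)"
        unfolding t(4)[OF that] using l by (cases s) (simp_all add: b)
      then show ?thesis using t(1-3) l unfolding tracks_def Y T Suc by (simp add: ts)
    qed
    have "filter (\<lambda>z. \<not> is_black (X ! fst z)) (tok_step 0 ?T) = filter (\<lambda>z. \<not> is_black (X ! fst z)) ?T"
      unfolding T using z by simp
    note F2 = this
    show ?thesis unfolding tw unfolding foldr.simps comp_apply 0 by (intro conjI allI impI F1 trans[OF F2 IH'])
  next
    case (Suc k)
    have k: "Suc k < length X" using len(3) Suc by simp
    have F1: "tracks X (sw (Suc k) ?Y) (\<lambda>p. tstep (Suc k) ?Y (?\<phi> p)) q (tok_step (Suc k) ?T ! q)" if q: "q < length X" for q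
    proof -
      let ?q = "transpose k (Suc k) q"
      have q': "?q < length X" using q k by (auto simp: transpose_def)
      have Z: "sw (Suc k) ?Y ! q = ?Y ! ?q" "tok_step (Suc k) ?T ! q = ?T ! ?q"
        using k q len by (auto simp del: sw.simps tok_step.simps intro!: nth_sw_Suc nth_tok_Suc)
      obtain t s where ts: "?T ! ?q = (t, s)" by (cases "?T ! ?q")
      have I: "tracks X ?Y ?\<phi> ?q (t, s)" using IH[OF q'] ts by simp
      have "tstep (Suc k) ?Y (Var (black_index ?Y ?q)) = (Var (black_index (sw (Suc k) ?Y) q) :: 'k mpoly)"
        if "is_black (?Y ! ?q)"
        using tstep_Suc_Var[of k ?Y ?q, where 'k = 'k] that k q' len Suc by simp
      note step = this
      have t: "t < length X" "?Y ! ?q = (if s then X ! t else flip (X ! t))" "\<not> is_black (X ! t) \<Longrightarrow> s"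
        "is_black (X ! t) \<Longrightarrow> ?\<phi> (Var (black_index X t)) =
          (if s then Var (black_index ?Y ?q) else - Var (black_index ?Y ?q))"
        using I unfolding tracks_def prod.case by blast+
      show ?thesis unfolding Z(2) ts tracks_def prod.case
      proof (intro conjI impI)
        show "t < length X" by fact
        show "sw (Suc k) ?Y ! q = (if s then X ! t else flip (X ! t))" unfolding Z(1) by (rule t(2))
        show s if "\<not> is_black (X ! t)" using that by (rule t(3))
        assume b: "is_black (X ! t)"
        then have "is_black (?Y ! ?q)" using tracks_black[OF I] by simp
        from step[OF this] show "tstep (Suc k) ?Y (?\<phi> (Var (black_index X t))) =
            (if s then Var (black_index (sw (Suc k) ?Y) q) else - Var (black_index (sw (Suc k) ?Y) q))"
          unfolding t(4)[OF b] by (cases s) (simp_all del: tstep.simps sw.simps)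
      qed
    qed
    have "filter (\<lambda>z. \<not> is_black (X ! fst z)) (tok_step (Suc k) ?T) = filter (\<lambda>z. \<not> is_black (X ! fst z)) ?T"
    proof -
      obtain A z z' B where T: "?T = A @ z # z' # B" "k = length A"
        by (rule split_at2[of k ?T]) (use k len in simp, blast)
      have "is_black (X ! fst z) = is_black (?Y ! k)" "is_black (X ! fst z') = is_black (?Y ! Suc k)"
        using tracks_black[OF IH[of k]] tracks_black[OF IH[of "Suc k"]] k T by (auto simp: nth_append)
      then have "is_black (X ! fst z) \<or> is_black (X ! fst z')" using len(4) Suc by simp
      then show ?thesis unfolding T tok_step_split by auto
    qed
    note F2 = this
    show ?thesis unfolding tw unfolding foldr.simps comp_apply Suc by (intro conjI allI impI F1 trans[OF F2 IH'])
  qed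
qed

end

lemma Var_eq_uminus_iff:
  assumes "(Var a :: 'k::field mpoly) = - Var b" shows "a = b"
proof (rule ccontr)
  assume "a \<noteq> b"
  moreover have "(Var a :: 'k mpoly) + Var b = 0" using assms by simp
  ultimately show False using Var_add_ne_0 by blast
qed

context oklrw
begin

lemma twist_inj: "twist w X p = twist w X q \<Longrightarrow> p = (q :: 'k::field mpoly)"
  using twist_simps(3)[of w X p q] twist_simps(6)[of w X "p - q"] by simp

lemma flip_neq: "letter_ok l \<Longrightarrow> is_black l \<Longrightarrow> flip l \<noteq> l"
  by (cases l) (auto simp: tau_no_fix)

text \<open>In characteristic 2 the twists do not see the signs; there the letters determine them, because
  \<open>\<tau>\<close> fixes no vertex.\<close>

lemma nf_between_separated:
  assumes X: "X \<in> words Q" and a: "a \<in> nf_between X Y" and b: "b \<in> nf_between X Y"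
    and eq: "\<And>j. 1 \<le> j \<Longrightarrow> j \<le> nblack X \<Longrightarrow> twist a X (Var j) = (twist b X (Var j) :: 'k::field mpoly)"
  shows "a = b"
proof -
  have A: "a \<in> nf (length X)" "set a \<subseteq> {..<length X}" "legal a X" "sws a X = Y"
    and B: "b \<in> nf (length X)" "set b \<subseteq> {..<length X}" "legal b X" "sws b X = Y"
    using a b set_nf by (auto simp: nf_between_def)
  let ?S = "toks a (start X)" and ?T = "toks b (start X)"
  have tA: "tracks X Y (twist a X :: 'k mpoly \<Rightarrow> _) q (?S ! q)" if "q < length X" for q
    using conjunct1[OF toks_track[OF X A(2,3), where 'k = 'k], rule_format, OF that] unfolding A(4) .
  have tB: "tracks X Y (twist b X :: 'k mpoly \<Rightarrow> _) q (?T ! q)" if "q < length X" for q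
    using conjunct1[OF toks_track[OF X B(2,3), where 'k = 'k], rule_format, OF that] unfolding B(4) .
  have len: "length ?S = length X" "length ?T = length X" "length (start X) = length X"
    using A(2) B(2) by (simp_all add: length_toks start_def)
  note okX = letter_ok_nth[OF X]
  have "?S = ?T"
  proof (rule filter_determines[where P = "\<lambda>z. \<not> is_black (X ! fst z)"])
    show "length ?S = length ?T" using len by simp
    show "filter (\<lambda>z. \<not> is_black (X ! fst z)) ?S = filter (\<lambda>z. \<not> is_black (X ! fst z)) ?T"
      using conjunct2[OF toks_track[OF X A(2,3)]] conjunct2[OF toks_track[OF X B(2,3)]] by (rule trans[OF _ sym])
  next
    fix q assume "q < length ?S"
    then have q: "q < length X" using len by simp
    show "(\<not> is_black (X ! fst (?S ! q))) = (\<not> is_black (X ! fst (?T ! q)))"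
      using tracks_black[OF tA[OF q]] tracks_black[OF tB[OF q]] by simp
    assume "\<not> \<not> is_black (X ! fst (?S ! q))"
    then have bl: "is_black (X ! fst (?S ! q))" "is_black (X ! fst (?T ! q))"
      using tracks_black[OF tA[OF q]] tracks_black[OF tB[OF q]] by simp_all
    obtain t s t' s' where ts: "?S ! q = (t, s)" "?T ! q = (t', s')" by (meson surj_pair)
    have S: "t < length X" "Y ! q = (if s then X ! t else flip (X ! t))" "is_black (X ! t)"
      "twist a X (Var (black_index X t)) = (if s then Var (black_index Y q) else - Var (black_index Y q) :: 'k mpoly)"
      using tA[OF q] bl unfolding tracks_def ts prod.case fst_conv by blast+
    have T: "t' < length X" "Y ! q = (if s' then X ! t' else flip (X ! t'))" "is_black (X ! t')"
      "twist b X (Var (black_index X t')) = (if s' then Var (black_index Y q) else - Var (black_index Y q) :: 'k mpoly)"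
      using tB[OF q] bl unfolding tracks_def ts prod.case fst_conv by blast+
    have index: "1 \<le> black_index X t'" "black_index X t' \<le> nblack X"
      using nblack_take_less[of t' "length X" X] T(1,3) by (simp_all add: black_index_def)
    have T': "twist a X (Var (black_index X t')) = (if s' then Var (black_index Y q) else - Var (black_index Y q) :: 'k mpoly)"
      unfolding eq[OF index] by (rule T(4))
    \<comment> \<open>The tokens t and t' have arrived at the same place of Y, so the images of
      their variables agree up to sign, and the injective map \<open>twist a X\<close> can be
      cancelled.\<close>
    have "twist a X (Var (black_index X t)) = (twist a X (if s = s' then Var (black_index X t') else - Var (black_index X t')) :: 'k mpoly)"
      unfolding S(4) using T' by (cases s; cases s') simp_all
    then have "(Var (black_index X t) :: 'k mpoly) = (if s = s' then Var (black_index X t') else - Var (black_index X t'))"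
      by (rule twist_inj)
    then have "black_index X t = black_index X t'"
      using Var_eq_uminus_iff[of "black_index X t" "black_index X t'"] by (cases "s = s'") simp_all
    then have "t = t'" by (rule black_index_inj) (use S(1,3) T(1,3) in simp_all)
    moreover have "s = s'"
      using trans[OF S(2)[symmetric] T(2)] flip_neq[OF okX[OF T(1)] T(3)] unfolding \<open>t = t'\<close>
      by (cases s; cases s') simp_all
    ultimately show "?S ! q = ?T ! q" by (simp add: ts)
  qed
  moreover have "distinct (map fst (start X))" by (simp add: start_def comp_def)
  ultimately show ?thesis by (intro nf_toks_inj[OF A(1) B(1) len(3)])
qed

section \<open>Linear independence and faithfulness\<close>

lemma act_path_expand:
  assumes X: "X \<in> words Q" and w: "w \<in> nf_between X Y"
  shows "\<exists>d r. d \<noteq> 0 \<and> r w \<noteq> 0 \<and> (\<forall>u. u \<noteq> w \<and> length w \<le> length u \<longrightarrow> r u = 0) \<and>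
    (\<forall>p :: 'k::field mpoly. d * act Q \<mu> 1 (path w X) p = (\<Sum>u \<in> nf_between X Y. r u * twist u X p))"
proof -
  have W: "set w \<subseteq> {..<length X}" "legal w X" "sws w X = Y"
    using w set_nf by (auto simp: nf_between_def)
  obtain d q r where d: "d \<noteq> 0" "q \<noteq> 0" "\<forall>u. length w \<le> length u \<longrightarrow> r u = 0"
    "\<And>p :: 'k mpoly. d * act Q \<mu> 1 (path w X) p - q * twist w X p = (\<Sum>u \<in> nf_between X Y. r u * twist u X p)"
    using act_path[OF X W(1,2), where 'k = 'k] unfolding twisted_def W(3) by blast
  \<comment> \<open>The error coefficients vanish at \<open>w\<close>, whose length is not below its
    own bound; this free place takes the leading coefficient.\<close>
  let ?r = "r(w := q)"
  have "d * act Q \<mu> 1 (path w X) p = (\<Sum>u \<in> nf_between X Y. ?r u * twist u X p)" for p :: "'k mpoly"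
  proof -
    have "(\<Sum>u \<in> nf_between X Y. r u * twist u X p) = (\<Sum>u \<in> nf_between X Y - {w}. r u * twist u X p)"
      using d(3) w by (subst sum.remove[OF finite_nf_between w]) simp
    also have "\<dots> = (\<Sum>u \<in> nf_between X Y - {w}. ?r u * twist u X p)" by (intro sum.cong) auto
    finally show ?thesis using d(4)[of p] by (subst sum.remove[OF finite_nf_between w]) (simp add: algebra_simps)
  qed
  then show ?thesis using d by (intro exI[of _ d] exI[of _ ?r]) auto
qed

lemma act_path_sum:
  assumes "X \<in> words Q" "set w \<subseteq> {..<length X}"
  shows "act Q \<mu> 1 (path w X) (\<Sum>a\<in>A. const (c a) * f a) = (\<Sum>a\<in>A. const (c a) * act Q \<mu> 1 (path w X) (f a :: 'k::field mpoly))"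
proof -
  have "mor_in Q \<tau> oKLRW (path w X :: ('i, 'k) mor)" using assms by simp
  from act_linear[OF this, of 1] show ?thesis
    by (induction A rule: infinite_finite_induct) simp_all
qed

lemma act_dotmonom_single:
  fixes p :: "'k::field mpoly"
  assumes "Poly_Mapping.keys m \<subseteq> {1..nblack X}"
  shows "act Q \<mu> 1 (dotmonom 1 X m) p = Poly_Mapping.single m 1 * p"
proof -
  have "Poly_Mapping.single m (1 :: 'k) = (\<Prod>j\<in>Poly_Mapping.keys m. Var j ^ Poly_Mapping.lookup m j)"
    using monom_expand[of m "1 :: 'k"] by simp
  also have "\<dots> = (\<Prod>j\<in>{1..nblack X}. Var j ^ Poly_Mapping.lookup m j)"
    by (rule mono_prod_superset) (use assms in auto)
  also have "\<dots> = (\<Prod>t<nblack X. Var (1 + t) ^ Poly_Mapping.lookup m (1 + t))"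
    by (simp add: prod.atLeast1_atMost_eq)
  finally show ?thesis unfolding act_dotmonom by simp
qed

text \<open>Among the words that occur, a longest one cannot be reached by the error terms of the
  others. The coefficient of its automorphism comes from its own diagram alone and is nonzero,
  against the independence of the automorphisms.\<close>

theorem diagrams_independent:
  fixes c :: "nat list \<times> (nat \<Rightarrow>\<^sub>0 nat) \<Rightarrow> 'k::field"
  assumes X: "X \<in> words Q" and L: "finite L" "L \<subseteq> basis X Y"
    and zero: "\<And>p. p \<in> polys (nblack X) \<Longrightarrow> (\<Sum>b\<in>L. const (c b) * act Q \<mu> 1 (diagram X b) p) = 0"
    and b: "b \<in> L"
  shows "c b = 0"
proof (rule ccontr)
  assume cb: "c b \<noteq> 0"
  \<comment> \<open>All monomials attached to one word are gathered in a polynomial, to which the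
    operator of the path is applied.\<close>
  define P where "P w = (\<Sum>b\<in>{b\<in>L. fst b = w}. Poly_Mapping.single (snd b) (c b))" for w
  define W where "W = {w \<in> fst ` L. P w \<noteq> 0}"
  have W: "finite W" "W \<subseteq> nf_between X Y"
    using L by (auto simp: W_def nf_between_def basis_def)
  \<comment> \<open>Different basis elements over one word have different monomials, so nothing
    cancels in \<open>P\<close>.\<close>
  have "Poly_Mapping.lookup (P (fst b)) (snd b) = c b"
  proof -
    have "Poly_Mapping.lookup (P (fst b)) (snd b) = (\<Sum>b'\<in>{b'\<in>L. fst b' = fst b}. if b' = b then c b' else 0)"
      unfolding P_def lookup_sum by (intro sum.cong) (auto simp: lookup_single when_def prod_eq_iff)
    then show ?thesis using b L(1) by simp
  qed
  then have "P (fst b) \<noteq> 0" using cb by auto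
  then have "fst b \<in> W" using b by (simp add: W_def)
  then have "Max (length ` W) \<in> length ` W" using W(1) by (intro Max_in) auto
  then obtain w0 where w0: "w0 \<in> W" "\<And>w. w \<in> W \<Longrightarrow> length w \<le> length w0"
    using W(1) by (metis (no_types, lifting) Max_ge finite_imageI image_iff imageI)
  have sum0: "(\<Sum>w\<in>W. act Q \<mu> 1 (path w X) (P w * p)) = 0" if p: "p \<in> polys (nblack X)" for p
  proof -
    have d: "const (c b) * act Q \<mu> 1 (diagram X b) p =
        const (c b) * act Q \<mu> 1 (path (fst b) X) (Poly_Mapping.single (snd b) 1 * p)" if "b \<in> L" for b
    proof -
      have "Poly_Mapping.keys (snd b) \<subseteq> {1..nblack X}" using that L(2) by (force simp: basis_def)
      from act_dotmonom_single[OF this, where 'k = 'k] show ?thesis by (simp add: diagram_def case_prod_unfold)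
    qed
    have Pp: "P w * p = (\<Sum>b\<in>{b\<in>L. fst b = w}. const (c b) * (Poly_Mapping.single (snd b) 1 * p))" for w
      unfolding P_def sum_distrib_right
      by (intro sum.cong) (simp_all add: const_def mult_single flip: mult.assoc)
    have "0 = (\<Sum>b\<in>L. const (c b) * act Q \<mu> 1 (diagram X b) p)" using zero[OF p] by simp
    also have "\<dots> = (\<Sum>b\<in>L. const (c b) * act Q \<mu> 1 (path (fst b) X) (Poly_Mapping.single (snd b) 1 * p))"
      by (intro sum.cong d) simp_all
    also have "\<dots> = (\<Sum>w\<in>fst ` L. \<Sum>b\<in>{b\<in>L. fst b = w}.
        const (c b) * act Q \<mu> 1 (path (fst b) X) (Poly_Mapping.single (snd b) 1 * p))"
      by (rule sum.image_gen[OF L(1)])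
    also have "\<dots> = (\<Sum>w\<in>fst ` L. act Q \<mu> 1 (path w X) (P w * p))"
    proof (intro sum.cong refl)
      fix w assume "w \<in> fst ` L"
      then have "w \<in> nf (length X)" using L(2) by (force simp: basis_def)
      then have "set w \<subseteq> {..<length X}" by (rule set_nf)
      then show "(\<Sum>b\<in>{b\<in>L. fst b = w}. const (c b) * act Q \<mu> 1 (path (fst b) X) (Poly_Mapping.single (snd b) 1 * p)) =
          act Q \<mu> 1 (path w X) (P w * p)"
        unfolding Pp by (subst act_path_sum[OF X]) (simp, intro sum.cong, simp_all)
    qed
    also have "\<dots> = (\<Sum>w\<in>W. act Q \<mu> 1 (path w X) (P w * p))"
      using L(1) by (intro sum.mono_neutral_right) (auto simp: W_def)
    finally show ?thesis by simp
  qed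
  have "\<forall>w\<in>W. \<exists>d r. d \<noteq> 0 \<and> r w \<noteq> 0 \<and> (\<forall>u. u \<noteq> w \<and> length w \<le> length u \<longrightarrow> r u = 0) \<and>
      (\<forall>p :: 'k mpoly. d * act Q \<mu> 1 (path w X) p = (\<Sum>u \<in> nf_between X Y. r u * twist u X p))"
    using act_path_expand[OF X] W(2) by blast
  from bchoice[OF this] obtain d where "\<forall>w\<in>W. \<exists>r. d w \<noteq> 0 \<and> r w \<noteq> 0 \<and>
      (\<forall>u. u \<noteq> w \<and> length w \<le> length u \<longrightarrow> r u = 0) \<and>
      (\<forall>p :: 'k mpoly. d w * act Q \<mu> 1 (path w X) p = (\<Sum>u \<in> nf_between X Y. r u * twist u X p))" ..
  from bchoice[OF this] obtain r where "\<forall>w\<in>W. d w \<noteq> 0 \<and> r w w \<noteq> 0 \<and>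
      (\<forall>u. u \<noteq> w \<and> length w \<le> length u \<longrightarrow> r w u = 0) \<and>
      (\<forall>p :: 'k mpoly. d w * act Q \<mu> 1 (path w X) p = (\<Sum>u \<in> nf_between X Y. r w u * twist u X p))" ..
  then have dr: "\<And>w. w \<in> W \<Longrightarrow> d w \<noteq> 0" "\<And>w. w \<in> W \<Longrightarrow> r w w \<noteq> 0"
    "\<And>w u. w \<in> W \<Longrightarrow> u \<noteq> w \<Longrightarrow> length w \<le> length u \<Longrightarrow> r w u = 0"
    "\<And>w p. w \<in> W \<Longrightarrow> d w * act Q \<mu> 1 (path w X) p = (\<Sum>u \<in> nf_between X Y. r w u * (twist u X p :: 'k mpoly))"
    by blast+
  \<comment> \<open>Every path has its own factor \<open>d w\<close>. The product over
    \<open>W\<close> is a common multiple of them, and \<open>D w\<close> is the complementary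
    factor.\<close>
  define D where "D w = (\<Prod>v\<in>W - {w}. d v)" for w
  have D: "(\<Prod>v\<in>W. d v) = D w * d w" if "w \<in> W" for w
    unfolding D_def using prod.remove[OF W(1) that, of d] by (simp add: mult.commute)
  \<comment> \<open>The automorphism of \<open>u\<close> is multiplicative on the product of
    \<open>P w\<close> and \<open>p\<close>, so \<open>P w\<close> enters the coefficient of
    \<open>u\<close> in transformed form, which is nonzero whenever \<open>P w\<close> is.\<close>
  define R where "R u = (\<Sum>w\<in>W. D w * r w u * twist u X (P w))" for u
  have "R w0 = 0"
  proof (rule multiplicative_independent[where M = "polys (nblack X)" and \<phi> = "\<lambda>u. twist u X"])
    fix p :: "'k mpoly" assume p: "p \<in> polys (nblack X)"
    have "0 = (\<Prod>v\<in>W. d v) * (\<Sum>w\<in>W. act Q \<mu> 1 (path w X) (P w * p))" using sum0[OF p] by simp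
    also have "\<dots> = (\<Sum>w\<in>W. D w * (d w * act Q \<mu> 1 (path w X) (P w * p)))"
      unfolding sum_distrib_left by (intro sum.cong) (simp_all add: D mult.assoc)
    also have "\<dots> = (\<Sum>w\<in>W. \<Sum>u \<in> nf_between X Y. D w * r w u * twist u X (P w) * twist u X p)"
      by (intro sum.cong) (simp_all add: dr(4)[unfolded One_nat_def] sum_distrib_left mult.assoc)
    also have "\<dots> = (\<Sum>u \<in> nf_between X Y. R u * twist u X p)"
      unfolding R_def sum_distrib_right by (rule sum.swap)
    finally show "(\<Sum>u \<in> nf_between X Y. R u * twist u X p) = 0" by simp
  next
    fix u v assume uv: "u \<in> nf_between X Y" "v \<in> nf_between X Y" "u \<noteq> v"
    show "\<exists>x\<in>polys (nblack X). twist u X x \<noteq> (twist v X x :: 'k mpoly)"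
    proof (rule ccontr)
      assume *: "\<not> (\<exists>x\<in>polys (nblack X). twist u X x \<noteq> (twist v X x :: 'k mpoly))"
      have "u = v" by (rule nf_between_separated[OF X uv(1,2), where 'k = 'k]) (use * in auto)
      then show False using uv(3) by simp
    qed
  next
    show "w0 \<in> nf_between X Y" using W(2) w0(1) by blast
  qed (simp_all add: finite_nf_between)
  moreover have "R w0 = D w0 * r w0 w0 * twist w0 X (P w0)"
  proof -
    \<comment> \<open>No other word of \<open>W\<close> is longer than \<open>w0\<close>, and an
      expansion contains, besides its own word, only strictly shorter ones.\<close>
    have "(\<Sum>w\<in>W - {w0}. D w * r w w0 * twist w0 X (P w)) = 0"
    proof (intro sum.neutral ballI)
      fix w assume "w \<in> W - {w0}"
      then have "r w w0 = 0" using w0(2) by (intro dr(3)) auto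
      then show "D w * r w w0 * twist w0 X (P w) = 0" by simp
    qed
    then show ?thesis unfolding R_def by (simp add: sum.remove[OF W(1) w0(1)])
  qed
  moreover have "D w0 \<noteq> 0" unfolding D_def using dr(1) W(1) by auto
  moreover have "P w0 \<noteq> 0" using w0(1) by (simp add: W_def)
  ultimately show False using dr(2)[OF w0(1)] by simp
qed

section \<open>Expansions over finite lists of diagrams\<close>

primrec lincomb :: "'i word \<Rightarrow> 'i word \<Rightarrow> (nat list \<times> (nat \<Rightarrow>\<^sub>0 nat) \<Rightarrow> 'k::field) \<Rightarrow>
    (nat list \<times> (nat \<Rightarrow>\<^sub>0 nat)) list \<Rightarrow> ('i, 'k) mor" where
  "lincomb X Y c [] = Zero X Y"
| "lincomb X Y c (b # L) = c b \<odot> diagram X b \<oplus> lincomb X Y c L"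

lemma lincomb_typing [simp]:
  assumes "X \<in> words Q" "Y \<in> words Q" "set L \<subseteq> basis X Y"
  shows "src (lincomb X Y c L) = X" "tgt \<tau> (lincomb X Y c L) = Y" "mor_in Q \<tau> oKLRW (lincomb X Y c L)"
proof -
  have "src (lincomb X Y c L) = X \<and> tgt \<tau> (lincomb X Y c L) = Y \<and> mor_in Q \<tau> oKLRW (lincomb X Y c L)"
    using assms by (induction L) auto
  then show "src (lincomb X Y c L) = X" "tgt \<tau> (lincomb X Y c L) = Y" "mor_in Q \<tau> oKLRW (lincomb X Y c L)"
    by auto
qed

lemma act_lincomb:
  "distinct L \<Longrightarrow> act Q \<mu> r (lincomb X Y c L) p = (\<Sum>b\<in>set L. const (c b) * act Q \<mu> r (diagram X b) p)"
  by (induction L) simp_all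

lemma scale_0_diagram:
  assumes "b \<in> basis X Y" "X \<in> words Q"
  shows "0 \<odot> diagram X b \<approx> (Zero X Y :: ('i, 'k::field) mor)"
  using scale_0[of oKLRW "diagram X b :: ('i, 'k) mor"] assms by simp

lemma lincomb_zero:
  assumes "X \<in> words Q" "Y \<in> words Q"
  shows "set L \<subseteq> basis X Y \<Longrightarrow> (\<And>b. b \<in> set L \<Longrightarrow> c b = 0) \<Longrightarrow> lincomb X Y c L \<approx> Zero X Y"
proof (induction L)
  case Nil
  then show ?case using assms by (auto intro: meq_refl)
next
  case (Cons b L)
  have "c b \<odot> diagram X b \<approx> Zero X Y" using Cons.prems assms by (simp add: scale_0_diagram)
  moreover have IH: "lincomb X Y c L \<approx> Zero X Y" using Cons by simp
  ultimately have "c b \<odot> diagram X b \<oplus> lincomb X Y c L \<approx> lincomb X Y c L"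
    using Cons.prems assms by (intro add_zero_left) auto
  then show ?case unfolding lincomb.simps using IH by (rule meq_trans)
qed

lemma lincomb_single:
  assumes "X \<in> words Q" "Y \<in> words Q"
  shows "set L \<subseteq> basis X Y \<Longrightarrow> distinct L \<Longrightarrow> b \<in> set L \<Longrightarrow>
    lincomb X Y (\<lambda>b'. if b' = b then 1 else 0) L \<approx> (diagram X b :: ('i, 'k::field) mor)"
proof (induction L)
  case (Cons b' L)
  let ?c = "\<lambda>b'. if b' = b then 1 else 0 :: 'k"
  show ?case
  proof (cases "b' = b")
    case True
    have "lincomb X Y ?c L \<approx> Zero X Y" using Cons.prems assms True by (intro lincomb_zero) auto
    then have "1 \<odot> diagram X b \<oplus> lincomb X Y ?c L \<approx> 1 \<odot> diagram X b"
      using Cons.prems assms True by (intro add_zero_right) auto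
    also have "\<dots> \<approx> diagram X b" using Cons.prems assms by (intro meq_scale_one) auto
    finally show ?thesis using True by simp
  next
    case False
    have "0 \<odot> diagram X b' \<approx> (Zero X Y :: ('i, 'k) mor)"
      using Cons.prems assms by (simp add: scale_0_diagram)
    then have "0 \<odot> diagram X b' \<oplus> lincomb X Y ?c L \<approx> lincomb X Y ?c L"
      using Cons.prems assms by (intro add_zero_left) auto
    also have "\<dots> \<approx> diagram X b" using Cons False by simp
    finally show ?thesis using False by simp
  qed
qed simp

lemma add_add_exchange:
  assumes "mor_in Q \<tau> C (f \<oplus> g \<oplus> (h \<oplus> k))"
  shows "f \<oplus> g \<oplus> (h \<oplus> k) \<approx>\<^bsub>C\<^esub> f \<oplus> h \<oplus> (g \<oplus> k)"
proof -
  have "f \<oplus> g \<oplus> (h \<oplus> k) \<approx>\<^bsub>C\<^esub> f \<oplus> (g \<oplus> (h \<oplus> k))"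
    using assms by (intro meq_add_assoc) auto
  also have "\<dots> \<approx>\<^bsub>C\<^esub> f \<oplus> (g \<oplus> h \<oplus> k)"
    using assms by (intro meq_add_cong meq_sym[OF meq_add_assoc]) (auto intro: meq_refl)
  also have "\<dots> \<approx>\<^bsub>C\<^esub> f \<oplus> (h \<oplus> g \<oplus> k)"
    using assms by (intro meq_add_cong add_commute_eqv) (auto intro: meq_refl)
  also have "\<dots> \<approx>\<^bsub>C\<^esub> f \<oplus> (h \<oplus> (g \<oplus> k))"
    using assms by (intro meq_add_cong meq_add_assoc) (auto intro: meq_refl)
  also have "\<dots> \<approx>\<^bsub>C\<^esub> f \<oplus> h \<oplus> (g \<oplus> k)"
    using assms by (intro meq_sym[OF meq_add_assoc]) auto
  finally show ?thesis .
qed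

lemma lincomb_add:
  assumes "X \<in> words Q" "Y \<in> words Q"
  shows "set L \<subseteq> basis X Y \<Longrightarrow>
    lincomb X Y c L \<oplus> lincomb X Y d L \<approx> lincomb X Y (\<lambda>b. c b + d b) L"
proof (induction L)
  case Nil
  then show ?case using assms meq_add_zero[of Q \<tau> oKLRW "Zero X Y"] by simp
next
  case (Cons b L)
  have "lincomb X Y c (b # L) \<oplus> lincomb X Y d (b # L) \<approx>
      c b \<odot> diagram X b \<oplus> d b \<odot> diagram X b \<oplus> (lincomb X Y c L \<oplus> lincomb X Y d L)"
    unfolding lincomb.simps using assms Cons.prems by (intro add_add_exchange) auto
  also have "\<dots> \<approx> (c b + d b) \<odot> diagram X b \<oplus> lincomb X Y (\<lambda>b. c b + d b) L"
    using assms Cons by (intro meq_add_cong meq_sym[OF meq_scale_add_left]) auto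
  finally show ?case by simp
qed

lemma lincomb_scale:
  assumes "X \<in> words Q" "Y \<in> words Q"
  shows "set L \<subseteq> basis X Y \<Longrightarrow> e \<odot> lincomb X Y c L \<approx> lincomb X Y (\<lambda>b. e * c b) L"
proof (induction L)
  case Nil
  have "e \<odot> Zero X Y \<approx> e \<odot> 0 \<odot> Zero X Y" using assms by (intro meq_scale_cong Zero_scale_0)
  also have "\<dots> \<approx> (e * 0) \<odot> Zero X Y" using assms by (intro meq_scale_scale) simp
  also have "\<dots> \<approx> Zero X Y" using assms scale_0[of oKLRW "Zero X Y"] by simp
  finally show ?case by simp
next
  case (Cons b L)
  have "e \<odot> lincomb X Y c (b # L) \<approx> e \<odot> c b \<odot> diagram X b \<oplus> e \<odot> lincomb X Y c L"
    unfolding lincomb.simps using assms Cons.prems by (intro meq_scale_add_right) auto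
  also have "\<dots> \<approx> (e * c b) \<odot> diagram X b \<oplus> lincomb X Y (\<lambda>b. e * c b) L"
    using assms Cons by (intro meq_add_cong meq_scale_scale) auto
  finally show ?case by simp
qed

text \<open>The expansion is given on every list that contains the support \<open>S\<close>, so that
  two expansions can be brought to one common list before their coefficients are added.\<close>

lemma spanned_lincomb:
  fixes f :: "('i, 'k::field) mor"
  assumes "spanned X Y n f" "X \<in> words Q" "Y \<in> words Q"
  shows "\<exists>S c. finite S \<and> S \<subseteq> basis X Y \<and>
    (\<forall>L. distinct L \<longrightarrow> S \<subseteq> set L \<longrightarrow> set L \<subseteq> basis X Y \<longrightarrow> f \<approx> lincomb X Y c L)"
  using assms(1)
proof (induction rule: spanned.induct)
  case spanned_Zero
  show ?case using assms(2,3) meq_sym[OF lincomb_zero[of X Y _ "\<lambda>b. 0"]]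
    by (intro exI[of _ "{}"] exI[of _ "\<lambda>b. 0"]) auto
next
  case (spanned_diagram b)
  then show ?case using assms(2,3)
    by (intro exI[of _ "{b}"] exI[of _ "\<lambda>b'. if b' = b then 1 else 0"]) (auto intro!: meq_sym[OF lincomb_single])
next
  case (spanned_add f g)
  then obtain S c T d where *: "finite S" "S \<subseteq> basis X Y" "finite T" "T \<subseteq> basis X Y"
    "\<And>L. distinct L \<Longrightarrow> S \<subseteq> set L \<Longrightarrow> set L \<subseteq> basis X Y \<Longrightarrow> f \<approx> lincomb X Y c L"
    "\<And>L. distinct L \<Longrightarrow> T \<subseteq> set L \<Longrightarrow> set L \<subseteq> basis X Y \<Longrightarrow> g \<approx> lincomb X Y d L" by metis
  have "f \<oplus> g \<approx> lincomb X Y (\<lambda>b. c b + d b) L"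
    if L: "distinct L" "S \<union> T \<subseteq> set L" "set L \<subseteq> basis X Y" for L
  proof -
    have "f \<oplus> g \<approx> lincomb X Y c L \<oplus> lincomb X Y d L"
      using L * assms(2,3) spanned_typing[OF spanned_add.hyps(1) assms(2,3)]
        spanned_typing[OF spanned_add.hyps(2) assms(2,3)] by (intro meq_add_cong) auto
    also have "\<dots> \<approx> lincomb X Y (\<lambda>b. c b + d b) L" using L assms(2,3) by (intro lincomb_add)
    finally show ?thesis .
  qed
  then show ?case using *(1-4) by (intro exI[of _ "S \<union> T"] exI[of _ "\<lambda>b. c b + d b"]) auto
next
  case (spanned_scale f e)
  then obtain S c where *: "finite S" "S \<subseteq> basis X Y"
    "\<And>L. distinct L \<Longrightarrow> S \<subseteq> set L \<Longrightarrow> set L \<subseteq> basis X Y \<Longrightarrow> f \<approx> lincomb X Y c L" by metis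
  have "e \<odot> f \<approx> lincomb X Y (\<lambda>b. e * c b) L"
    if L: "distinct L" "S \<subseteq> set L" "set L \<subseteq> basis X Y" for L
  proof -
    have "e \<odot> f \<approx> e \<odot> lincomb X Y c L" using L * by (intro meq_scale_cong)
    also have "\<dots> \<approx> lincomb X Y (\<lambda>b. e * c b) L" using L assms(2,3) by (intro lincomb_scale)
    finally show ?thesis .
  qed
  then show ?case using *(1,2) by (intro exI[of _ S] exI[of _ "\<lambda>b. e * c b"]) auto
next
  case (spanned_eqv f g)
  then obtain S c where *: "finite S" "S \<subseteq> basis X Y"
    "\<And>L. distinct L \<Longrightarrow> S \<subseteq> set L \<Longrightarrow> set L \<subseteq> basis X Y \<Longrightarrow> f \<approx> lincomb X Y c L" by metis
  have "g \<approx> lincomb X Y c L" if L: "distinct L" "S \<subseteq> set L" "set L \<subseteq> basis X Y" for L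
    using meq_sym[OF spanned_eqv.hyps(2)] *(3)[OF L] by (rule meq_trans)
  then show ?case using *(1,2) by (intro exI[of _ S] exI[of _ c]) auto
qed

text \<open>The difference of \<open>f\<close> and \<open>g\<close> acts by zero. Its expansion in
  diagrams of normal forms acts in the same way, so independence kills all coefficients.\<close>

theorem faithful:
  fixes f g :: "('i, 'k::field) mor"
  assumes "f \<in> oKLRW_exprs Q \<tau> X Y" "g \<in> oKLRW_exprs Q \<tau> X Y" "poly_op Q \<mu> f = poly_op Q \<mu> g"
  shows "f \<approx> g"
proof -
  have f: "mor_in Q \<tau> oKLRW f" "src f = X" "tgt \<tau> f = Y" and g: "mor_in Q \<tau> oKLRW g" "src g = X" "tgt \<tau> g = Y"
    using assms(1,2) by (auto simp: oKLRW_exprs_def)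
  have XY: "X \<in> words Q" "Y \<in> words Q" using mor_in_words[OF f(1)] f by auto
  let ?h = "f \<ominus> g"
  have h: "mor_in Q \<tau> oKLRW ?h" using f g by simp
  have "spanned X Y (ncross ?h) ?h" using filt_spanned[OF filt_ncross[OF h]] f by simp
  from spanned_lincomb[OF this XY] obtain S c where S: "finite S" "S \<subseteq> basis X Y"
    "\<And>L. distinct L \<Longrightarrow> S \<subseteq> set L \<Longrightarrow> set L \<subseteq> basis X Y \<Longrightarrow> ?h \<approx> lincomb X Y c L" by metis
  obtain L where L: "set L = S" "distinct L" using finite_distinct_list[OF S(1)] by blast
  have hL: "?h \<approx> lincomb X Y c L" using S L by auto
  have "(\<Sum>b\<in>S. const (c b) * act Q \<mu> 1 (diagram X b) p) = 0" if p: "p \<in> polys (nblack X)" for p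
  proof -
    have "act Q \<mu> 1 f p = act Q \<mu> 1 g p"
      using fun_cong[OF assms(3), of p] p f g by (simp add: poly_op_def)
    then have "act Q \<mu> 1 ?h p = 0" unfolding act_diff by simp
    moreover have "act Q \<mu> 1 ?h p = act Q \<mu> 1 (lincomb X Y c L) p"
      using hL by (rule act_mor_eq) simp_all
    ultimately show ?thesis using L by (simp add: act_lincomb)
  qed
  then have "c b = 0" if "b \<in> S" for b
    using diagrams_independent[OF XY(1) S(1,2) _ that] by blast
  then have "lincomb X Y c L \<approx> Zero X Y" using L S(2) by (intro lincomb_zero XY) auto
  with hL have "?h \<approx> Zero X Y" by (rule meq_trans)
  then show ?thesis by (rule eqv_diff_zeroD)
qed

end

theorem corollary2p16:
  fixes Q :: "('i, 'a) pre_digraph" and \<tau> :: "'i \<Rightarrow> 'i" and \<tau>\<^sub>1 :: "'a \<Rightarrow> 'a"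
    and \<mu> :: "'i weight" and X Y :: "'i word"
  assumes "involutive_quiver Q \<tau> \<tau>\<^sub>1"
    and "\<mu> \<in> dominant_weights Q"
    and "X \<in> words Q" and "Y \<in> words Q"
  shows "inj_on (poly_rep Q \<mu>) (oKLRW_Hom Q \<tau> \<mu> X Y :: ('i, 'k::alg_closed_field) mor set set)"
proof (rule inj_onI)
  interpret oklrw Q \<tau> \<tau>\<^sub>1 \<mu> by (rule oklrw.intro) fact
  fix F G :: "('i, 'k) mor set"
  assume FG: "F \<in> oKLRW_Hom Q \<tau> \<mu> X Y" "G \<in> oKLRW_Hom Q \<tau> \<mu> X Y" and eq: "poly_rep Q \<mu> F = poly_rep Q \<mu> G"
  obtain f where f: "f \<in> oKLRW_exprs Q \<tau> X Y" "F = oKLRW_eq Q \<tau> \<mu> X Y `` {f}"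
    using FG(1) unfolding oKLRW_Hom_def by (rule quotientE)
  obtain g where g: "g \<in> oKLRW_exprs Q \<tau> X Y" "G = oKLRW_eq Q \<tau> \<mu> X Y `` {g}"
    using FG(2) unfolding oKLRW_Hom_def by (rule quotientE)
  have "poly_op Q \<mu> f = poly_op Q \<mu> g"
    using eq poly_rep_class[OF f(1)] poly_rep_class[OF g(1)] unfolding f(2) g(2) by simp
  then have "mor_eq Q \<tau> \<mu> oKLRW f g" by (rule faithful[OF f(1) g(1)])
  then have "(f, g) \<in> oKLRW_eq Q \<tau> \<mu> X Y" using f(1) g(1) by (simp add: oKLRW_eq_def)
  then show "F = G" unfolding f(2) g(2) by (rule equiv_class_eq[OF equiv_oKLRW_eq])
qed

end
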